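(* For every integer $n\ge 0$, \[ N^{0}(0,8;8n+r)>N^{0}(4,8;8n+r)\quad (r\in\{1,3\}),\qquad N^{0}(1,8;8n+2)>N^{0}(3,8;8n+2), \] and for every integer $n\ge 1$, $N^{0}(1,8;8n)>N^{0}(3,8;8n)$.
   Context: An odd Durfee symbol of a positive integer $n$ consists of a nonnegative integer $D$ together with two (possibly empty) non-increasing sequences of odd positive integers $a_1\ge\cdots\ge a_s$ (top row) and $b_1\ge\cdots\ge b_t$ (bottom row), all entries at most $2D+1$, such that $n=\sum a_i+\sum b_j+2D^2+2D+1$. Its odd rank is $s-t$. $N^{0}(a,M;n)$ is the number of odd Durfee symbols of $n$ whose odd rank is congruent to $a$ modulo $M$. *)

theory Defs
  imports "HOL-Number_Theory.Cong"
begin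

(* The triple (D, as, bs) is the symbol with subscript D, top row as and bottom row bs. *)
definition odd_durfee_symbols :: "nat \<Rightarrow> (nat \<times> nat list \<times> nat list) set" where
  "odd_durfee_symbols n =
     {(D, as, bs).
        sorted_wrt (\<ge>) as \<and> sorted_wrt (\<ge>) bs \<and>
        (\<forall>x \<in> set as \<union> set bs. odd x \<and> x \<le> 2 * D + 1) \<and>
        n = sum_list as + sum_list bs + 2 * D\<^sup>2 + 2 * D + 1}"

definition odd_rank :: "nat \<times> nat list \<times> nat list \<Rightarrow> int" where
  "odd_rank = (\<lambda>(D, as, bs). int (length as) - int (length bs))"

definition N0 :: "int \<Rightarrow> int \<Rightarrow> nat \<Rightarrow> nat" where
  "N0 a M n = card {S \<in> odd_durfee_symbols n. [odd_rank S = a] (mod M)}"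

(* Hence the cardinality in N0 is never the default value 0 for infinite sets. *)
lemma finite_odd_durfee_symbols: "finite (odd_durfee_symbols n)"
proof -
  have len: "length xs \<le> sum_list xs" if "\<forall>x \<in> set xs. odd x" for xs :: "nat list"
    using that
  proof (induction xs)
    case (Cons x xs)
    then have "1 \<le> x" by (cases x) auto
    with Cons show ?case by auto
  qed simp
  let ?L = "{xs. set xs \<subseteq> {..n} \<and> length xs \<le> n}"
  have "odd_durfee_symbols n \<subseteq> {..n} \<times> ?L \<times> ?L"
  proof
    fix S assume "S \<in> odd_durfee_symbols n"
    then obtain D as bs where S: "S = (D, as, bs)"
      and odd: "\<forall>x \<in> set as. odd x" "\<forall>x \<in> set bs. odd x"
      and n: "n = sum_list as + sum_list bs + 2 * D\<^sup>2 + 2 * D + 1"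
      by (auto simp: odd_durfee_symbols_def)
    have "set as \<subseteq> {..n}" "set bs \<subseteq> {..n}"
      using n by (auto dest!: member_le_sum_list)
    moreover have "length as \<le> n" "length bs \<le> n" "D \<le> n"
      using n len[OF odd(1)] len[OF odd(2)] by linarith+
    ultimately show "S \<in> {..n} \<times> ?L \<times> ?L" using S by simp
  qed
  moreover have "finite ?L" by (rule finite_lists_length_le) simp
  ultimately show ?thesis by (meson finite_SigmaI finite_atMost finite_subset)
qed

end

theory Submission
  imports "HOL-Analysis.Analysis" "HOL-Computational_Algebra.Polynomial" Defs
begin

text \<open>
  Let \<open>\<zeta>\<close> be a primitive eighth root of unity. The generating function of the odd rank at \<open>\<zeta>\<close> is
  \<open>R(q) = \<Sum>n. q^(2 n^2 + 2 n + 1) / ((\<zeta> q; q^2)_(n+1) (q / \<zeta>; q^2)_(n+1))\<close>; by the parity of the rank and its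
  symmetry, its coefficient of \<open>q^n\<close> is \<open>N(0,8;n) - N(4,8;n)\<close> for odd \<open>n\<close> and
  \<open>sqrt 2 (N(1,8;n) - N(3,8;n))\<close> for even \<open>n\<close>.

  Partial fractions and the Durfee rectangle identity turn \<open>R\<close> into an Appell sum. The same sum is one of the
  three parts of the partial fraction expansion of the reciprocal of a product of three theta functions in
  base \<open>q^2\<close> with zeros at \<open>z = q^(2 n + 1)\<close> and \<open>z = \<plusminus> \<i> q^(2 n)\<close>; at \<open>z = \<zeta>\<close> the other two parts combine, after
  splitting the summation index by parity, into the third order mock theta functions
  \<open>\<phi>(q^8)\<close> and \<open>\<nu>(q^8)\<close>. Completing these to bilateral series, which are theta quotients, exchanges them for
  series with positive coefficients, and all remaining theta quotients collapse to
  \<open>R(q) = q \<theta>(t) (-t^2; t^2)_\<infinity> + q^3 \<Sum>m. t^m (-t; t^2)_m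
     + sqrt 2 (q^2 (-t; t^2)_\<infinity> \<Sum>n. t^(n^2 + n) + \<Sum>m. t^(m + 1) (-t^2; t^2)_m)\<close>
  with \<open>t = q^8\<close> and \<open>\<theta>(t)\<close> the sum of \<open>t^(n^2)\<close> over all integers. The four residue classes modulo 8 are
  thus separated, and each has positive coefficients.
\<close>

section \<open>The q-Pochhammer symbol\<close>

text \<open>The mock theta functions enter \<open>R\<close> with a minus sign and have coefficients
  of both signs, so positivity is invisible until they are removed. What makes this possible is a
  coincidence of theta quotients: the quotient in the three-theta identity, dissected by the
  exponent of \<open>q\<close> modulo 8, contains in the classes 0 and 3 exactly the quotients that
  complete phi and nu to bilateral series, while the classes 1 and 2 contain no mock part and are
  products already. The first of the three zero families is forced by the rank series. The other two
  are placed so that their positions cancel in its residues, which makes these a plain Appell sum,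
  and so that up to a power of \<open>q\<close> they differ by a sign, which lets the parity of the
  index recombine their residues.

  All identities are proved for complex \<open>q\<close> with \<open>0 < norm q < 1\<close> and not
  for formal power series, since two-sided sums need negative powers of \<open>q\<close>;
  coefficients are compared only at the very end.\<close>

definition qpoch :: "complex \<Rightarrow> complex \<Rightarrow> nat \<Rightarrow> complex" where
  "qpoch a p n = (\<Prod>k<n. 1 - a * p ^ k)"

definition qpoch_inf :: "complex \<Rightarrow> complex \<Rightarrow> complex" where
  "qpoch_inf a p = (\<Prod>k. 1 - a * p ^ k)"

lemma qpoch_0 [simp]: "qpoch a p 0 = 1"
  by (simp add: qpoch_def)

lemma qpoch_Suc: "qpoch a p (Suc n) = qpoch a p n * (1 - a * p ^ n)"
  by (simp add: qpoch_def)

lemma qpoch_Suc_shift: "qpoch a p (Suc n) = (1 - a) * qpoch (a * p) p n"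
  unfolding qpoch_def by (subst prod.lessThan_Suc_shift) (simp add: mult_ac)

lemma qpoch_add: "qpoch a p (m + n) = qpoch a p m * qpoch (a * p ^ m) p n"
  by (induction n) (simp_all add: qpoch_Suc power_add mult_ac)

lemma convergent_prod_qpoch:
  fixes a p :: complex
  assumes "norm p < 1"
  shows "convergent_prod (\<lambda>k. 1 - a * p ^ k)"
proof (intro abs_convergent_prod_imp_convergent_prod summable_imp_abs_convergent_prod)
  show "summable (\<lambda>k. norm ((1 - a * p ^ k) - 1))"
    using assms by (simp add: norm_mult norm_power summable_mult summable_geometric)
qed

lemma qpoch_tendsto:
  assumes "norm p < 1"
  shows "qpoch a p \<longlonglongrightarrow> qpoch_inf a p"
proof -
  have "(\<lambda>n. qpoch a p (Suc n)) \<longlonglongrightarrow> qpoch_inf a p"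
    using convergent_prod_LIMSEQ[OF convergent_prod_qpoch[OF assms, of a]]
    unfolding qpoch_def qpoch_inf_def lessThan_Suc_atMost .
  thus ?thesis by (simp only: filterlim_sequentially_Suc)
qed

lemma qpoch_inf_nonzero:
  assumes "norm p < 1" "\<And>k. a * p ^ k \<noteq> 1"
  shows "qpoch_inf a p \<noteq> 0"
  unfolding qpoch_inf_def
  by (rule prodinf_nonzero[OF convergent_prod_qpoch]) (use assms in auto)

lemma qpoch_inf_nonzero':
  assumes "norm p < 1" "norm a < 1"
  shows "qpoch_inf a p \<noteq> 0"
proof (rule qpoch_inf_nonzero[OF assms(1)])
  fix k
  have "norm (a * p ^ k) \<le> norm a * 1"
    unfolding norm_mult norm_power using assms
    by (intro mult_left_mono power_le_one) auto
  with assms(2) show "a * p ^ k \<noteq> 1" by auto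
qed

lemma qpoch_nonzero:
  assumes "\<And>k. a * p ^ k \<noteq> 1"
  shows "qpoch a p n \<noteq> 0"
  using assms by (auto simp: qpoch_def)

lemma qpoch_nonzero':
  assumes "norm p < 1" "norm a < 1"
  shows "qpoch a p n \<noteq> 0"
proof (rule qpoch_nonzero)
  fix k
  have "norm (a * p ^ k) \<le> norm a * 1"
    unfolding norm_mult norm_power using assms
    by (intro mult_left_mono power_le_one) auto
  with assms(2) show "a * p ^ k \<noteq> 1" by auto
qed

lemma inverse_qpoch_bounded:
  assumes "norm p < 1" "\<And>k. a * p ^ k \<noteq> 1"
  obtains B where "B > 0" "\<And>n. norm (1 / qpoch a p n) \<le> B"
proof -
  have "(\<lambda>n. 1 / qpoch a p n) \<longlonglongrightarrow> 1 / qpoch_inf a p"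
    by (intro tendsto_intros qpoch_tendsto qpoch_inf_nonzero assms)
  hence "Bseq (\<lambda>n. 1 / qpoch a p n)"
    by (meson convergentI convergent_imp_Bseq)
  thus ?thesis using that by (auto elim: BseqE)
qed

lemma qpoch_inf_split:
  assumes "norm p < 1"
  shows "qpoch_inf a p = qpoch a p n * qpoch_inf (a * p ^ n) p"
proof (rule LIMSEQ_unique)
  show "(\<lambda>m. qpoch a p (m + n)) \<longlonglongrightarrow> qpoch_inf a p"
    using qpoch_tendsto[OF assms] by (rule LIMSEQ_ignore_initial_segment)
  show "(\<lambda>m. qpoch a p (m + n)) \<longlonglongrightarrow> qpoch a p n * qpoch_inf (a * p ^ n) p"
    unfolding add.commute[of _ n] qpoch_add by (intro tendsto_intros qpoch_tendsto assms)
qed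

lemma qpoch_inf_rec:
  assumes "norm p < 1"
  shows "qpoch_inf a p = (1 - a) * qpoch_inf (a * p) p"
  using qpoch_inf_split[OF assms, of a 1] by (simp add: qpoch_Suc)

lemma qpoch_inf_mult_minus:
  assumes "norm p < 1"
  shows "qpoch_inf a p * qpoch_inf (-a) p = qpoch_inf (a\<^sup>2) (p\<^sup>2)"
proof (rule LIMSEQ_unique)
  have "norm (p\<^sup>2) < 1" using assms by (simp add: norm_power power_less_one_iff)
  thus "(\<lambda>n. qpoch (a\<^sup>2) (p\<^sup>2) n) \<longlonglongrightarrow> qpoch_inf (a\<^sup>2) (p\<^sup>2)"
    by (rule qpoch_tendsto)
  have "qpoch (a\<^sup>2) (p\<^sup>2) n = qpoch a p n * qpoch (-a) p n" for n
    unfolding qpoch_def prod.distrib [symmetric]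
    by (rule prod.cong) (auto simp: algebra_simps power2_eq_square power_mult_distrib)
  thus "(\<lambda>n. qpoch (a\<^sup>2) (p\<^sup>2) n) \<longlonglongrightarrow> qpoch_inf a p * qpoch_inf (-a) p"
    by (simp add: tendsto_mult qpoch_tendsto assms)
qed

lemma qpoch_inf_even_odd:
  assumes "norm p < 1"
  shows "qpoch_inf a p = qpoch_inf a (p\<^sup>2) * qpoch_inf (a * p) (p\<^sup>2)"
proof (rule LIMSEQ_unique)
  have p2: "norm (p\<^sup>2) < 1" using assms by (simp add: norm_power power_less_one_iff)
  have "qpoch a p (2 * n) = qpoch a (p\<^sup>2) n * qpoch (a * p) (p\<^sup>2) n" for n
    by (induction n) (simp_all add: qpoch_Suc power_mult [symmetric] mult_ac)
  thus "(\<lambda>n. qpoch a p (2 * n)) \<longlonglongrightarrow> qpoch_inf a (p\<^sup>2) * qpoch_inf (a * p) (p\<^sup>2)"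
    by (simp add: tendsto_mult qpoch_tendsto p2)
  show "(\<lambda>n. qpoch a p (2 * n)) \<longlonglongrightarrow> qpoch_inf a p"
    using LIMSEQ_subseq_LIMSEQ[OF qpoch_tendsto[OF assms, of a], of "\<lambda>n. 2 * n"]
    by (simp add: strict_mono_def o_def)
qed

section \<open>Gaussian series and sums over all integers\<close>

lemma summable_gauss:
  fixes r C :: real
  assumes "0 \<le> r" "r < 1" "0 \<le> C"
  shows "summable (\<lambda>n. r ^ (n\<^sup>2) * C ^ n)"
proof -
  \<comment> \<open>The term is the \<open>n\<close>-th power of \<open>r ^ n * C\<close>, which
    tends to 0, so a geometric series of ratio 1/2 eventually dominates.\<close>
  have "(\<lambda>n. r ^ n * C) \<longlonglongrightarrow> 0 * C"
    by (intro tendsto_intros LIMSEQ_power_zero) (use assms in auto)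
  hence "eventually (\<lambda>n. r ^ n * C < 1/2) sequentially"
    by (intro order_tendstoD(2)) auto
  hence "eventually (\<lambda>n. norm (r ^ (n\<^sup>2) * C ^ n) \<le> (1/2) ^ n) sequentially"
  proof eventually_elim
    case (elim n)
    have "r ^ (n\<^sup>2) * C ^ n = (r ^ n * C) ^ n"
      by (simp add: power_mult_distrib power2_eq_square power_mult)
    also have "\<dots> \<le> (1/2) ^ n"
      by (rule power_mono) (use elim assms in auto)
    finally show ?case using assms by simp
  qed
  thus ?thesis by (rule summable_comparison_test_ev) (simp add: summable_geometric)
qed

text \<open>The index \<open>- int n - 1\<close> runs once through the negative integers, so a
  bilateral sum is treated as two ordinary series.\<close>

lemma has_sum_int_split:
  fixes f :: "int \<Rightarrow> 'a :: {topological_comm_monoid_add, t2_space}"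
  assumes "((\<lambda>n::nat. f (int n)) has_sum a) UNIV" "((\<lambda>n::nat. f (- int n - 1)) has_sum b) UNIV"
  shows "(f has_sum (a + b)) UNIV"
proof -
  have 1: "(f has_sum a) (range int)"
    using assms(1) by (subst has_sum_reindex) (auto simp: o_def)
  have 2: "(f has_sum b) (range (\<lambda>n::nat. - int n - 1))"
    using assms(2) by (subst has_sum_reindex) (auto simp: o_def inj_on_def)
  have "(f has_sum (a + b)) (range int \<union> range (\<lambda>n::nat. - int n - 1))"
    by (rule has_sum_Un_disjoint[OF 1 2]) auto
  moreover have "range int \<union> range (\<lambda>n::nat. - int n - 1) = UNIV"
  proof -
    have "n \<in> range int \<union> range (\<lambda>n::nat. - int n - 1)" for n :: int
    proof (cases "n \<ge> 0")
      case True
      hence "n = int (nat n)" by simp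
      thus ?thesis by blast
    next
      case False
      hence "n = - int (nat (- n - 1)) - 1" by simp
      thus ?thesis by blast
    qed
    thus ?thesis by blast
  qed
  ultimately show ?thesis by simp
qed

text \<open>In this direction completeness of the space is what guarantees that the two halves
  converge at all.\<close>

lemma has_sum_int_splitE:
  fixes f :: "int \<Rightarrow> 'a :: banach"
  assumes "(f has_sum S) UNIV"
  obtains a b where "((\<lambda>n::nat. f (int n)) has_sum a) UNIV"
    "((\<lambda>n::nat. f (- int n - 1)) has_sum b) UNIV" "S = a + b"
proof -
  have f: "f summable_on UNIV" using assms by (rule has_sum_imp_summable)
  have inj: "inj_on (\<lambda>n::nat. - int n - 1) UNIV" by (auto simp: inj_on_def)
  have "f summable_on range int" "f summable_on range (\<lambda>n::nat. - int n - 1)"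
    using f by (auto intro: summable_on_subset_banach)
  hence "(f \<circ> int) summable_on UNIV" "(f \<circ> (\<lambda>n::nat. - int n - 1)) summable_on UNIV"
    using summable_on_reindex[OF inj_of_nat, of f] summable_on_reindex[OF inj, of f] by auto
  then obtain a b where ab: "((\<lambda>n::nat. f (int n)) has_sum a) UNIV" "((\<lambda>n::nat. f (- int n - 1)) has_sum b) UNIV"
    unfolding o_def summable_on_def by blast
  from has_sum_int_split[OF ab] assms have "S = a + b" by (rule has_sum_unique[rotated])
  thus ?thesis using that ab by blast
qed

lemma abs_summable_gauss:
  fixes q c :: complex
  assumes "norm q < 1" "q \<noteq> 0" "c \<noteq> 0"
  shows "(\<lambda>n::int. norm (q powi (n\<^sup>2) * c powi n)) summable_on UNIV"
proof -
  let ?f = "\<lambda>n::int. norm (q powi (n\<^sup>2) * c powi n)"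
  have 1: "?f (int n) = norm q ^ (n\<^sup>2) * norm c ^ n" for n
    by (simp add: norm_mult norm_power flip: of_nat_power)
  have sq: "(- int n - 1)\<^sup>2 = int ((Suc n)\<^sup>2)" for n
    by (simp add: power2_eq_square algebra_simps)
  have 2: "?f (- int n - 1) = norm q ^ ((Suc n)\<^sup>2) * norm (1 / c) ^ Suc n" for n
  proof -
    have "norm (c powi (- int n - 1)) = norm (1/c) ^ Suc n"
    proof -
      have "- int n - 1 = - int (Suc n)" by simp
      hence "c powi (- int n - 1) = inverse (c powi int (Suc n))"
        by (simp only: power_int_minus)
      thus ?thesis by (simp only: power_int_of_nat norm_inverse norm_power power_inverse norm_divide norm_one divide_inverse mult_1)
    qed
    thus ?thesis unfolding norm_mult sq power_int_of_nat norm_power by simp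
  qed
  have s1: "summable (\<lambda>n. ?f (int n))"
    unfolding 1 by (rule summable_gauss) (use assms in auto)
  have "summable (\<lambda>n. norm q ^ ((Suc n)\<^sup>2) * norm (1 / c) ^ Suc n)"
    by (subst summable_Suc_iff) (rule summable_gauss, use assms in auto)
  hence s2: "summable (\<lambda>n. ?f (- int n - 1))" unfolding 2 .
  have "(?f has_sum (suminf (\<lambda>n. ?f (int n)) + suminf (\<lambda>n. ?f (- int n - 1)))) UNIV"
    by (intro has_sum_int_split sums_nonneg_imp_has_sum summable_sums s1 s2) auto
  thus ?thesis by (rule has_sum_imp_summable)
qed

lemma qpoch_euler_aux_summable:
  assumes "norm p < 1" "norm x < 1"
  shows "summable (\<lambda>k. norm (x ^ k / qpoch p p k))"
proof -
  have np: "p * p ^ k \<noteq> 1" for k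
  proof -
    have "norm (p ^ Suc k) < 1"
      unfolding norm_power using assms(1) by (cases "p = 0") (auto intro!: power_Suc_less_one simp del: power_Suc)
    thus ?thesis by auto
  qed
  obtain B where B: "B > 0" "\<And>n. norm (1 / qpoch p p n) \<le> B"
    using inverse_qpoch_bounded[OF assms(1) np] by metis
  have "summable (\<lambda>k. norm x ^ k * B)"
    using assms by (intro summable_mult2 summable_geometric) auto
  thus ?thesis
  proof (rule summable_comparison_test[rotated], intro exI allI impI)
    fix k
    show "norm (norm (x ^ k / qpoch p p k)) \<le> norm x ^ k * B"
      using mult_left_mono[OF B(2)[of k], of "norm (x ^ k)"] by (simp add: norm_divide norm_power)
  qed
qed

section \<open>Euler's expansions\<close>

lemma power_Suc_neq_1:
  assumes "norm (p::complex) < 1"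
  shows "p * p ^ k \<noteq> 1"
proof
  assume "p * p ^ k = 1"
  hence "norm p ^ Suc k = 1" by (metis norm_one norm_power power_Suc)
  moreover have "norm p ^ Suc k < 1" using assms by (subst power_less_one_iff) auto
  ultimately show False by simp
qed

text \<open>The power series satisfies \<open>(1 - y) * f y = f (y * p)\<close>. Iterating drives
  the argument to 0, where the series is continuous with value 1, and the accumulated factors form
  the infinite product.\<close>

lemma qpoch_euler_geometric:
  assumes "norm p < 1" "norm x < 1"
  shows "(\<lambda>k. x ^ k / qpoch p p k) sums (1 / qpoch_inf x p)"
proof -
  define c where "c = (\<lambda>k. 1 / qpoch p p k)"
  define f where "f = (\<lambda>y. \<Sum>k. c k * y ^ k)"
  have sm: "summable (\<lambda>k. c k * y ^ k)" if "norm y < 1" for y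
    using qpoch_euler_aux_summable[OF assms(1) that]
    by (auto dest: summable_norm_cancel simp: c_def)
  have c0: "c 0 = 1" by (simp add: c_def)
  have cS: "c (Suc k) * (1 - p * p ^ k) = c k" for k
    using power_Suc_neq_1[OF assms(1), of k] unfolding c_def qpoch_Suc by simp
  have rec: "(1 - y) * f y = f (y * p)" if y: "norm y < 1" for y
  proof -
    have yp: "norm (y * p) < 1" using norm_mult_less[OF y assms(1)] by simp
    have "f y - f (y * p) = (\<Sum>k. c k * y ^ k - c k * (y * p) ^ k)"
      unfolding f_def by (intro suminf_diff sm y yp)
    also have "\<dots> = (\<Sum>k. c (Suc k) * y ^ Suc k - c (Suc k) * (y * p) ^ Suc k)"
      by (subst suminf_split_head[OF summable_diff[OF sm[OF y] sm[OF yp]]]) simp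
    also have "(\<lambda>k. c (Suc k) * y ^ Suc k - c (Suc k) * (y * p) ^ Suc k) = (\<lambda>k. y * (c k * y ^ k))"
      by (rule ext, subst cS [symmetric]) (simp add: power_mult_distrib algebra_simps)
    also have "suminf \<dots> = y * f y"
      unfolding f_def by (intro suminf_mult sm y)
    finally show ?thesis by (simp add: algebra_simps)
  qed
  have xp: "norm (x * p ^ n) < 1" for n
  proof -
    have "norm (x * p ^ n) \<le> norm x * 1"
      unfolding norm_mult norm_power using assms by (intro mult_left_mono power_le_one) auto
    thus ?thesis using assms by simp
  qed
  have "f (x * p ^ n) = qpoch x p n * f x" for n
  proof (induction n)
    case (Suc n)
    have "f (x * p ^ Suc n) = (1 - x * p ^ n) * f (x * p ^ n)"
      using rec[OF xp[of n]] by (simp add: mult_ac)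
    thus ?case using Suc by (simp add: qpoch_Suc)
  qed simp
  moreover have "(\<lambda>n. f (x * p ^ n)) \<longlonglongrightarrow> f 0"
  proof -
    have "isCont f 0" unfolding f_def
      by (rule isCont_powser[of _ "1/2"]) (auto intro!: sm)
    moreover have "(\<lambda>n. x * p ^ n) \<longlonglongrightarrow> 0"
      using LIMSEQ_power_zero[OF assms(1)] by (rule tendsto_mult_right_zero)
    ultimately show ?thesis by (rule isCont_tendsto_compose)
  qed
  moreover have "(\<lambda>n. qpoch x p n * f x) \<longlonglongrightarrow> qpoch_inf x p * f x"
    by (intro tendsto_intros qpoch_tendsto assms)
  ultimately have "qpoch_inf x p * f x = f 0"
    using LIMSEQ_unique by simp
  also have "f 0 = 1" by (simp add: f_def powser_zero c0)
  finally have "f x = 1 / qpoch_inf x p"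
    using qpoch_inf_nonzero'[OF assms] by (simp add: field_simps)
  moreover have "(\<lambda>k. c k * x ^ k) sums f x"
    unfolding f_def by (intro summable_sums sm assms)
  ultimately show ?thesis by (simp add: c_def)
qed

lemma qpoch_euler_abs_summable:
  assumes "norm q < 1"
  shows "summable (\<lambda>k. norm (q ^ (k * k) * x ^ k / qpoch (q\<^sup>2) (q\<^sup>2) k))"
proof -
  have q2: "norm (q\<^sup>2) < 1" using assms by (simp add: norm_power power_less_one_iff)
  obtain B where B: "B > 0" "\<And>n. norm (1 / qpoch (q\<^sup>2) (q\<^sup>2) n) \<le> B"
    using inverse_qpoch_bounded[OF q2 power_Suc_neq_1[OF q2]] by metis
  have "summable (\<lambda>k. norm q ^ (k\<^sup>2) * norm x ^ k * B)"
    using assms by (intro summable_mult2 summable_gauss) auto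
  thus ?thesis
  proof (rule summable_comparison_test[rotated], intro exI allI impI)
    fix k
    show "norm (norm (q ^ (k * k) * x ^ k / qpoch (q\<^sup>2) (q\<^sup>2) k)) \<le> norm q ^ (k\<^sup>2) * norm x ^ k * B"
      using mult_left_mono[OF B(2)[of k], of "norm (q ^ (k * k) * x ^ k)"]
      by (simp add: norm_divide norm_power norm_mult power2_eq_square)
  qed
qed

text \<open>Here the functional equation is \<open>f y = (1 + y * q) * f (y * p)\<close> with
  \<open>p = q\<^sup>2\<close>. Taking the base as a square makes the exponent the square
  \<open>k * k\<close>, which matches the exponents of \<open>theta_sum\<close>.\<close>

lemma qpoch_euler_gauss:
  assumes "norm q < 1"
  shows "(\<lambda>k. q ^ (k * k) * x ^ k / qpoch (q\<^sup>2) (q\<^sup>2) k) sums qpoch_inf (- x * q) (q\<^sup>2)"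
proof -
  define p where "p = q\<^sup>2"
  have p: "norm p < 1" using assms by (simp add: norm_power power_less_one_iff p_def)
  define c where "c = (\<lambda>k. q ^ (k * k) / qpoch p p k)"
  define f where "f = (\<lambda>y. \<Sum>k. c k * y ^ k)"
  have sm: "summable (\<lambda>k. c k * y ^ k)" for y
    using qpoch_euler_abs_summable[OF assms, of y]
    by (auto dest: summable_norm_cancel simp: c_def p_def)
  have cS: "c (Suc k) * (1 - p * p ^ k) = q * p ^ k * c k" for k
  proof -
    have "q ^ (Suc k * Suc k) = q * p ^ k * q ^ (k * k)"
      by (simp add: p_def power_add mult_2 flip: power_mult)
    moreover have "1 - p * p ^ k \<noteq> 0" using power_Suc_neq_1[OF p, of k] by simp
    ultimately show ?thesis unfolding c_def qpoch_Suc by (simp del: mult_Suc mult_Suc_right)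
  qed
  have rec: "f y = (1 + y * q) * f (y * p)" for y
  proof -
    have "f y - f (y * p) = (\<Sum>k. c k * y ^ k - c k * (y * p) ^ k)"
      unfolding f_def by (intro suminf_diff sm)
    also have "\<dots> = (\<Sum>k. c (Suc k) * y ^ Suc k - c (Suc k) * (y * p) ^ Suc k)"
      by (subst suminf_split_head[OF summable_diff[OF sm[of y] sm[of "y * p"]]]) simp
    also have "(\<lambda>k. c (Suc k) * y ^ Suc k - c (Suc k) * (y * p) ^ Suc k) = (\<lambda>k. y * q * (c k * (y * p) ^ k))"
    proof (rule ext)
      fix k
      have "c (Suc k) * y ^ Suc k - c (Suc k) * (y * p) ^ Suc k = y ^ Suc k * (c (Suc k) * (1 - p * p ^ k))"
        by (simp add: power_mult_distrib algebra_simps)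
      also have "\<dots> = y * q * (c k * (y * p) ^ k)"
        unfolding cS by (simp add: power_mult_distrib)
      finally show "c (Suc k) * y ^ Suc k - c (Suc k) * (y * p) ^ Suc k = y * q * (c k * (y * p) ^ k)" .
    qed
    also have "suminf \<dots> = y * q * f (y * p)"
      unfolding f_def by (intro suminf_mult sm)
    finally show ?thesis by (simp add: algebra_simps)
  qed
  have iter: "f x = qpoch (- x * q) p n * f (x * p ^ n)" for n
  proof (induction n)
    case (Suc n)
    thus ?case using rec[of "x * p ^ n"] by (simp add: qpoch_Suc mult_ac)
  qed simp
  have "(\<lambda>n. f (x * p ^ n)) \<longlonglongrightarrow> f 0"
  proof -
    have "isCont f 0" unfolding f_def
      by (rule isCont_powser[of _ "1/2"]) (auto intro!: sm)
    moreover have "(\<lambda>n. x * p ^ n) \<longlonglongrightarrow> 0"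
      using LIMSEQ_power_zero[OF p] by (rule tendsto_mult_right_zero)
    ultimately show ?thesis by (rule isCont_tendsto_compose)
  qed
  hence "(\<lambda>n. qpoch (- x * q) p n * f (x * p ^ n)) \<longlonglongrightarrow> qpoch_inf (- x * q) p * f 0"
    by (intro tendsto_intros qpoch_tendsto p)
  moreover have "(\<lambda>n. qpoch (- x * q) p n * f (x * p ^ n)) = (\<lambda>n. f x)"
    by (rule ext) (rule iter[symmetric])
  ultimately have "(\<lambda>n. f x) \<longlonglongrightarrow> qpoch_inf (- x * q) p * f 0"
    by metis
  hence "f x = qpoch_inf (- x * q) p * f 0"
    by (rule LIMSEQ_unique[OF tendsto_const])
  moreover have "f 0 = c 0" unfolding f_def by (rule powser_zero)
  moreover have "c 0 = 1" unfolding c_def by simp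
  ultimately have fx: "f x = qpoch_inf (- x * q) p" by (metis mult_1_right)
  have "(\<lambda>k. c k * x ^ k) sums f x"
    unfolding f_def by (rule summable_sums[OF sm])
  thus ?thesis unfolding fx c_def p_def by (simp only: times_divide_eq_left)
qed

section \<open>The theta series and the triple product\<close>

text \<open>Unordered summability of complex families is absolute, so the product family is summable
  without further assumptions.\<close>

lemma has_sum_product_complex:
  fixes f g :: "_ \<Rightarrow> complex"
  assumes f: "(f has_sum a) A" and g: "(g has_sum b) B"
  shows "((\<lambda>(x,y). f x * g y) has_sum (a * b)) (A \<times> B)"
proof -
  have nf: "(\<lambda>x. norm (f x)) summable_on A" and ng: "(\<lambda>y. norm (g y)) summable_on B"
    using f g by (auto simp flip: summable_on_iff_abs_summable_on_complex dest: has_sum_imp_summable)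
  have "(\<lambda>(x,y). norm (f x) * norm (g y)) summable_on (A \<times> B)"
    by (rule summable_on_SigmaI[where g = "\<lambda>x. norm (f x) * (\<Sum>\<^sub>\<infinity>y\<in>B. norm (g y))"])
       (auto intro!: has_sum_cmult_right summable_on_cmult_left has_sum_infsum nf ng)
  hence "(\<lambda>x. norm ((\<lambda>(x,y). f x * g y) x)) summable_on (A \<times> B)"
    by (simp add: case_prod_unfold norm_mult)
  hence sm: "(\<lambda>(x,y). f x * g y) summable_on (A \<times> B)"
    by (rule abs_summable_summable)
  show ?thesis
    by (rule has_sum_SigmaI[where g = "\<lambda>x. f x * b"])
       (use sm in \<open>auto intro!: has_sum_cmult_right has_sum_cmult_left f g\<close>)
qed

text \<open>Jacobi's theta function with nome \<open>q\<close> and multiplicative argument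
  \<open>y\<close>.\<close>

definition theta_sum :: "complex \<Rightarrow> complex \<Rightarrow> complex" where
  "theta_sum y q = (\<Sum>\<^sub>\<infinity>n::int. q powi (n\<^sup>2) * y powi n)"

lemma has_sum_theta_sum:
  assumes "norm q < 1" "q \<noteq> 0" "y \<noteq> 0"
  shows "((\<lambda>n::int. q powi (n\<^sup>2) * y powi n) has_sum theta_sum y q) UNIV"
  unfolding theta_sum_def
  by (rule has_sum_infsum[OF abs_summable_summable[OF abs_summable_gauss[OF assms]]])

text \<open>
  The case a \<rightarrow> \<infinity> of Ramanujan's bilateral \<open>1\<psi>1\<close> summation: after expanding the products by
  Euler's series, completing the square in the exponent separates the double sum.
\<close>
lemma bilateral_theta_summation:
  assumes q: "norm q < 1" "q \<noteq> 0" and y: "y \<noteq> 0" and b: "norm b < norm (q * y)"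
  shows "((\<lambda>n::int. q powi (n\<^sup>2) * y powi n * qpoch_inf (b * q powi (2 * n)) (q\<^sup>2)) has_sum
           (theta_sum y q / qpoch_inf (- b / (q * y)) (q\<^sup>2))) UNIV"
proof -
  define p where "p = q\<^sup>2"
  have p: "norm p < 1" using q by (simp add: norm_power power_less_one_iff p_def)
  define w where "w = - b / (q * y)"
  have w: "norm w < 1" using b q y by (simp add: w_def norm_divide)
  define g where "g = (\<lambda>n::int. q powi (n\<^sup>2) * y powi n)"
  define h where "h = (\<lambda>k. w ^ k / qpoch p p k)"
  have hs: "(h has_sum (1 / qpoch_inf w p)) UNIV"
    unfolding h_def by (intro norm_summable_imp_has_sum qpoch_euler_aux_summable qpoch_euler_geometric p w)
  have gs: "(g has_sum theta_sum y q) UNIV"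
    unfolding g_def by (rule has_sum_theta_sum[OF q y])
  have tot: "((\<lambda>(m,k). g m * h k) has_sum (theta_sum y q * (1 / qpoch_inf w p))) (UNIV \<times> UNIV)"
    by (rule has_sum_product_complex[OF gs hs])
  \<comment> \<open>The shear to \<open>m = n + k\<close> moves between the product of the two
    series, where the total is known, and rows in \<open>k\<close> that are Euler series.\<close>
  have bij: "bij_betw (\<lambda>(n,k). (n + int k, k)) (UNIV \<times> UNIV) (UNIV \<times> UNIV)"
    by (rule bij_betwI[where g = "\<lambda>(m,k). (m - int k, k)"]) auto
  have eq: "g (n + int k) * h k = q powi (n\<^sup>2) * y powi n * (q ^ (k * k) * (- b * q powi (2 * n) / q) ^ k / qpoch p p k)" for n k
  proof -
    have "q powi ((n + int k)\<^sup>2) = q powi (n\<^sup>2) * q ^ (k * k) * (q powi (2 * n)) ^ k"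
    proof -
      have "(n + int k)\<^sup>2 = n\<^sup>2 + int (k * k) + 2 * n * int k"
        by (simp add: power2_eq_square algebra_simps)
      hence "q powi ((n + int k)\<^sup>2) = q powi (n\<^sup>2) * q powi int (k * k) * q powi (2 * n * int k)"
        using q(2) by (simp only: power_int_add simp_thms)
      thus ?thesis by (simp only: power_int_of_nat power_int_mult)
    qed
    moreover have "y powi (n + int k) * w ^ k = y powi n * (- b / q) ^ k"
    proof -
      have "y ^ k * w ^ k = (- b / q) ^ k"
        using y q by (simp add: w_def flip: power_mult_distrib)
      thus ?thesis using y by (simp add: power_int_add mult.assoc)
    qed
    moreover have "(- b * q powi (2 * n) / q) ^ k = (q powi (2 * n)) ^ k * (- b / q) ^ k"
      unfolding power_mult_distrib [symmetric] by (simp add: mult_ac)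
    moreover have "g (n + int k) * h k = q powi ((n + int k)\<^sup>2) * (y powi (n + int k) * w ^ k) / qpoch p p k"
      by (simp add: g_def h_def mult.assoc)
    ultimately show ?thesis by (simp only: times_divide_eq_right mult_ac)
  qed
  have tot': "((\<lambda>(n,k). q powi (n\<^sup>2) * y powi n * (q ^ (k * k) * (- b * q powi (2 * n) / q) ^ k / qpoch p p k)) has_sum
           (theta_sum y q * (1 / qpoch_inf w p))) (UNIV \<times> UNIV)"
    using iffD2[OF has_sum_reindex_bij_betw[OF bij] tot] by (simp only: case_prod_unfold fst_conv snd_conv eq)
  have "((\<lambda>n::int. q powi (n\<^sup>2) * y powi n * qpoch_inf (b * q powi (2 * n)) p) has_sum
           (theta_sum y q * (1 / qpoch_inf w p))) UNIV"
  proof (rule has_sum_SigmaD[OF tot'])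
    fix n :: int
    have "((\<lambda>k. q ^ (k * k) * (- b * q powi (2 * n) / q) ^ k / qpoch p p k) has_sum
             qpoch_inf (- (- b * q powi (2 * n) / q) * q) p) UNIV"
      unfolding p_def
      by (intro norm_summable_imp_has_sum qpoch_euler_abs_summable qpoch_euler_gauss q)
    hence "((\<lambda>k. q ^ (k * k) * (- b * q powi (2 * n) / q) ^ k / qpoch p p k) has_sum
             qpoch_inf (b * q powi (2 * n)) p) UNIV"
      using q by simp
    thus "((\<lambda>k. case (n, k) of (n, k) \<Rightarrow> q powi (n\<^sup>2) * y powi n *
             (q ^ (k * k) * (- b * q powi (2 * n) / q) ^ k / qpoch p p k)) has_sum
            q powi (n\<^sup>2) * y powi n * qpoch_inf (b * q powi (2 * n)) p) UNIV"
      unfolding prod.case by (rule has_sum_cmult_right)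
  qed
  thus ?thesis by (simp add: w_def p_def)
qed

text \<open>The bilateral summation at \<open>b = q\<^sup>2\<close>: for every negative
  \<open>n\<close> the product in the summand contains the factor 0, and what remains is Euler's
  Gaussian series. The hypothesis on \<open>y\<close> is the convergence condition of that
  summation.\<close>

lemma jacobi_triple_product:
  assumes q: "norm q < 1" "q \<noteq> 0" and y: "norm q < norm y"
  shows "theta_sum y q = qpoch_inf (q\<^sup>2) (q\<^sup>2) * qpoch_inf (- (y * q)) (q\<^sup>2) * qpoch_inf (- (q / y)) (q\<^sup>2)"
proof -
  define p where "p = q\<^sup>2"
  have p: "norm p < 1" using q by (simp add: norm_power power_less_one_iff p_def)
  have y0: "y \<noteq> 0" using y by auto
  have qy: "norm (q / y) < 1" using y y0 by (simp add: norm_divide)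
  define f where "f = (\<lambda>n::int. q powi (n\<^sup>2) * y powi n * qpoch_inf (p * q powi (2 * n)) p)"
  have "norm p < norm (q * y)" using q y by (simp add: p_def norm_mult power2_eq_square)
  from bilateral_theta_summation[OF q y0 this]
  have 1: "(f has_sum (theta_sum y q / qpoch_inf (- (q / y)) p)) UNIV"
    using q y0 by (simp add: p_def f_def power2_eq_square)
  have f1: "f (int n) = qpoch_inf p p * (q ^ (n * n) * y ^ n / qpoch p p n)" for n
  proof -
    have "qpoch_inf p p = qpoch p p n * qpoch_inf (p * p ^ n) p"
      by (rule qpoch_inf_split[OF p])
    moreover have "qpoch p p n \<noteq> 0" by (rule qpoch_nonzero'[OF p p])
    moreover have "p ^ n = q powi (2 * int n)"
      by (simp add: p_def power_int_def nat_mult_distrib flip: power_mult)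
    ultimately show ?thesis
      by (simp add: f_def power2_eq_square flip: of_nat_mult)
  qed
  have "((\<lambda>n. q ^ (n * n) * y ^ n / qpoch p p n) has_sum qpoch_inf (- y * q) p) UNIV"
    unfolding p_def
    by (intro norm_summable_imp_has_sum qpoch_euler_abs_summable qpoch_euler_gauss q)
  hence s1: "((\<lambda>n. f (int n)) has_sum (qpoch_inf p p * qpoch_inf (- (y * q)) p)) UNIV"
    unfolding f1 by (intro has_sum_cmult_right) simp
  have f2: "f (- int n - 1) = 0" for n
  proof -
    have "p ^ n * (p * q powi (2 * (- int n - 1))) = 1"
      using q by (simp add: p_def power_int_diff power_int_minus algebra_simps power_int_mult field_simps
         flip: power_mult)
    hence "qpoch_inf (p * q powi (2 * (- int n - 1))) p = 0"
      using qpoch_inf_split[OF p, of "p * q powi (2 * (- int n - 1))" "Suc n"]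
      by (simp add: qpoch_Suc mult_ac)
    thus ?thesis by (simp add: f_def)
  qed
  have "(f has_sum (qpoch_inf p p * qpoch_inf (- (y * q)) p + 0)) UNIV"
    by (rule has_sum_int_split[OF s1]) (simp add: f2)
  from has_sum_unique[OF this 1] have "qpoch_inf p p * qpoch_inf (- (y * q)) p = theta_sum y q / qpoch_inf (- (q / y)) p"
    by simp
  moreover have "qpoch_inf (- (q / y)) p \<noteq> 0"
    by (rule qpoch_inf_nonzero'[OF p]) (use qy in simp)
  ultimately show ?thesis by (simp add: p_def field_simps)
qed

section \<open>Partial fractions and the Durfee rectangle identity\<close>

text \<open>Lagrange interpolation of the monomial \<open>t ^ a\<close> at the points \<open>1 / d j\<close>, evaluated at \<open>t = 1\<close>.\<close>
lemma partial_fractions_reciprocal_product: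
  fixes d :: "'b \<Rightarrow> 'a :: field"
  assumes J: "finite J" and inj: "inj_on d J" and nz: "\<And>j. j \<in> J \<Longrightarrow> d j \<noteq> 0"
    and n1: "\<And>j. j \<in> J \<Longrightarrow> d j \<noteq> 1" and a: "a < card J"
  shows "1 / (\<Prod>j\<in>J. 1 - d j) =
    (\<Sum>j\<in>J. 1 / (d j ^ a * (1 - d j) * (\<Prod>l\<in>J - {j}. 1 - d l / d j)))"
proof -
  define L where "L = (\<lambda>j. \<Prod>l\<in>J - {j}. [:1, - d l:])"
  define c where "c = (\<lambda>j. 1 / (d j ^ a * (\<Prod>l\<in>J - {j}. 1 - d l / d j)))"
  define f where "f = (\<Sum>j\<in>J. smult (c j) (L j)) - monom 1 a"
  have polyL: "poly (L j) t = (\<Prod>l\<in>J - {j}. 1 - t * d l)" for j t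
    by (simp add: L_def poly_prod)
  have root: "poly f (1 / d i) = 0" if i: "i \<in> J" for i
  proof -
    have "poly f (1 / d i) = (\<Sum>j\<in>J. c j * (\<Prod>l\<in>J - {j}. 1 - d l / d i)) - 1 / d i ^ a"
      by (simp add: f_def poly_sum polyL poly_monom power_one_over)
    also have "(\<Sum>j\<in>J. c j * (\<Prod>l\<in>J - {j}. 1 - d l / d i)) =
               (\<Sum>j\<in>J. if j = i then 1 / d i ^ a else 0)"
    proof (rule sum.cong)
      fix j assume j: "j \<in> J"
      show "c j * (\<Prod>l\<in>J - {j}. 1 - d l / d i) = (if j = i then 1 / d i ^ a else 0)"
      proof (cases "j = i")
        case True
        have "(\<Prod>l\<in>J - {i}. 1 - d l / d i) \<noteq> 0"
          using J inj nz i by (auto simp: inj_on_def)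
        thus ?thesis using True by (simp add: c_def)
      next
        case False
        have "(\<Prod>l\<in>J - {j}. 1 - d l / d i) = 0"
          by (rule prod_zero) (use False i J nz in auto)
        thus ?thesis using False by simp
      qed
    qed simp
    also have "\<dots> = 1 / d i ^ a" using i J by simp
    finally show ?thesis by simp
  qed
  \<comment> \<open>\<open>f\<close> has degree below \<open>card J\<close> but vanishes at the
    \<open>card J\<close> distinct points \<open>1 / d i\<close>.\<close>
  have "f = 0"
  proof (rule ccontr)
    assume f0: "f \<noteq> 0"
    have degL: "degree (L j) \<le> card J - 1" if "j \<in> J" for j
    proof -
      have "degree (L j) \<le> (\<Sum>l\<in>J - {j}. degree [:1, - d l:])"
        using degree_prod_sum_le[of "J - {j}" "\<lambda>l. [:1, - d l:]"] J by (simp add: L_def o_def)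
      also have "\<dots> \<le> (\<Sum>l\<in>J - {j}. 1)" by (rule sum_mono) auto
      finally show ?thesis using that J by simp
    qed
    have "degree f \<le> card J - 1" unfolding f_def
      by (intro degree_diff_le degree_sum_le J order.trans[OF degree_smult_le] degL order.trans[OF degree_monom_le])
         (use a in auto)
    moreover have "card ((\<lambda>i. 1 / d i) ` J) = card J"
      by (rule card_image) (use inj nz in \<open>auto simp: inj_on_def\<close>)
    moreover have "card ((\<lambda>i. 1 / d i) ` J) \<le> card {x. poly f x = 0}"
      by (rule card_mono) (use poly_roots_finite[OF f0] root in auto)
    moreover have "card {x. poly f x = 0} \<le> degree f"
      by (rule card_poly_roots_bound[OF f0])
    ultimately show False using a by linarith
  qed
  hence "poly f 1 = 0" by simp
  hence "(\<Sum>j\<in>J. c j * (\<Prod>l\<in>J - {j}. 1 - d l)) = 1"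
    by (simp add: f_def poly_sum polyL poly_monom)
  hence "1 / (\<Prod>j\<in>J. 1 - d j) = (\<Sum>j\<in>J. c j * (\<Prod>l\<in>J - {j}. 1 - d l)) / (\<Prod>j\<in>J. 1 - d j)"
    by simp
  also have "\<dots> = (\<Sum>j\<in>J. c j * (\<Prod>l\<in>J - {j}. 1 - d l) / (\<Prod>j\<in>J. 1 - d j))"
    by (rule sum_divide_distrib)
  also have "\<dots> = (\<Sum>j\<in>J. 1 / (d j ^ a * (1 - d j) * (\<Prod>l\<in>J - {j}. 1 - d l / d j)))"
  proof (rule sum.cong)
    fix j assume j: "j \<in> J"
    have "(\<Prod>j\<in>J. 1 - d j) = (1 - d j) * (\<Prod>l\<in>J - {j}. 1 - d l)"
      using J j by (rule prod.remove)
    moreover have "(\<Prod>l\<in>J - {j}. 1 - d l) \<noteq> 0" using J n1 by auto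
    ultimately show "c j * (\<Prod>l\<in>J - {j}. 1 - d l) / (\<Prod>j\<in>J. 1 - d j) =
        1 / (d j ^ a * (1 - d j) * (\<Prod>l\<in>J - {j}. 1 - d l / d j))"
      by (simp add: c_def mult_ac)
  qed simp
  finally show ?thesis .
qed

text \<open>
  Writing \<open>G r\<close> for the sum, comparing terms gives \<open>G r - G (r + 1) = p ^ (r + 1) * (G (r + 2) - G (r + 1))\<close>,
  so \<open>G\<close> does not depend on \<open>r\<close>.
\<close>
lemma durfee_rectangle_sums:
  assumes p: "norm p < 1"
  shows "(\<lambda>m. p ^ (m * m + m * r) / (qpoch p p m * qpoch p p (m + r))) sums (1 / qpoch_inf p p)"
proof -
  define t where "t = (\<lambda>r m. p ^ (m * m + m * r) / (qpoch p p m * qpoch p p (m + r)))"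
  obtain B where B: "B > 0" "\<And>n. norm (1 / qpoch p p n) \<le> B"
    using inverse_qpoch_bounded[OF p power_Suc_neq_1[OF p]] by metis
  have nz: "qpoch p p n \<noteq> 0" for n by (rule qpoch_nonzero'[OF p p])
  have bnd: "norm (t r m) \<le> norm p ^ (m * m) * norm p ^ (m * r) * B\<^sup>2" for r m
  proof -
    have "norm (t r m) = norm p ^ (m * m) * norm p ^ (m * r) * (norm (1 / qpoch p p m) * norm (1 / qpoch p p (m + r)))"
      by (simp add: t_def norm_divide norm_mult norm_power power_add)
    also have "\<dots> \<le> norm p ^ (m * m) * norm p ^ (m * r) * (B * B)"
      using B by (intro mult_left_mono mult_mono) auto
    finally show ?thesis by (simp add: power2_eq_square)
  qed
  have sb: "summable (\<lambda>m. norm p ^ (m * m) * B\<^sup>2)"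
    using summable_gauss[of "norm p" 1] p by (intro summable_mult2) (simp add: power2_eq_square)
  have bnd': "norm (t r m) \<le> norm p ^ (m * m) * B\<^sup>2" for r m
  proof -
    have "norm p ^ (m * m) * norm p ^ (m * r) * B\<^sup>2 \<le> norm p ^ (m * m) * 1 * B\<^sup>2"
      using p by (intro mult_right_mono mult_left_mono power_le_one) auto
    thus ?thesis using bnd[of r m] by simp
  qed
  have sm: "summable (t r)" for r
    by (rule summable_comparison_test[OF _ sb]) (use bnd' in auto)
  define G where "G = (\<lambda>r. suminf (t r))"
  have lim: "G \<longlonglongrightarrow> 1 / qpoch_inf p p"
  proof -
    \<comment> \<open>As \<open>r\<close> grows, the weight \<open>p ^ (m * r)\<close> kills every
      term except \<open>m = 0\<close>.\<close>
    define b where "b = (\<lambda>m::nat. if m = 0 then 1 / qpoch_inf p p else 0)"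
    have "(\<lambda>r. suminf (\<lambda>m. t r m)) \<longlonglongrightarrow> suminf b"
    proof (rule tannerys_theorem[THEN conjunct2, THEN conjunct2])
      show "\<forall>\<^sub>F (m, r) in sequentially \<times>\<^sub>F sequentially. norm (t r m) \<le> norm p ^ (m * m) * B\<^sup>2"
        using bnd' by (intro always_eventually) auto
      show "(\<lambda>r. t r m) \<longlonglongrightarrow> b m" for m
      proof (cases "m = 0")
        case True
        have "(\<lambda>r. 1 / qpoch p p r) \<longlonglongrightarrow> 1 / qpoch_inf p p"
          by (intro tendsto_intros qpoch_tendsto qpoch_inf_nonzero' p)
        thus ?thesis using True by (simp add: t_def b_def)
      next
        case False
        have "(\<lambda>r. norm p ^ (m * m) * norm p ^ (m * r) * B\<^sup>2) \<longlonglongrightarrow> norm p ^ (m * m) * 0 * B\<^sup>2"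
        proof (intro tendsto_intros)
          have "norm p ^ m < 1" using p False by (subst power_less_one_iff) auto
          hence "(\<lambda>r. (norm p ^ m) ^ r) \<longlonglongrightarrow> 0" by (intro LIMSEQ_power_zero) auto
          thus "(\<lambda>r. norm p ^ (m * r)) \<longlonglongrightarrow> 0" by (simp add: power_mult)
        qed
        hence "(\<lambda>r. t r m) \<longlonglongrightarrow> 0"
          by (intro Lim_null_comparison[OF always_eventually[OF allI[OF bnd]]]) simp
        thus ?thesis using False by (simp add: b_def)
      qed
    qed (use sb in auto)
    moreover have "suminf b = 1 / qpoch_inf p p"
      using sums_single[of 0 "\<lambda>_. 1 / qpoch_inf p p"] by (simp add: sums_iff b_def eq_commute)
    ultimately show ?thesis by (simp add: G_def)
  qed
  have rec: "G r - G (Suc r) = p ^ Suc r * (G (Suc (Suc r)) - G (Suc r))" for r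
  proof -
    \<comment> \<open>\<open>u\<close> is the series of \<open>G (r + 2)\<close> moved by one index.
      Over a common denominator the comparison of terms is
      \<open>(1 - p^(m+r+1)) - p^m = (1 - p^m) - p^(r+1) p^m\<close>.\<close>
    define u where "u = (\<lambda>m. if m = 0 then 0 else p ^ Suc r * t (Suc (Suc r)) (m - 1))"
    have "t r m - t (Suc r) m = u m - p ^ Suc r * t (Suc r) m" for m
    proof -
      have e: "qpoch p p (m + Suc r) = qpoch p p (m + r) * (1 - p * p ^ (m + r))"
        by (simp add: qpoch_Suc)
      have ne: "1 - p * p ^ (m + r) \<noteq> 0" using power_Suc_neq_1[OF p, of "m + r"] by simp
      have 1: "t r m = p ^ (m * m + m * r) * (1 - p * p ^ (m + r)) / (qpoch p p m * qpoch p p (m + Suc r))"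
        unfolding t_def e using ne by simp
      have 2: "t (Suc r) m = p ^ (m * m + m * r) * p ^ m / (qpoch p p m * qpoch p p (m + Suc r))"
        by (simp add: t_def power_add)
      have 3: "u m = p ^ (m * m + m * r) * (1 - p ^ m) / (qpoch p p m * qpoch p p (m + Suc r))"
      proof (cases m)
        case (Suc k)
        have ne': "1 - p * p ^ k \<noteq> 0" using power_Suc_neq_1[OF p, of k] by simp
        have "Suc r + (k * k + k * Suc (Suc r)) = m * m + m * r" by (simp add: Suc algebra_simps)
        hence "p ^ Suc r * p ^ (k * k + k * Suc (Suc r)) = p ^ (m * m + m * r)"
          by (simp only: flip: power_add)
        moreover have "u m = p ^ Suc r * p ^ (k * k + k * Suc (Suc r)) / (qpoch p p k * qpoch p p (m + Suc r))"
          by (simp add: u_def t_def Suc)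
        ultimately have "u m = p ^ (m * m + m * r) / (qpoch p p k * qpoch p p (m + Suc r))"
          by (simp only:)
        thus ?thesis using ne' unfolding Suc by (simp add: qpoch_Suc[of _ _ k])
      qed (simp add: u_def)
      show ?thesis unfolding 1 2 3
        by (simp add: diff_divide_distrib[symmetric] algebra_simps power_add)
    qed
    hence eq: "(\<lambda>m. t r m - t (Suc r) m) = (\<lambda>m. u m - p ^ Suc r * t (Suc r) m)" by blast
    have us: "u sums (p ^ Suc r * G (Suc (Suc r)))"
    proof -
      have "(\<lambda>m. u (Suc m)) sums (p ^ Suc r * G (Suc (Suc r)))"
        unfolding u_def G_def using sm by (auto intro!: sums_mult summable_sums)
      from sums_Suc[OF this] show ?thesis by (simp add: u_def)
    qed
    have "(\<lambda>m. t r m - t (Suc r) m) sums (G r - G (Suc r))"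
      unfolding G_def by (intro sums_diff summable_sums sm)
    moreover have "(\<lambda>m. t r m - t (Suc r) m) sums (p ^ Suc r * G (Suc (Suc r)) - p ^ Suc r * G (Suc r))"
      unfolding eq by (intro sums_diff us sums_mult) (use sm in \<open>auto simp: G_def intro!: summable_sums\<close>)
    ultimately show ?thesis unfolding right_diff_distrib by (rule sums_unique2)
  qed
  \<comment> \<open>The recurrence has the factor \<open>norm p ^ Suc r\<close>, which is at most 1,
    so \<open>D\<close> is nondecreasing; being nonnegative with limit 0, it vanishes, and
    \<open>G\<close> equals its own limit.\<close>
  define D where "D = (\<lambda>r. norm (G r - G (Suc r)))"
  have Drec: "D r \<le> D (Suc r)" for r
  proof -
    have "D r = norm p ^ Suc r * D (Suc r)"
      unfolding D_def rec[of r] norm_mult norm_power by (subst norm_minus_commute) rule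
    also have "\<dots> \<le> 1 * D (Suc r)"
      using p by (intro mult_right_mono power_le_one) (auto simp: D_def)
    finally show ?thesis by simp
  qed
  have "D \<longlonglongrightarrow> norm (1 / qpoch_inf p p - 1 / qpoch_inf p p)"
    unfolding D_def by (intro tendsto_intros lim) (use lim in \<open>simp only: filterlim_sequentially_Suc\<close>)
  hence D0: "D \<longlonglongrightarrow> 0" by simp
  have "D r \<le> 0" for r
    using incseq_le[OF _ D0] Drec by (simp add: incseq_SucI)
  hence "G (Suc r) = G r" for r by (simp add: D_def)
  hence "G r = G 0" for r by (induction r) auto
  hence "G = (\<lambda>_. G 0)" by blast
  with lim have "G r = 1 / qpoch_inf p p"
    by (metis LIMSEQ_unique tendsto_const)
  thus ?thesis using summable_sums[OF sm[of r]] by (simp add: G_def t_def)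
qed

section \<open>Finite products over two-sided ranges of exponents\<close>

lemma powi_double_of_nat: "q powi (2 * int n) = (q\<^sup>2 :: complex) ^ n"
  by (simp add: power_int_mult)

lemma prod_powi_nonneg:
  "(\<Prod>k\<in>{0..<int B}. 1 - x * q powi (2 * k)) = qpoch x (q\<^sup>2) B"
proof -
  have "(\<Prod>k\<in>{0..<int B}. 1 - x * q powi (2 * k)) = (\<Prod>k<B. 1 - x * q powi (2 * int k))"
    by (rule prod.reindex_bij_witness[of _ int nat]) auto
  also have "\<dots> = qpoch x (q\<^sup>2) B"
    unfolding qpoch_def by (simp only: powi_double_of_nat)
  finally show ?thesis .
qed

lemma prod_powi_pos:
  "(\<Prod>k\<in>{0<..int B}. 1 - q powi (2 * k)) = qpoch (q\<^sup>2) (q\<^sup>2) B"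
proof -
  have "(\<Prod>k\<in>{0<..int B}. 1 - q powi (2 * k)) = (\<Prod>k<B. 1 - q powi (2 * int (Suc k)))"
    by (rule prod.reindex_bij_witness[of _ "\<lambda>k. int (Suc k)" "\<lambda>k. nat (k - 1)"]) auto
  also have "\<dots> = qpoch (q\<^sup>2) (q\<^sup>2) B"
    unfolding qpoch_def
    by (simp only: powi_double_of_nat power_Suc)
  finally show ?thesis .
qed

text \<open>A factor with negative exponent is turned around by
  \<open>1 - x q^(-2k) = - x q^(-2k) (1 - q^(2k) / x)\<close>; the exponents \<open>-2k\<close> for
  \<open>k\<close> from 1 to \<open>A\<close> add up to \<open>- A (A + 1)\<close>.\<close>

lemma prod_powi_neg:
  assumes "q \<noteq> 0" "x \<noteq> 0"
  shows "(\<Prod>k\<in>{- int A..<0}. 1 - x * q powi (2 * k)) =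
         (-x) ^ A * q powi (- (int A * (int A + 1))) * qpoch (q\<^sup>2 / x) (q\<^sup>2) A"
proof (induction A)
  case (Suc A)
  have "{- int (Suc A)..<0} = insert (- int (Suc A)) {- int A..<0}" by auto
  hence "(\<Prod>k\<in>{- int (Suc A)..<0}. 1 - x * q powi (2 * k)) =
         (1 - x * q powi (2 * (- int (Suc A)))) * (\<Prod>k\<in>{- int A..<0}. 1 - x * q powi (2 * k))"
    by (subst prod.insert [symmetric]) auto
  also have "1 - x * q powi (2 * (- int (Suc A))) =
             - x * q powi (- 2 * (int A + 1)) * (1 - q\<^sup>2 / x * (q\<^sup>2) ^ A)"
  proof -
    have "q powi (2 * (int A + 1)) = q\<^sup>2 * (q\<^sup>2) ^ A"
      using assms by (simp add: algebra_simps power_int_add power_int_mult) (simp add: mult.commute flip: power_mult)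
    moreover have "q powi (- 2 * (int A + 1)) * q powi (2 * (int A + 1)) = 1"
      using assms by (simp flip: power_int_add)
    ultimately have *: "q powi (- 2 * (int A + 1)) * (q\<^sup>2 * (q\<^sup>2) ^ A) = 1" by simp
    have "- x * q powi (- 2 * (int A + 1)) * (1 - q\<^sup>2 / x * (q\<^sup>2) ^ A) =
          - x * q powi (- 2 * (int A + 1)) + q powi (- 2 * (int A + 1)) * (q\<^sup>2 * (q\<^sup>2) ^ A)"
      using assms by (simp add: algebra_simps)
    also have "\<dots> = 1 - x * q powi (- 2 * (int A + 1))" unfolding * by simp
    finally show ?thesis by (simp add: algebra_simps)
  qed
  also have "- x * q powi (- 2 * (int A + 1)) * (1 - q\<^sup>2 / x * (q\<^sup>2) ^ A) *
      (\<Prod>k\<in>{- int A..<0}. 1 - x * q powi (2 * k)) =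
      (- x) ^ Suc A * (q powi (- 2 * (int A + 1)) * q powi (- (int A * (int A + 1)))) *
      qpoch (q\<^sup>2 / x) (q\<^sup>2) (Suc A)"
    unfolding Suc qpoch_Suc by (simp only: power_Suc mult_ac)
  also have "q powi (- 2 * (int A + 1)) * q powi (- (int A * (int A + 1))) =
             q powi (- (int (Suc A) * (int (Suc A) + 1)))"
    using assms by (simp flip: power_int_add add: algebra_simps)
  finally show ?case .
qed simp

lemma prod_powi_interval:
  assumes "q \<noteq> 0" "x \<noteq> 0"
  shows "(\<Prod>k\<in>{- int A..<int B}. 1 - x * q powi (2 * k)) =
         qpoch x (q\<^sup>2) B * qpoch (q\<^sup>2 / x) (q\<^sup>2) A * ((-x) ^ A * q powi (- (int A * (int A + 1))))"
proof -
  have "{- int A..<int B} = {- int A..<0} \<union> {0..<int B}" by auto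
  hence "(\<Prod>k\<in>{- int A..<int B}. 1 - x * q powi (2 * k)) =
         (\<Prod>k\<in>{- int A..<0}. 1 - x * q powi (2 * k)) * (\<Prod>k\<in>{0..<int B}. 1 - x * q powi (2 * k))"
    by (subst prod.union_disjoint [symmetric]) auto
  thus ?thesis unfolding prod_powi_neg[OF assms] prod_powi_nonneg by (simp only: mult_ac)
qed

text \<open>The two-sided product at \<open>x = 1\<close> without its zero factor, as it occurs at a
  node of the interpolation after the indices are centred there.\<close>

lemma prod_powi_interval_punctured:
  assumes "q \<noteq> 0"
  shows "(\<Prod>k\<in>{- int A..int B} - {0}. 1 - q powi (2 * k)) =
         qpoch (q\<^sup>2) (q\<^sup>2) B * qpoch (q\<^sup>2) (q\<^sup>2) A * ((-1) ^ A * q powi (- (int A * (int A + 1))))"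
proof -
  have eq: "{- int A..int B} - {0} = {- int A..<0} \<union> {0<..int B}" by auto
  have "(\<Prod>k\<in>{- int A..int B} - {0}. 1 - q powi (2 * k)) =
         (\<Prod>k\<in>{- int A..<0}. 1 - q powi (2 * k)) * (\<Prod>k\<in>{0<..int B}. 1 - q powi (2 * k))"
    unfolding eq by (rule prod.union_disjoint) auto
  also have "(\<Prod>k\<in>{- int A..<0}. 1 - q powi (2 * k)) =
      (-1) ^ A * q powi (- (int A * (int A + 1))) * qpoch (q\<^sup>2) (q\<^sup>2) A"
    using prod_powi_neg[OF assms, of 1 A] by (simp only: mult_1_left div_by_1 one_neq_zero not_False_eq_True simp_thms)
  also have "(\<Prod>k\<in>{0<..int B}. 1 - q powi (2 * k)) = qpoch (q\<^sup>2) (q\<^sup>2) B"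
    by (rule prod_powi_pos)
  finally show ?thesis by (simp only: mult_ac)
qed

lemma powi_eq_iff_complex:
  assumes "norm (q::complex) < 1" "q \<noteq> 0"
  shows "q powi m = q powi n \<longleftrightarrow> m = n"
proof
  assume "q powi m = q powi n"
  hence *: "norm q powi m = norm q powi n" by (metis norm_power_int)
  have "m = n" if "m \<le> n" "norm q powi m = norm q powi n" for m n :: int
  proof (rule ccontr)
    assume "m \<noteq> n"
    with that have "m < n" by simp
    hence "norm q powi n < norm q powi m"
      using assms by (intro power_int_strict_decreasing) auto
    with that show False by simp
  qed
  from this[of m n] this[of n m] * show "m = n" by linarith
qed simp

lemma minus_one_power_powi:
  assumes "int A = int M + k"
  shows "(-1) ^ A * (-1) powi k = (-1 :: complex) ^ M"
proof -
  have "(-1) ^ A * (-1) powi k = (-1 :: complex) powi (int A + k)"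
    by (simp add: power_int_add)
  also have "int A + k = int M + 2 * k" by (simp add: assms)
  also have "(-1 :: complex) powi \<dots> = (-1) ^ M * (-1) powi (2 * k)"
    by (subst power_int_add) auto
  also have "(-1 :: complex) powi (2 * k) = 1"
    by (simp add: power_int_mult)
  finally show ?thesis by simp
qed

text \<open>The nodes are \<open>x q^(2k)\<close> with \<open>k\<close> from \<open>- M\<close> to
  \<open>n\<close>. Interpolating the monomial of exponent \<open>M\<close> matches the factor
  \<open>(- x) ^ M\<close> that comes from turning the \<open>M\<close> factors of negative index
  around, so \<open>x\<close> survives only in the poles \<open>1 - x q^(2k)\<close>.\<close>

lemma partial_fractions_qpoch:
  assumes q: "norm q < 1" "q \<noteq> 0" and x: "x \<noteq> 0" "\<And>k::int. x * q powi (2 * k) \<noteq> 1"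
  shows "1 / (qpoch x (q\<^sup>2) (Suc n) * qpoch (q\<^sup>2 / x) (q\<^sup>2) M) =
    (\<Sum>k\<in>{- int M..int n}. (-1) powi k * q powi (k\<^sup>2 + k) /
       ((1 - x * q powi (2 * k)) * (qpoch (q\<^sup>2) (q\<^sup>2) (nat (int n - k)) * qpoch (q\<^sup>2) (q\<^sup>2) (nat (int M + k)))))"
proof -
  define p where "p = q\<^sup>2"
  define J where "J = {- int M..int n}"
  define d where "d = (\<lambda>k. x * q powi (2 * k))"
  define s where "s = (-x) ^ M * q powi (- (int M * (int M + 1)))"
  have s0: "s \<noteq> 0" using q x by (simp add: s_def)
  have "1 / (\<Prod>j\<in>J. 1 - d j) =
    (\<Sum>j\<in>J. 1 / (d j ^ M * (1 - d j) * (\<Prod>l\<in>J - {j}. 1 - d l / d j)))"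
  proof (rule partial_fractions_reciprocal_product)
    show "inj_on d J" using q x by (auto simp: inj_on_def d_def powi_eq_iff_complex)
    show "M < card J" by (simp add: J_def)
  qed (use q x in \<open>auto simp: J_def d_def\<close>)
  also have "(\<Prod>j\<in>J. 1 - d j) = qpoch x p (Suc n) * qpoch (p / x) p M * s"
  proof -
    have "J = {- int M..<int (Suc n)}" by (auto simp: J_def)
    thus ?thesis using prod_powi_interval[OF q(2) x(1), of M "Suc n"] by (simp only: d_def s_def p_def)
  qed
  finally have eq: "1 / (qpoch x p (Suc n) * qpoch (p / x) p M * s) =
      (\<Sum>j\<in>J. 1 / (d j ^ M * (1 - d j) * (\<Prod>l\<in>J - {j}. 1 - d l / d j)))" .
  have "1 / (qpoch x p (Suc n) * qpoch (p / x) p M) = s * (1 / (qpoch x p (Suc n) * qpoch (p / x) p M * s))"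
    using s0 by simp
  also have "\<dots> = s * (\<Sum>j\<in>J. 1 / (d j ^ M * (1 - d j) * (\<Prod>l\<in>J - {j}. 1 - d l / d j)))"
    unfolding eq ..
  also have "\<dots> = (\<Sum>k\<in>J. s * (1 / (d k ^ M * (1 - d k) * (\<Prod>l\<in>J - {k}. 1 - d l / d k))))"
    by (rule sum_distrib_left)
  also have "\<dots> = (\<Sum>k\<in>J. (-1) powi k * q powi (k\<^sup>2 + k) /
       ((1 - x * q powi (2 * k)) * (qpoch p p (nat (int n - k)) * qpoch p p (nat (int M + k)))))"
  proof (rule sum.cong)
    fix k assume k: "k \<in> J"
    define A where "A = nat (int M + k)"
    define B where "B = nat (int n - k)"
    have A: "int A = int M + k" and B: "int B = int n - k" using k by (auto simp: A_def B_def J_def)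
    have "(\<Prod>l\<in>J - {k}. 1 - d l / d k) = (\<Prod>l\<in>{- int A..int B} - {0}. 1 - q powi (2 * l))"
      by (rule prod.reindex_bij_witness[of _ "\<lambda>l. l + k" "\<lambda>l. l - k"])
         (use q x in \<open>auto simp: A B J_def d_def power_int_diff algebra_simps\<close>)
    also have "\<dots> = qpoch p p B * qpoch p p A * ((-1) ^ A * q powi (- (int A * (int A + 1))))"
      unfolding p_def by (rule prod_powi_interval_punctured[OF q(2)])
    finally have P: "(\<Prod>l\<in>J - {k}. 1 - d l / d k) = qpoch p p B * qpoch p p A * ((-1) ^ A * q powi (- (int A * (int A + 1))))" .
    have s: "s = d k ^ M * ((-1) ^ A * q powi (- (int A * (int A + 1)))) * ((-1) powi k * q powi (k\<^sup>2 + k))"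
    proof -
      have "d k ^ M = x ^ M * q powi (2 * k * int M)"
        by (simp add: d_def power_mult_distrib power_int_mult)
      hence "d k ^ M * ((-1) ^ A * q powi (- (int A * (int A + 1)))) * ((-1) powi k * q powi (k\<^sup>2 + k)) =
        ((-1) ^ A * (-1) powi k) * x ^ M * (q powi (2 * k * int M) * q powi (- (int A * (int A + 1))) * q powi (k\<^sup>2 + k))"
        by (simp only: mult_ac)
      also have "q powi (2 * k * int M) * q powi (- (int A * (int A + 1))) * q powi (k\<^sup>2 + k) =
            q powi (2 * k * int M + - (int A * (int A + 1)) + (k\<^sup>2 + k))"
        using q(2) by (simp only: power_int_add simp_thms)
      also have "2 * k * int M + - (int A * (int A + 1)) + (k\<^sup>2 + k) = - (int M * (int M + 1))"
        by (simp add: A algebra_simps power2_eq_square)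
      also have "(-1) ^ A * (-1) powi k = (-1 :: complex) ^ M"
        by (rule minus_one_power_powi[OF A])
      also have "(-1) ^ M * x ^ M = (- x) ^ M" by (rule power_minus [symmetric])
      finally show ?thesis unfolding s_def ..
    qed
    have cancel: "D * E * C * (1 / (D * u * (v * E))) = C / (u * v)" if "D \<noteq> 0" "E \<noteq> 0" for C D E u v :: complex
      using that by simp
    have "s * (1 / (d k ^ M * (1 - d k) * (\<Prod>l\<in>J - {k}. 1 - d l / d k))) =
          (-1) powi k * q powi (k\<^sup>2 + k) / ((1 - d k) * (qpoch p p B * qpoch p p A))"
      unfolding P s by (rule cancel) (use q x in \<open>auto simp: d_def\<close>)
    thus "s * (1 / (d k ^ M * (1 - d k) * (\<Prod>l\<in>J - {k}. 1 - d l / d k))) =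
        (-1) powi k * q powi (k\<^sup>2 + k) /
       ((1 - x * q powi (2 * k)) * (qpoch p p (nat (int n - k)) * qpoch p p (nat (int M + k))))"
      by (simp only: A_def B_def d_def)
  qed simp
  finally show ?thesis by (simp only: p_def J_def)
qed

section \<open>Durfee series as Appell sums\<close>

text \<open>A level 3 Appell sum. Its exponent is \<open>(k^2 + k) + 2 (k^2 + a k)\<close>: the
  first part comes from the partial fractions, the second from Durfee rectangles with side
  difference \<open>a\<close>.\<close>

definition appell_sum :: "nat \<Rightarrow> complex \<Rightarrow> complex \<Rightarrow> complex" where
  "appell_sum a x q = (\<Sum>\<^sub>\<infinity>k::int. (-1) powi k * q powi (3 * k\<^sup>2 + (2 * int a + 1) * k) / (1 - x * q powi (2 * k)))"

text \<open>The denominators tend to 1 in one direction and to infinity in the other. A pole among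
  them does no harm to the bound, because division by 0 gives 0.\<close>

lemma inverse_one_minus_powi_bounded:
  fixes q x :: complex
  assumes q: "norm q < 1" "q \<noteq> 0" and x: "x \<noteq> 0"
  obtains C where "C > 0" "\<And>k::int. norm (1 / (1 - x * q powi (2 * k))) \<le> C"
proof -
  define p where "p = q\<^sup>2"
  have p: "norm p < 1" using q by (simp add: norm_power power_less_one_iff p_def)
  have p0: "p \<noteq> 0" using q by (simp add: p_def)
  have lim: "(\<lambda>n. p ^ n) \<longlonglongrightarrow> 0" by (rule LIMSEQ_power_zero[OF p])
  have "(\<lambda>n. 1 / (1 - x * p ^ n)) \<longlonglongrightarrow> 1 / (1 - x * 0)"
    by (intro tendsto_intros lim) auto
  hence "Bseq (\<lambda>n. 1 / (1 - x * p ^ n))"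
    by (meson convergentI convergent_imp_Bseq)
  then obtain C1 where C1: "C1 > 0" "\<And>n. norm (1 / (1 - x * p ^ n)) \<le> C1"
    by (auto elim: BseqE)
  have "(\<lambda>n. p ^ n / (p ^ n - x)) \<longlonglongrightarrow> 0 / (0 - x)"
    by (intro tendsto_intros lim) (use x in auto)
  hence "Bseq (\<lambda>n. p ^ n / (p ^ n - x))"
    by (meson convergentI convergent_imp_Bseq)
  then obtain C2 where C2: "C2 > 0" "\<And>n. norm (p ^ n / (p ^ n - x)) \<le> C2"
    by (auto elim: BseqE)
  have "norm (1 / (1 - x * q powi (2 * k))) \<le> max C1 C2" for k :: int
  proof (cases "k \<ge> 0")
    case True
    hence "q powi (2 * k) = p ^ nat k"
      unfolding p_def powi_double_of_nat[symmetric] by simp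
    thus ?thesis using C1(2)[of "nat k"] by simp
  next
    case False
    define m where "m = nat (- k)"
    have "q powi (2 * k) = inverse (p ^ m)"
      using False unfolding p_def powi_double_of_nat[symmetric] power_int_minus[symmetric] by (simp add: m_def)
    moreover have "1 / (1 - x * inverse (p ^ m)) = p ^ m / (p ^ m - x)"
      using p0 by (simp add: field_simps)
    ultimately show ?thesis using C2(2)[of m] by (simp only: max.coboundedI2)
  qed
  thus ?thesis using that[of "max C1 C2"] C1 by (meson less_max_iff_disj)
qed

text \<open>The rectangle identity at \<open>r = 2 K + a\<close>, reindexed by
  \<open>n = K + m\<close>. Extending by 0 below \<open>K\<close> lets all columns of the coming
  double sum share one index set.\<close>

lemma durfee_rectangle_has_sum:
  assumes p: "norm p < 1"
  shows "((\<lambda>n. if K \<le> n then p ^ (n * n + a * n) / (qpoch p p (n - K) * qpoch p p (n + a + K)) else 0) has_sum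
          p ^ (K * K + a * K) / qpoch_inf p p) UNIV"
proof -
  define r where "r = 2 * K + a"
  define t where "t = (\<lambda>m. p ^ (m * m + m * r) / (qpoch p p m * qpoch p p (m + r)))"
  obtain B where B: "B > 0" "\<And>n. norm (1 / qpoch p p n) \<le> B"
    using inverse_qpoch_bounded[OF p power_Suc_neq_1[OF p]] by metis
  have "summable (\<lambda>m. norm (t m))"
  proof (rule summable_comparison_test)
    show "summable (\<lambda>m. norm p ^ (m * m) * (B * B))"
      using summable_gauss[of "norm p" 1] p by (intro summable_mult2) (simp add: power2_eq_square)
    have "norm (t m) \<le> norm p ^ (m * m) * (B * B)" for m
    proof -
      have "norm (t m) = norm p ^ (m * m + m * r) * (norm (1 / qpoch p p m) * norm (1 / qpoch p p (m + r)))"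
        by (simp add: t_def norm_divide norm_mult norm_power)
      also have "\<dots> \<le> norm p ^ (m * m) * (B * B)"
        using B p by (intro mult_mono power_decreasing) auto
      finally show ?thesis .
    qed
    thus "\<exists>N. \<forall>m\<ge>N. norm (norm (t m)) \<le> norm p ^ (m * m) * (B * B)" by simp
  qed
  hence "(t has_sum (1 / qpoch_inf p p)) UNIV"
    using durfee_rectangle_sums[OF p, of r] unfolding t_def by (rule norm_summable_imp_has_sum)
  hence "((\<lambda>m. p ^ (K * K + a * K) * t m) has_sum (p ^ (K * K + a * K) * (1 / qpoch_inf p p))) UNIV"
    by (rule has_sum_cmult_right)
  also have "?this \<longleftrightarrow> (((\<lambda>n. p ^ (n * n + a * n) / (qpoch p p (n - K) * qpoch p p (n + a + K))) \<circ> (+) K) has_sum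
       (p ^ (K * K + a * K) * (1 / qpoch_inf p p))) UNIV"
  proof (rule has_sum_cong)
    fix m
    have e1: "(K + m) * (K + m) + a * (K + m) = (K * K + a * K) + (m * m + m * r)"
      by (simp add: r_def algebra_simps)
    have e2: "K + m + a + K = m + r" by (simp add: r_def)
    show "p ^ (K * K + a * K) * t m = ((\<lambda>n. p ^ (n * n + a * n) / (qpoch p p (n - K) * qpoch p p (n + a + K))) \<circ> (+) K) m"
      unfolding o_apply e1 e2 by (simp add: t_def power_add)
  qed
  also have "\<dots> \<longleftrightarrow> ((\<lambda>n. p ^ (n * n + a * n) / (qpoch p p (n - K) * qpoch p p (n + a + K))) has_sum
       (p ^ (K * K + a * K) * (1 / qpoch_inf p p))) (range ((+) K))"
    by (rule has_sum_reindex [symmetric]) auto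
  also have "range ((+) K) = {K..}"
    by (auto simp: image_def) (metis le_iff_add)
  also have "((\<lambda>n. p ^ (n * n + a * n) / (qpoch p p (n - K) * qpoch p p (n + a + K))) has_sum
       (p ^ (K * K + a * K) * (1 / qpoch_inf p p))) {K..} \<longleftrightarrow>
     ((\<lambda>n. if K \<le> n then p ^ (n * n + a * n) / (qpoch p p (n - K) * qpoch p p (n + a + K)) else 0) has_sum
       (p ^ (K * K + a * K) * (1 / qpoch_inf p p))) UNIV"
    by (rule has_sum_cong_neutral) auto
  finally show ?thesis by simp
qed

lemma summable_appell_coefficients:
  fixes q x :: complex
  assumes q: "norm q < 1" "q \<noteq> 0" and x: "x \<noteq> 0"
  shows "(\<lambda>k::int. norm ((-1) powi k * q powi (k\<^sup>2 + k) / (1 - x * q powi (2 * k)))) summable_on UNIV"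
proof -
  obtain C where C: "C > 0" "\<And>k::int. norm (1 / (1 - x * q powi (2 * k))) \<le> C"
    using inverse_one_minus_powi_bounded[OF q x] by blast
  have "(\<lambda>k::int. norm (q powi (k\<^sup>2) * q powi k) * C) summable_on UNIV"
    by (intro summable_on_cmult_left abs_summable_gauss q)
  thus ?thesis
  proof (rule Infinite_Sum.abs_summable_on_comparison_test')
    fix k :: int
    have "norm ((-1) powi k * q powi (k\<^sup>2 + k) / (1 - x * q powi (2 * k))) =
          norm (q powi (k\<^sup>2) * q powi k) * norm (1 / (1 - x * q powi (2 * k)))"
      using q by (simp add: norm_mult norm_divide norm_power_int power_int_add)
    also have "\<dots> \<le> norm (q powi (k\<^sup>2) * q powi k) * C"
      by (intro mult_left_mono C) auto
    finally show "norm ((-1) powi k * q powi (k\<^sup>2 + k) / (1 - x * q powi (2 * k))) \<le> norm (q powi (k\<^sup>2) * q powi k) * C" .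
  qed
qed

text \<open>
  Bailey's lemma for the pair obtained by expanding \<open>1 / ((x)_(n+1) (p/x)_(n+a))\<close> in partial fractions.
  For \<open>a > 1\<close> the columns \<open>- a / 2 \<le> k < 0\<close> would start at \<open>n = 0\<close> and no longer be complete Durfee sums.
\<close>
lemma durfee_series_eq_appell_sum:
  assumes q: "norm q < 1" "q \<noteq> 0" and x: "x \<noteq> 0" "\<And>k::int. x * q powi (2 * k) \<noteq> 1" and a: "a \<le> 1"
  shows "((\<lambda>n. (q\<^sup>2) ^ (n * n + a * n) / (qpoch x (q\<^sup>2) (Suc n) * qpoch (q\<^sup>2 / x) (q\<^sup>2) (n + a))) has_sum
          appell_sum a x q / qpoch_inf (q\<^sup>2) (q\<^sup>2)) UNIV"
proof -
  define p where "p = q\<^sup>2"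
  have p: "norm p < 1" using q by (simp add: norm_power power_less_one_iff p_def)
  define c where "c = (\<lambda>k::int. (-1) powi k * q powi (k\<^sup>2 + k) / (1 - x * q powi (2 * k)))"
  \<comment> \<open>The pair \<open>n - k\<close>, \<open>n + a + k\<close> in the denominators is
    swapped by the reflection \<open>k -> - k - a\<close>, which also preserves
    \<open>k^2 + a k\<close>. Hence a negative \<open>k\<close> gives the same column as the
    nonnegative index \<open>- k - a\<close>.\<close>
  define K where "K = (\<lambda>k::int. if k \<ge> 0 then nat k else nat (- k - int a))"
  define W where "W = (\<lambda>n K. if K \<le> n then p ^ (n * n + a * n) / (qpoch p p (n - K) * qpoch p p (n + a + K)) else 0)"
  obtain B where B: "B > 0" "\<And>n. norm (1 / qpoch p p n) \<le> B"
    using inverse_qpoch_bounded[OF p power_Suc_neq_1[OF p]] by metis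
  have W_bound: "norm (W n k) \<le> norm p ^ (n\<^sup>2) * (B * B)" for n k
  proof (cases "k \<le> n")
    case True
    have "norm (W n k) = norm p ^ (n * n + a * n) * (norm (1 / qpoch p p (n - k)) * norm (1 / qpoch p p (n + a + k)))"
      using True by (simp add: W_def norm_divide norm_mult norm_power)
    also have "\<dots> \<le> norm p ^ (n\<^sup>2) * (B * B)"
      using B p by (intro mult_mono power_decreasing) (auto simp: power2_eq_square)
    finally show ?thesis .
  qed (use B in \<open>simp add: W_def\<close>)
  have ns: "(\<lambda>n. norm p ^ (n\<^sup>2) * (B * B)) summable_on UNIV"
    using summable_gauss[of "norm p" 1] p
    by (intro summable_on_cmult_left summable_nonneg_imp_summable_on) auto
  have cs: "(\<lambda>k. norm (c k)) summable_on UNIV"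
    unfolding c_def by (rule summable_appell_coefficients[OF q x(1)])
  \<comment> \<open>A Gaussian bound in \<open>n\<close> times an absolutely summable sequence in
    \<open>k\<close> dominates the double family, so rows and columns may be exchanged.\<close>
  have "(\<lambda>(n,k). norm p ^ (n\<^sup>2) * (B * B) * norm (c k)) summable_on (UNIV \<times> UNIV)"
    by (rule summable_on_SigmaI[where g = "\<lambda>n. norm p ^ (n\<^sup>2) * (B * B) * (\<Sum>\<^sub>\<infinity>k. norm (c k))"])
       (use B in \<open>auto intro!: has_sum_cmult_right has_sum_infsum summable_on_cmult_left[OF ns] cs\<close>)
  hence "(\<lambda>z. norm ((\<lambda>(n,k). c k * W n (K k)) z)) summable_on (UNIV \<times> UNIV)"
  proof (rule Infinite_Sum.abs_summable_on_comparison_test')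
    fix z :: "nat \<times> int"
    obtain n k where z: "z = (n, k)" by force
    show "norm ((\<lambda>(n,k). c k * W n (K k)) z) \<le> (\<lambda>(n,k). norm p ^ (n\<^sup>2) * (B * B) * norm (c k)) z"
      using mult_right_mono[OF W_bound[of n "K k"] norm_ge_zero[of "c k"]] by (simp add: z norm_mult mult_ac)
  qed
  hence sm: "(\<lambda>(n,k). c k * W n (K k)) summable_on (UNIV \<times> UNIV)"
    by (rule abs_summable_summable)
  \<comment> \<open>The total \<open>T\<close> is now read in two ways: each row is a partial
    fraction expansion, each column a Durfee rectangle sum.\<close>
  then obtain T where T: "((\<lambda>(n,k). c k * W n (K k)) has_sum T) (UNIV \<times> UNIV)"
    by (auto simp: summable_on_def)
  have rows: "((\<lambda>n. p ^ (n * n + a * n) / (qpoch x p (Suc n) * qpoch (p / x) p (n + a))) has_sum T) UNIV"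
  proof (rule has_sum_SigmaD[OF T])
    fix n :: nat
    let ?J = "{- int (n + a)..int n}"
    have KW: "c k * W n (K k) = p ^ (n * n + a * n) * ((-1) powi k * q powi (k\<^sup>2 + k) /
       ((1 - x * q powi (2 * k)) * (qpoch p p (nat (int n - k)) * qpoch p p (nat (int (n + a) + k)))))"
      if "k \<in> ?J" for k
    proof (cases "k \<ge> 0")
      case True
      have "n - K k = nat (int n - k)" "n + a + K k = nat (int (n + a) + k)" "K k \<le> n"
        using True that by (auto simp: K_def)
      thus ?thesis by (simp add: c_def W_def)
    next
      case False
      have "n - K k = nat (int (n + a) + k)" "n + a + K k = nat (int n - k)" "K k \<le> n"
        using False that a by (auto simp: K_def)
      thus ?thesis by (simp add: c_def W_def mult_ac)
    qed
    have KW0: "c k * W n (K k) = 0" if "k \<notin> ?J" for k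
    proof -
      have "\<not> K k \<le> n" using that a by (auto simp: K_def split: if_splits)
      thus ?thesis by (simp add: W_def)
    qed
    have "p ^ (n * n + a * n) / (qpoch x p (Suc n) * qpoch (p / x) p (n + a)) =
          p ^ (n * n + a * n) * (1 / (qpoch x p (Suc n) * qpoch (p / x) p (n + a)))" by simp
    also have "\<dots> = (\<Sum>k\<in>?J. p ^ (n * n + a * n) * ((-1) powi k * q powi (k\<^sup>2 + k) /
       ((1 - x * q powi (2 * k)) * (qpoch p p (nat (int n - k)) * qpoch p p (nat (int (n + a) + k))))))"
      unfolding p_def partial_fractions_qpoch[OF q x] by (rule sum_distrib_left)
    also have "\<dots> = (\<Sum>k\<in>?J. c k * W n (K k))"
      by (rule sum.cong) (simp_all only: KW)
    finally have eq: "p ^ (n * n + a * n) / (qpoch x p (Suc n) * qpoch (p / x) p (n + a)) = (\<Sum>k\<in>?J. c k * W n (K k))" .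
    have "((\<lambda>k. c k * W n (K k)) has_sum (\<Sum>k\<in>?J. c k * W n (K k))) UNIV"
      by (rule has_sum_finite_neutralI) (use KW0 in auto)
    thus "((\<lambda>k. case (n, k) of (n, k) \<Rightarrow> c k * W n (K k)) has_sum
        p ^ (n * n + a * n) / (qpoch x p (Suc n) * qpoch (p / x) p (n + a))) UNIV"
      unfolding eq prod.case .
  qed
  have T': "((\<lambda>(k,n). c k * W n (K k)) has_sum T) (UNIV \<times> UNIV)"
    using T by (subst has_sum_swap) simp
  have cols: "((\<lambda>k. c k * (p ^ (K k * K k + a * K k) / qpoch_inf p p)) has_sum T) UNIV"
  proof (rule has_sum_SigmaD[OF T'])
    fix k :: int
    show "((\<lambda>n. case (k, n) of (k, n) \<Rightarrow> c k * W n (K k)) has_sum (c k * (p ^ (K k * K k + a * K k) / qpoch_inf p p))) UNIV"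
      unfolding prod.case W_def by (intro has_sum_cmult_right durfee_rectangle_has_sum p)
  qed
  have eq: "c k * (p ^ (K k * K k + a * K k) / qpoch_inf p p) =
      (-1) powi k * q powi (3 * k\<^sup>2 + (2 * int a + 1) * k) / (1 - x * q powi (2 * k)) * (1 / qpoch_inf p p)" for k
  proof -
    have Ka: "int (K k * K k + a * K k) = k\<^sup>2 + int a * k"
    proof (cases "k \<ge> 0")
      case False
      hence "int (K k) = - k - int a" using a by (simp add: K_def)
      thus ?thesis unfolding of_nat_add of_nat_mult by (simp only:) (simp add: power2_eq_square algebra_simps)
    qed (simp add: K_def power2_eq_square)
    have "p ^ (K k * K k + a * K k) = q powi (2 * (k\<^sup>2 + int a * k))"
      unfolding p_def powi_double_of_nat[symmetric] Ka ..
    hence "q powi (k\<^sup>2 + k) * p ^ (K k * K k + a * K k) = q powi ((k\<^sup>2 + k) + 2 * (k\<^sup>2 + int a * k))"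
      using q(2) by (simp only: power_int_add simp_thms)
    also have "(k\<^sup>2 + k) + 2 * (k\<^sup>2 + int a * k) = 3 * k\<^sup>2 + (2 * int a + 1) * k"
      by (simp add: algebra_simps)
    finally show ?thesis by (simp add: c_def)
  qed
  have P0: "qpoch_inf p p \<noteq> 0" by (rule qpoch_inf_nonzero'[OF p p])
  have "((\<lambda>k. (-1) powi k * q powi (3 * k\<^sup>2 + (2 * int a + 1) * k) / (1 - x * q powi (2 * k)) * (1 / qpoch_inf p p)) has_sum T) UNIV"
    using cols unfolding eq .
  from has_sum_cmult_left[OF this, of "qpoch_inf p p"]
  have "((\<lambda>k. (-1) powi k * q powi (3 * k\<^sup>2 + (2 * int a + 1) * k) / (1 - x * q powi (2 * k))) has_sum T * qpoch_inf p p) UNIV"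
    using P0 by (simp add: mult.assoc)
  hence "T * qpoch_inf p p = appell_sum a x q"
    unfolding appell_sum_def by (simp add: infsumI)
  hence "T = appell_sum a x q / qpoch_inf p p" using P0 by (simp add: field_simps)
  thus ?thesis using rows by (simp only: p_def)
qed

section \<open>Partial fractions of a reciprocal product of three theta functions\<close>

lemma infsum_int_split:
  fixes f :: "int \<Rightarrow> complex"
  assumes "f summable_on UNIV"
  shows "infsum f UNIV = (\<Sum>n. f (int n)) + (\<Sum>n. f (- int n - 1))"
proof -
  obtain a b where "((\<lambda>n::nat. f (int n)) has_sum a) UNIV" "((\<lambda>n::nat. f (- int n - 1)) has_sum b) UNIV"
    and "infsum f UNIV = a + b"
    using has_sum_int_splitE[OF has_sum_infsum[OF assms]] by blast
  thus ?thesis using has_sum_imp_sums sums_unique by metis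
qed

text \<open>Tannery's theorem on each half of the integers; it carries the symmetric truncations of
  the partial fractions to the limit.\<close>

lemma infsum_int_dominated_convergence:
  fixes f :: "nat \<Rightarrow> int \<Rightarrow> complex"
  assumes g: "g summable_on UNIV" and bound: "\<And>N n. norm (f N n) \<le> g n"
    and lim: "\<And>n. (\<lambda>N. f N n) \<longlonglongrightarrow> h n"
  shows "(\<lambda>N. infsum (f N) UNIV) \<longlonglongrightarrow> infsum h UNIV"
proof -
  have hb: "norm (h n) \<le> g n" for n
    by (rule LIMSEQ_le_const2[OF tendsto_norm[OF lim]]) (use bound in auto)
  have fs: "f N summable_on UNIV" for N
    by (rule abs_summable_summable[OF Infinite_Sum.abs_summable_on_comparison_test'[OF g bound]])
  have hs: "h summable_on UNIV"
    by (rule abs_summable_summable[OF Infinite_Sum.abs_summable_on_comparison_test'[OF g hb]])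
  obtain a b where "((\<lambda>n::nat. g (int n)) has_sum a) UNIV" "((\<lambda>n::nat. g (- int n - 1)) has_sum b) UNIV"
    using has_sum_int_splitE[OF has_sum_infsum[OF g]] by blast
  hence gs: "summable (\<lambda>n. g (int n))" "summable (\<lambda>n. g (- int n - 1))"
    by (auto dest!: has_sum_imp_sums simp: sums_iff)
  have "(\<lambda>N. \<Sum>n. f N (int n)) \<longlonglongrightarrow> (\<Sum>n. h (int n))"
    by (rule tannerys_theorem[THEN conjunct2, THEN conjunct2, OF lim _ gs(1)])
       (use bound in \<open>auto intro!: always_eventually\<close>)
  moreover have "(\<lambda>N. \<Sum>n. f N (- int n - 1)) \<longlonglongrightarrow> (\<Sum>n. h (- int n - 1))"
    by (rule tannerys_theorem[THEN conjunct2, THEN conjunct2, OF lim _ gs(2)])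
       (use bound in \<open>auto intro!: always_eventually\<close>)
  ultimately show ?thesis
    unfolding infsum_int_split[OF fs] infsum_int_split[OF hs] by (rule tendsto_add)
qed

text \<open>The theta product without its constant factor \<open>qpoch_inf p p\<close>; its zeros in
  \<open>x\<close> are the integer powers of \<open>p\<close>.\<close>

definition qtheta :: "complex \<Rightarrow> complex \<Rightarrow> complex" where
  "qtheta x p = qpoch_inf x p * qpoch_inf (p / x) p"

text \<open>One family of residues of a reciprocal product of three theta functions: three factors
  produce the Gaussian \<open>q^(3 n^2 + 3 n)\<close>, and the position of the other two zero
  families enters only through \<beta>.\<close>

definition appell3_sum :: "complex \<Rightarrow> complex \<Rightarrow> complex \<Rightarrow> complex" where
  "appell3_sum \<beta> x q = (\<Sum>\<^sub>\<infinity>n::int. (-1) powi n * q powi (3 * n\<^sup>2 + 3 * n) * \<beta> powi n / (1 - x * q powi (2 * n)))"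

text \<open>The contribution of the pole with index \<open>n\<close> in the family of
  \<open>u\<close>, when each theta product is cut off at \<open>N\<close>. For fixed
  \<open>n\<close> and growing \<open>N\<close> the Pochhammer symbols become constants and the rest
  is a term of \<open>appell3_sum\<close>.\<close>

definition three_theta_term :: "complex \<Rightarrow> nat \<Rightarrow> complex \<Rightarrow> complex \<Rightarrow> complex \<Rightarrow> int \<Rightarrow> complex" where
  "three_theta_term q N u v w n = (-1) powi n * q powi (3 * n\<^sup>2 + 3 * n) * (u\<^sup>2 / (v * w)) powi n /
     ((1 - u * q powi (2 * n)) *
      (qpoch (q\<^sup>2) (q\<^sup>2) (nat (int N - n)) * qpoch (q\<^sup>2) (q\<^sup>2) (nat (int N + n)) *
       (qpoch (v / u) (q\<^sup>2) (Suc (nat (int N - n))) * qpoch (q\<^sup>2 / (v / u)) (q\<^sup>2) (nat (int N + n))) *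
       (qpoch (w / u) (q\<^sup>2) (Suc (nat (int N - n))) * qpoch (q\<^sup>2 / (w / u)) (q\<^sup>2) (nat (int N + n)))))"

text \<open>The nodes are \<open>b i * q powi (2 * k)\<close> for three families and
  \<open>k\<close> from \<open>- N\<close> to \<open>N\<close>. The exponent \<open>3 * N\<close> is
  the number of nodes with negative \<open>k\<close>; it cancels the powers of \<open>b i\<close>
  from turning those factors around and leaves only the ratio
  \<open>u\<^sup>2 / (v * w)\<close>.\<close>

lemma three_theta_partial_fractions:
  fixes b :: "nat \<Rightarrow> complex"
  assumes q: "norm q < 1" "q \<noteq> 0" and b: "\<And>i. b i \<noteq> 0" "\<And>i (k::int). b i * q powi (2 * k) \<noteq> 1"
    and bb: "\<And>i j (k::int). i < 3 \<Longrightarrow> j < 3 \<Longrightarrow> i \<noteq> j \<Longrightarrow> b j / b i * q powi (2 * k) \<noteq> 1"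
  shows "1 / (\<Prod>i\<in>{..<3}. qpoch (b i) (q\<^sup>2) (Suc N) * qpoch (q\<^sup>2 / b i) (q\<^sup>2) N) =
    (\<Sum>n\<in>{-int N..int N}. three_theta_term q N (b 0) (b 1) (b 2) n) +
    (\<Sum>n\<in>{-int N..int N}. three_theta_term q N (b 1) (b 0) (b 2) n) +
    (\<Sum>n\<in>{-int N..int N}. three_theta_term q N (b 2) (b 0) (b 1) n)"
proof -
  define p where "p = q\<^sup>2"
  define Z where "Z = {-int N..int N}"
  define J where "J = {..<3::nat} \<times> Z"
  define d where "d = (\<lambda>(i,k). b i * q powi (2 * k))"
  define e where "e = q powi (- (int N * (int N + 1)))"
  define s where "s = (- b 0) ^ N * (- b 1) ^ N * (- b 2) ^ N * e ^ 3"
  have s0: "s \<noteq> 0" using q b by (simp add: s_def e_def)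
  define g where "g = (\<lambda>j. s * (1 / (d j ^ (3 * N) * (1 - d j) * (\<Prod>l\<in>J - {j}. 1 - d l / d j))))"
  have "1 / (\<Prod>j\<in>J. 1 - d j) =
    (\<Sum>j\<in>J. 1 / (d j ^ (3 * N) * (1 - d j) * (\<Prod>l\<in>J - {j}. 1 - d l / d j)))"
  proof (rule partial_fractions_reciprocal_product)
    show "inj_on d J"
    proof (rule inj_onI)
      fix y z assume y: "y \<in> J" and z: "z \<in> J" and eq: "d y = d z"
      obtain i k j l where yz: "y = (i, k)" "z = (j, l)" by (metis surj_pair)
      have "b j / b i * q powi (2 * (l - k)) = 1"
        using eq q b by (simp add: yz d_def power_int_diff right_diff_distrib)
      hence "i = j" using bb[of i j "l - k"] y z by (auto simp: J_def yz)
      moreover from this have "k = l"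
        using eq b q by (simp add: yz d_def powi_eq_iff_complex)
      ultimately show "y = z" by (simp add: yz)
    qed
    show "3 * N < card J" by (simp add: J_def Z_def card_cartesian_product)
  qed (use q b in \<open>auto simp: J_def Z_def d_def\<close>)
  moreover have "(\<Prod>j\<in>J. 1 - d j) = (\<Prod>i\<in>{..<3}. qpoch (b i) p (Suc N) * qpoch (p / b i) p N) * s"
  proof -
    have Z: "Z = {- int N..<int (Suc N)}" by (auto simp: Z_def)
    have "(\<Prod>j\<in>J. 1 - d j) = (\<Prod>i\<in>{..<3}. \<Prod>k\<in>Z. 1 - b i * q powi (2 * k))"
      unfolding J_def d_def by (simp add: prod.cartesian_product case_prod_unfold)
    also have "\<dots> = (\<Prod>i\<in>{..<3}. qpoch (b i) p (Suc N) * qpoch (p / b i) p N * ((- b i) ^ N * e))"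
      unfolding Z p_def e_def by (intro prod.cong refl prod_powi_interval q b)
    also have "\<dots> = (\<Prod>i\<in>{..<3}. qpoch (b i) p (Suc N) * qpoch (p / b i) p N) * s"
      by (simp add: prod.distrib s_def numeral_3_eq_3 numeral_2_eq_2 mult_ac)
    finally show ?thesis .
  qed
  moreover have "s * (1 / (X * s)) = 1 / X" for X using s0 by simp
  ultimately have "1 / (\<Prod>i\<in>{..<3}. qpoch (b i) p (Suc N) * qpoch (p / b i) p N) =
     s * (\<Sum>j\<in>J. 1 / (d j ^ (3 * N) * (1 - d j) * (\<Prod>l\<in>J - {j}. 1 - d l / d j)))" by metis
  also have "\<dots> = (\<Sum>j\<in>J. g j)"
    unfolding g_def by (rule sum_distrib_left)
  also have "\<dots> = (\<Sum>i\<in>{..<3}. \<Sum>n\<in>Z. g (i,n))"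
    unfolding J_def by (subst sum.cartesian_product) (simp add: case_prod_unfold)
  finally have main: "1 / (\<Prod>i\<in>{..<3}. qpoch (b i) p (Suc N) * qpoch (p / b i) p N) =
    (\<Sum>i\<in>{..<3}. \<Sum>n\<in>Z. g (i,n))" .
  \<comment> \<open>One argument serves all three families: \<open>i\<close> is the family of the
    pole, \<open>j\<close> and \<open>l\<close> are the other two in either order.\<close>
  have trm: "g (i,n) =
             three_theta_term q N (b i) (b j) (b l) n"
    if n: "n \<in> Z" and ijl: "{..<3} = {i, j, l}" "i \<noteq> j" "i \<noteq> l" "j \<noteq> l"
      and sb: "s = (- b i) ^ N * (- b j) ^ N * (- b l) ^ N * e ^ 3" for i j l n
  proof -
    define A where "A = nat (int N + n)"
    define B where "B = nat (int N - n)"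
    have A: "int A = int N + n" and B: "int B = int N - n" using n by (auto simp: A_def B_def Z_def)
    define x where "x = b j / b i"
    define y where "y = b l / b i"
    define \<beta> where "\<beta> = (b i)\<^sup>2 / (b j * b l)"
    have x0: "x \<noteq> 0" and y0: "y \<noteq> 0" and beta0: "\<beta> \<noteq> 0" using b by (auto simp: x_def y_def \<beta>_def)
    define E where "E = q powi (- (int A * (int A + 1)))"
    have shift: "(\<Prod>k\<in>Z. 1 - d (m, k) / d (i, n)) = qpoch (b m / b i) p (Suc B) * qpoch (p / (b m / b i)) p A * ((- (b m / b i)) ^ A * E)" for m
    proof -
      have "(\<Prod>k\<in>Z. 1 - d (m, k) / d (i, n)) = (\<Prod>k\<in>{- int A..<int (Suc B)}. 1 - b m / b i * q powi (2 * k))"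
        by (rule prod.reindex_bij_witness[of _ "\<lambda>k. k + n" "\<lambda>k. k - n"])
           (use q b in \<open>auto simp: A B Z_def d_def power_int_diff right_diff_distrib\<close>)
      also have "\<dots> = qpoch (b m / b i) p (Suc B) * qpoch (p / (b m / b i)) p A * ((- (b m / b i)) ^ A * E)"
        unfolding p_def E_def by (rule prod_powi_interval) (use q b in auto)
      finally show ?thesis .
    qed
    have shift0: "(\<Prod>k\<in>Z - {n}. 1 - d (i, k) / d (i, n)) = qpoch p p B * qpoch p p A * ((-1) ^ A * E)"
    proof -
      have "(\<Prod>k\<in>Z - {n}. 1 - d (i, k) / d (i, n)) = (\<Prod>k\<in>{- int A..int B} - {0}. 1 - q powi (2 * k))"
        by (rule prod.reindex_bij_witness[of _ "\<lambda>k. k + n" "\<lambda>k. k - n"])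
           (use q b in \<open>auto simp: A B Z_def d_def power_int_diff right_diff_distrib\<close>)
      thus ?thesis unfolding p_def E_def by (simp only: prod_powi_interval_punctured[OF q(2)])
    qed
    have Jeq: "J - {(i,n)} = Pair i ` (Z - {n}) \<union> (Pair j ` Z \<union> Pair l ` Z)"
      unfolding J_def ijl(1) using ijl(2-4) by auto
    have finZ: "finite Z" by (simp add: Z_def)
    have "(\<Prod>l\<in>J - {(i,n)}. 1 - d l / d (i,n)) =
          (\<Prod>l\<in>Pair i ` (Z - {n}). 1 - d l / d (i,n)) * ((\<Prod>l\<in>Pair j ` Z. 1 - d l / d (i,n)) * (\<Prod>l\<in>Pair l ` Z. 1 - d l / d (i,n)))"
    proof -
      have "(\<Prod>l\<in>Pair j ` Z \<union> Pair l ` Z. 1 - d l / d (i,n)) =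
            (\<Prod>l\<in>Pair j ` Z. 1 - d l / d (i,n)) * (\<Prod>l\<in>Pair l ` Z. 1 - d l / d (i,n))"
        by (rule prod.union_disjoint) (use ijl(2-4) finZ in auto)
      moreover have "(\<Prod>l\<in>Pair i ` (Z - {n}) \<union> (Pair j ` Z \<union> Pair l ` Z). 1 - d l / d (i,n)) =
            (\<Prod>l\<in>Pair i ` (Z - {n}). 1 - d l / d (i,n)) * (\<Prod>l\<in>Pair j ` Z \<union> Pair l ` Z. 1 - d l / d (i,n))"
        by (rule prod.union_disjoint) (use ijl(2-4) finZ in auto)
      ultimately show ?thesis unfolding Jeq by (simp only:)
    qed
    also have "\<dots> = (\<Prod>k\<in>Z - {n}. 1 - d (i, k) / d (i,n)) * ((\<Prod>k\<in>Z. 1 - d (j, k) / d (i,n)) * (\<Prod>k\<in>Z. 1 - d (l, k) / d (i,n)))"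
      by (simp add: prod.reindex inj_on_def)
    also have "\<dots> = (qpoch p p B * qpoch p p A * (qpoch x p (Suc B) * qpoch (p / x) p A) * (qpoch y p (Suc B) * qpoch (p / y) p A)) *
         ((-1) ^ A * (- x) ^ A * (- y) ^ A * E ^ 3)"
      unfolding shift shift0 x_def y_def by (simp only: mult_ac power3_eq_cube)
    finally have P: "(\<Prod>l\<in>J - {(i,n)}. 1 - d l / d (i,n)) = (qpoch p p B * qpoch p p A * (qpoch x p (Suc B) * qpoch (p / x) p A) * (qpoch y p (Suc B) * qpoch (p / y) p A)) *
         ((-1) ^ A * (- x) ^ A * (- y) ^ A * E ^ 3)" .
    define C where "C = (-1) powi n * q powi (3 * n\<^sup>2 + 3 * n) * \<beta> powi n"
    \<comment> \<open>The prefactor \<open>s\<close> absorbs all powers that appear when the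
      products are centred at the pole; the quotient is the numerator \<open>C\<close>.\<close>
    have s: "s = d (i,n) ^ (3 * N) * ((-1) ^ A * (- x) ^ A * (- y) ^ A * E ^ 3) * C"
    proof -
      have sgn: "(-1) ^ A * (-1) powi n = (-1 :: complex) ^ N"
        by (rule minus_one_power_powi[OF A])
      have xy: "(- x) ^ A * (- y) ^ A * \<beta> powi n = \<beta> powi (- int N)"
      proof -
        have "(- x) * (- y) = inverse \<beta>" using b by (simp add: x_def y_def \<beta>_def power2_eq_square)
        hence "(- x) ^ A * (- y) ^ A = inverse \<beta> ^ A" by (metis power_mult_distrib)
        also have "\<dots> = \<beta> powi (- int A)" by (simp add: power_int_minus power_inverse)
        also have "\<dots> * \<beta> powi n = \<beta> powi (- int A + n)" using beta0 by (simp only: power_int_add simp_thms)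
        finally show ?thesis by (simp add: A)
      qed
      have qq: "q powi (2 * n * int (3 * N)) * E ^ 3 * q powi (3 * n\<^sup>2 + 3 * n) = e ^ 3"
      proof -
        have "E ^ 3 = q powi (- (int A * (int A + 1)) * 3)" by (simp add: E_def power_int_mult del: mult_minus_left)
        hence "q powi (2 * n * int (3 * N)) * E ^ 3 * q powi (3 * n\<^sup>2 + 3 * n) =
               q powi (2 * n * int (3 * N) + (- (int A * (int A + 1)) * 3) + (3 * n\<^sup>2 + 3 * n))"
          using q(2) by (simp only: power_int_add simp_thms)
        also have "2 * n * int (3 * N) + (- (int A * (int A + 1)) * 3) + (3 * n\<^sup>2 + 3 * n) = - (int N * (int N + 1)) * 3"
          by (simp add: A algebra_simps power2_eq_square)
        also have "q powi \<dots> = e ^ 3" by (simp add: e_def power_int_mult del: mult_minus_left)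
        finally show ?thesis .
      qed
      have bN: "(- b i) ^ N * (- b j) ^ N * (- b l) ^ N = (-1) ^ N * b i ^ (3 * N) * \<beta> powi (- int N)"
      proof -
        have "(- b i) * (- b j) * (- b l) = (-1) * b i ^ 3 * inverse \<beta>"
          using b by (simp add: \<beta>_def power2_eq_square power3_eq_cube)
        hence "((- b i) * (- b j) * (- b l)) ^ N = ((-1) * b i ^ 3 * inverse \<beta>) ^ N" by simp
        thus ?thesis by (simp only: power_mult_distrib power_mult power_int_minus power_int_of_nat power_inverse)
      qed
      have "d (i,n) ^ (3 * N) = b i ^ (3 * N) * q powi (2 * n * int (3 * N))"
        unfolding d_def prod.case power_mult_distrib power_int_mult[of q "2 * n" "int (3 * N)"] power_int_of_nat ..
      hence "d (i,n) ^ (3 * N) * ((-1) ^ A * (- x) ^ A * (- y) ^ A * E ^ 3) * C =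
         ((-1) ^ A * (-1) powi n) * b i ^ (3 * N) * ((- x) ^ A * (- y) ^ A * \<beta> powi n) *
         (q powi (2 * n * int (3 * N)) * E ^ 3 * q powi (3 * n\<^sup>2 + 3 * n))"
        unfolding C_def by (simp only: mult_ac)
      thus ?thesis unfolding sgn xy qq sb bN by (simp only:)
    qed
    have cancel: "D * F * G * (1 / (D * u * (v * F))) = G / (u * v)" if "D \<noteq> 0" "F \<noteq> 0" for D F G u v :: complex
      using that by simp
    have "g (i,n) =
      C / ((1 - d (i,n)) * (qpoch p p B * qpoch p p A * (qpoch x p (Suc B) * qpoch (p / x) p A) * (qpoch y p (Suc B) * qpoch (p / y) p A)))"
      unfolding g_def P s by (rule cancel) (use q b x0 y0 in \<open>auto simp: d_def E_def\<close>)
    thus ?thesis unfolding three_theta_term_def C_def x_def y_def \<beta>_def A_def B_def p_def d_def prod.case .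
  qed
  have "(\<Sum>i\<in>{..<3}. \<Sum>n\<in>Z. g (i,n)) =
    (\<Sum>n\<in>Z. g (0,n)) +
    (\<Sum>n\<in>Z. g (1,n)) +
    (\<Sum>n\<in>Z. g (2,n))"
    by (simp only: numeral_3_eq_3 lessThan_Suc lessThan_0 numeral_2_eq_2 One_nat_def) (simp add: add_ac)
  also have "\<dots> = (\<Sum>n\<in>Z. three_theta_term q N (b 0) (b 1) (b 2) n) +
    (\<Sum>n\<in>Z. three_theta_term q N (b 1) (b 0) (b 2) n) + (\<Sum>n\<in>Z. three_theta_term q N (b 2) (b 0) (b 1) n)"
    by (intro arg_cong2[where f = "(+)"] sum.cong refl trm) (auto simp: s_def mult_ac)
  finally show ?thesis using main by (simp only: p_def Z_def)
qed


section \<open>From truncated to infinite theta products\<close>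

lemma theta_factors_neq_1:
  fixes x q :: complex
  assumes x: "\<And>k::int. x * q powi (2 * k) \<noteq> 1" "x \<noteq> 0"
  shows "x * (q\<^sup>2) ^ k \<noteq> 1" "q\<^sup>2 / x * (q\<^sup>2) ^ k \<noteq> 1"
proof -
  show "x * (q\<^sup>2) ^ k \<noteq> 1" using x(1)[of "int k"] unfolding powi_double_of_nat .
  show "q\<^sup>2 / x * (q\<^sup>2) ^ k \<noteq> 1"
  proof
    assume "q\<^sup>2 / x * (q\<^sup>2) ^ k = 1"
    hence "(q\<^sup>2) ^ Suc k = x" using x(2) by (simp add: field_simps)
    moreover have "q powi (2 * (- int (Suc k))) = inverse ((q\<^sup>2) ^ Suc k)"
      unfolding mult_minus_right power_int_minus powi_double_of_nat ..
    ultimately show False using x(1)[of "- int (Suc k)"] x(2) by simp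
  qed
qed

lemma summable_appell3_numerators:
  fixes q \<beta> :: complex
  assumes q: "norm q < 1" "q \<noteq> 0" and beta: "\<beta> \<noteq> 0"
  shows "(\<lambda>n::int. norm ((-1) powi n * q powi (3 * n\<^sup>2 + 3 * n) * \<beta> powi n)) summable_on UNIV"
proof -
  have "(\<lambda>n::int. norm ((q ^ 3) powi (n\<^sup>2) * (q ^ 3 * \<beta>) powi n)) summable_on UNIV"
    using q beta by (intro abs_summable_gauss) (auto simp: norm_power power_less_one_iff)
  moreover have "norm ((-1) powi n * q powi (3 * n\<^sup>2 + 3 * n) * \<beta> powi n) =
      norm ((q ^ 3) powi (n\<^sup>2) * (q ^ 3 * \<beta>) powi n)" for n :: int
  proof -
    have "q powi (3 * n\<^sup>2 + 3 * n) = (q powi 3) powi (n\<^sup>2) * (q powi 3) powi n"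
      using q(2) by (simp only: power_int_add power_int_mult simp_thms)
    hence "q powi (3 * n\<^sup>2 + 3 * n) * \<beta> powi n = (q ^ 3) powi (n\<^sup>2) * (q ^ 3 * \<beta>) powi n"
      by (simp add: power_int_mult_distrib mult.assoc)
    moreover have "norm ((-1) powi n * q powi (3 * n\<^sup>2 + 3 * n) * \<beta> powi n) = norm (q powi (3 * n\<^sup>2 + 3 * n) * \<beta> powi n)"
      by (simp add: norm_mult norm_power_int)
    ultimately show ?thesis by simp
  qed
  ultimately show ?thesis by simp
qed

text \<open>The reciprocals of the Pochhammer symbols are bounded uniformly in \<open>N\<close> and
  \<open>n\<close>, so the Gaussian numerators dominate all truncated sums at once.\<close>

lemma three_theta_term_limit:
  assumes q: "norm q < 1" "q \<noteq> 0" and nz: "u \<noteq> 0" "v \<noteq> 0" "w \<noteq> 0"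
    and vu: "\<And>k::int. v / u * q powi (2 * k) \<noteq> 1" and wu: "\<And>k::int. w / u * q powi (2 * k) \<noteq> 1"
  shows "(\<lambda>N. \<Sum>n\<in>{-int N..int N}. three_theta_term q N u v w n) \<longlonglongrightarrow>
    appell3_sum (u\<^sup>2 / (v * w)) u q / ((qpoch_inf (q\<^sup>2) (q\<^sup>2))\<^sup>2 * qtheta (v / u) (q\<^sup>2) * qtheta (w / u) (q\<^sup>2))"
proof -
  define p where "p = q\<^sup>2"
  have p: "norm p < 1" using q by (simp add: norm_power power_less_one_iff p_def)
  define \<beta> where "\<beta> = u\<^sup>2 / (v * w)"
  have beta0: "\<beta> \<noteq> 0" using nz by (simp add: \<beta>_def)
  note ne1 = theta_factors_neq_1(1)[where q = q, folded p_def] and ne2 = theta_factors_neq_1(2)[where q = q, folded p_def]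
  obtain B0 where B0: "B0 > 0" "\<And>n. norm (1 / qpoch p p n) \<le> B0"
    using inverse_qpoch_bounded[OF p power_Suc_neq_1[OF p]] by metis
  have vu0: "v / u \<noteq> 0" and wu0: "w / u \<noteq> 0" using nz by auto
  obtain B1 where B1: "B1 > 0" "\<And>n. norm (1 / qpoch (v / u) p n) \<le> B1"
    using inverse_qpoch_bounded[OF p ne1[OF vu vu0]] by metis
  obtain B2 where B2: "B2 > 0" "\<And>n. norm (1 / qpoch (p / (v / u)) p n) \<le> B2"
    using inverse_qpoch_bounded[OF p ne2[OF vu vu0]] by metis
  obtain B3 where B3: "B3 > 0" "\<And>n. norm (1 / qpoch (w / u) p n) \<le> B3"
    using inverse_qpoch_bounded[OF p ne1[OF wu wu0]] by metis
  obtain B4 where B4: "B4 > 0" "\<And>n. norm (1 / qpoch (p / (w / u)) p n) \<le> B4"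
    using inverse_qpoch_bounded[OF p ne2[OF wu wu0]] by metis
  obtain C where C: "C > 0" "\<And>k::int. norm (1 / (1 - u * q powi (2 * k))) \<le> C"
    using inverse_one_minus_powi_bounded[OF q nz(1)] by blast
  define K where "K = C * (B0 * B0 * (B1 * B2) * (B3 * B4))"
  define a where "a = (\<lambda>n::int. (-1) powi n * q powi (3 * n\<^sup>2 + 3 * n) * \<beta> powi n)"
  define R where "R = (\<lambda>A B. (1 / qpoch p p B) * (1 / qpoch p p A) *
       ((1 / qpoch (v / u) p (Suc B)) * (1 / qpoch (p / (v / u)) p A)) *
       ((1 / qpoch (w / u) p (Suc B)) * (1 / qpoch (p / (w / u)) p A)))"
  have trm: "three_theta_term q N u v w n = a n * ((1 / (1 - u * q powi (2 * n))) * R (nat (int N + n)) (nat (int N - n)))" for N n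
    unfolding three_theta_term_def a_def R_def \<beta>_def p_def by simp
  have Rb: "norm (R A B) \<le> B0 * B0 * (B1 * B2) * (B3 * B4)" for A B
    unfolding R_def norm_mult
    by (intro mult_mono B0 B1 B2 B3 B4 mult_nonneg_nonneg norm_ge_zero less_imp_le[OF B0(1)] less_imp_le[OF B1(1)]
         less_imp_le[OF B2(1)] less_imp_le[OF B3(1)] less_imp_le[OF B4(1)])
  have tb: "norm (three_theta_term q N u v w n) \<le> norm (a n) * K" for N n
    unfolding trm K_def norm_mult
    by (intro mult_left_mono mult_mono C Rb norm_ge_zero less_imp_le[OF C(1)])
  have as: "(\<lambda>n. norm (a n) * K) summable_on UNIV"
    unfolding a_def by (intro summable_on_cmult_left summable_appell3_numerators q beta0)
  \<comment> \<open>Outside the range \<open>nat\<close> would cut negative arguments to 0, so the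
    term is replaced by 0 there; every fixed \<open>n\<close> enters the range eventually.\<close>
  define f where "f = (\<lambda>N n. if n \<in> {-int N..int N} then three_theta_term q N u v w n else 0)"
  define L where "L = 1 / ((qpoch_inf p p)\<^sup>2 * qtheta (v / u) p * qtheta (w / u) p)"
  have K0: "K \<ge> 0" using B0 B1 B2 B3 B4 C by (simp add: K_def)
  have "(\<lambda>N. infsum (f N) UNIV) \<longlonglongrightarrow> infsum (\<lambda>n. a n / (1 - u * q powi (2 * n)) * L) UNIV"
  proof (rule infsum_int_dominated_convergence[OF as])
    show "norm (f N n) \<le> norm (a n) * K" for N n
      using tb[of N n] K0 by (simp add: f_def)
    fix n :: int
    have l0: "filterlim (\<lambda>N. nat (int N + m)) at_top at_top" for m
      unfolding filterlim_at_top
    proof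
      fix Z :: nat
      show "\<forall>\<^sub>F N in sequentially. Z \<le> nat (int N + m)"
        using eventually_ge_at_top[of "Z + nat \<bar>m\<bar>"] by eventually_elim linarith
    qed
    have l1: "filterlim (\<lambda>N. nat (int N + n)) at_top at_top" "filterlim (\<lambda>N. nat (int N - n)) at_top at_top"
      using l0[of n] l0[of "- n"] by simp_all
    have l2: "filterlim (\<lambda>N. Suc (nat (int N - n))) at_top at_top"
      using l1(2) by (rule filterlim_compose[OF filterlim_Suc])
    have "(\<lambda>N. R (nat (int N + n)) (nat (int N - n))) \<longlonglongrightarrow>
        (1 / qpoch_inf p p) * (1 / qpoch_inf p p) *
       ((1 / qpoch_inf (v / u) p) * (1 / qpoch_inf (p / (v / u)) p)) *
       ((1 / qpoch_inf (w / u) p) * (1 / qpoch_inf (p / (w / u)) p))"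
      unfolding R_def
      by (intro tendsto_intros filterlim_compose[OF qpoch_tendsto[OF p] l1(1)] filterlim_compose[OF qpoch_tendsto[OF p] l1(2)]
            filterlim_compose[OF qpoch_tendsto[OF p] l2] qpoch_inf_nonzero p ne1[OF vu vu0] ne2[OF vu vu0] ne1[OF wu wu0] ne2[OF wu wu0]
            power_Suc_neq_1)
    also have "(1 / qpoch_inf p p) * (1 / qpoch_inf p p) *
       ((1 / qpoch_inf (v / u) p) * (1 / qpoch_inf (p / (v / u)) p)) *
       ((1 / qpoch_inf (w / u) p) * (1 / qpoch_inf (p / (w / u)) p)) = L"
      by (simp add: L_def qtheta_def power2_eq_square)
    finally have "(\<lambda>N. three_theta_term q N u v w n) \<longlonglongrightarrow> a n * ((1 / (1 - u * q powi (2 * n))) * L)"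
      unfolding trm by (intro tendsto_intros)
    moreover have "\<forall>\<^sub>F N in sequentially. three_theta_term q N u v w n = f N n"
      using eventually_ge_at_top[of "nat \<bar>n\<bar>"] by eventually_elim (auto simp: f_def)
    ultimately have "(\<lambda>N. f N n) \<longlonglongrightarrow> a n * ((1 / (1 - u * q powi (2 * n))) * L)"
      by (rule Lim_transform_eventually)
    thus "(\<lambda>N. f N n) \<longlonglongrightarrow> a n / (1 - u * q powi (2 * n)) * L" by simp
  qed
  moreover have "infsum (f N) UNIV = (\<Sum>n\<in>{-int N..int N}. three_theta_term q N u v w n)" for N
  proof (rule infsumI, rule has_sum_finite_neutralI[of "{-int N..int N}"])
    show "(\<Sum>n\<in>{-int N..int N}. three_theta_term q N u v w n) = sum (f N) {-int N..int N}"
      by (rule sum.cong) (simp_all add: f_def)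
  qed (auto simp: f_def)
  moreover have "infsum (\<lambda>n. a n / (1 - u * q powi (2 * n)) * L) UNIV = appell3_sum \<beta> u q * L"
    unfolding appell3_sum_def a_def by (rule infsum_cmult_left')
  ultimately show ?thesis by (simp add: L_def \<beta>_def p_def)
qed

text \<open>The limit of the truncated expansions. The first three inequalities keep the theta
  values on the left nonzero, the last three keep the zero families disjoint, so that every pole is
  simple.\<close>

lemma three_theta_identity:
  assumes q: "norm q < 1" "q \<noteq> 0" and nz: "u \<noteq> 0" "v \<noteq> 0" "w \<noteq> 0"
    and u1: "\<And>k::int. u * q powi (2 * k) \<noteq> 1" and v1: "\<And>k::int. v * q powi (2 * k) \<noteq> 1"
    and w1: "\<And>k::int. w * q powi (2 * k) \<noteq> 1"
    and uv: "\<And>k::int. u * q powi (2 * k) \<noteq> v" and uw: "\<And>k::int. u * q powi (2 * k) \<noteq> w"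
    and vw: "\<And>k::int. v * q powi (2 * k) \<noteq> w"
  shows "(qpoch_inf (q\<^sup>2) (q\<^sup>2))\<^sup>2 / (qtheta u (q\<^sup>2) * qtheta v (q\<^sup>2) * qtheta w (q\<^sup>2)) =
     appell3_sum (u\<^sup>2 / (v * w)) u q / (qtheta (v / u) (q\<^sup>2) * qtheta (w / u) (q\<^sup>2)) +
     appell3_sum (v\<^sup>2 / (u * w)) v q / (qtheta (u / v) (q\<^sup>2) * qtheta (w / v) (q\<^sup>2)) +
     appell3_sum (w\<^sup>2 / (u * v)) w q / (qtheta (u / w) (q\<^sup>2) * qtheta (v / w) (q\<^sup>2))"
proof -
  define p where "p = q\<^sup>2"
  have p: "norm p < 1" using q by (simp add: norm_power power_less_one_iff p_def)
  have ratio: "x / y * q powi (2 * k) \<noteq> 1 \<and> y / x * q powi (2 * k) \<noteq> 1"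
    if xy: "\<And>k::int. x * q powi (2 * k) \<noteq> y" "x \<noteq> 0" "y \<noteq> 0" for x y and k :: int
  proof -
    have "x * q powi (2 * (- k)) \<noteq> y" by (rule xy(1))
    hence "x \<noteq> y * q powi (2 * k)"
      using q by (simp add: power_int_minus field_simps)
    thus ?thesis using xy(1)[of k] xy(2,3) by (simp add: field_simps)
  qed
  \<comment> \<open>Taking the value \<open>w\<close> for every index from 2 on makes the conditions
    required of each \<open>b i\<close> hold for all natural indices.\<close>
  define b where "b = (\<lambda>i::nat. if i = 0 then u else if i = 1 then v else w)"
  have b_simps: "b 0 = u" "b 1 = v" "b 2 = w" by (simp_all add: b_def)
  have bb: "b j / b i * q powi (2 * k) \<noteq> 1" if "i < 3" "j < 3" "i \<noteq> j" for i j k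
  proof -
    have "i = 0 \<or> i = 1 \<or> i = 2" "j = 0 \<or> j = 1 \<or> j = 2" using that by auto
    with that(3) show ?thesis
      using ratio[OF uv nz(1,2), of k] ratio[OF uw nz(1,3), of k] ratio[OF vw nz(2,3), of k]
      by (auto simp: b_simps simp del: One_nat_def)
  qed
  have tn: "qtheta x p \<noteq> 0" if x: "\<And>k::int. x * q powi (2 * k) \<noteq> 1" "x \<noteq> 0" for x
    unfolding qtheta_def using theta_factors_neq_1[OF x, folded p_def] qpoch_inf_nonzero[OF p] by auto
  have lim1: "(\<lambda>N. qpoch x p (Suc N) * qpoch (p / x) p N) \<longlonglongrightarrow> qtheta x p" for x
    unfolding qtheta_def by (intro tendsto_mult qpoch_tendsto p LIMSEQ_Suc)
  have pf: "1 / ((qpoch u p (Suc N) * qpoch (p / u) p N) * (qpoch v p (Suc N) * qpoch (p / v) p N) * (qpoch w p (Suc N) * qpoch (p / w) p N)) =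
    (\<Sum>n\<in>{-int N..int N}. three_theta_term q N u v w n) +
    (\<Sum>n\<in>{-int N..int N}. three_theta_term q N v u w n) +
    (\<Sum>n\<in>{-int N..int N}. three_theta_term q N w u v n)" for N
  proof -
    have "(\<Prod>i\<in>{..<3}. qpoch (b i) p (Suc N) * qpoch (p / b i) p N) =
       (qpoch (b 0) p (Suc N) * qpoch (p / b 0) p N) * (qpoch (b 1) p (Suc N) * qpoch (p / b 1) p N) * (qpoch (b 2) p (Suc N) * qpoch (p / b 2) p N)"
      by (simp only: numeral_3_eq_3 lessThan_Suc lessThan_0 numeral_2_eq_2 One_nat_def) (simp add: mult_ac)
    thus ?thesis
      using three_theta_partial_fractions[of q b N, OF q _ _ bb] nz u1 v1 w1
      unfolding p_def[symmetric] b_simps by (simp add: b_def)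
  qed
  have l1: "(\<lambda>N. 1 / ((qpoch u p (Suc N) * qpoch (p / u) p N) * (qpoch v p (Suc N) * qpoch (p / v) p N) * (qpoch w p (Suc N) * qpoch (p / w) p N)))
     \<longlonglongrightarrow> 1 / (qtheta u p * qtheta v p * qtheta w p)"
    by (intro tendsto_divide tendsto_mult lim1 tendsto_const) (use tn u1 v1 w1 nz in auto)
  define P where "P = qpoch_inf p p"
  have l2: "(\<lambda>N. (\<Sum>n\<in>{-int N..int N}. three_theta_term q N u v w n) +
    (\<Sum>n\<in>{-int N..int N}. three_theta_term q N v u w n) +
    (\<Sum>n\<in>{-int N..int N}. three_theta_term q N w u v n)) \<longlonglongrightarrow>
     appell3_sum (u\<^sup>2 / (v * w)) u q / (P\<^sup>2 * qtheta (v / u) p * qtheta (w / u) p) +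
     appell3_sum (v\<^sup>2 / (u * w)) v q / (P\<^sup>2 * qtheta (u / v) p * qtheta (w / v) p) +
     appell3_sum (w\<^sup>2 / (u * v)) w q / (P\<^sup>2 * qtheta (u / w) p * qtheta (v / w) p)"
    unfolding P_def p_def
    by (intro tendsto_add three_theta_term_limit q nz)
       (use ratio[OF uv nz(1,2)] ratio[OF uw nz(1,3)] ratio[OF vw nz(2,3)] in blast)+
  have eq: "1 / (qtheta u p * qtheta v p * qtheta w p) =
     appell3_sum (u\<^sup>2 / (v * w)) u q / (P\<^sup>2 * qtheta (v / u) p * qtheta (w / u) p) +
     appell3_sum (v\<^sup>2 / (u * w)) v q / (P\<^sup>2 * qtheta (u / v) p * qtheta (w / v) p) +
     appell3_sum (w\<^sup>2 / (u * v)) w q / (P\<^sup>2 * qtheta (u / w) p * qtheta (v / w) p)"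
    by (rule LIMSEQ_unique[OF l1[unfolded pf] l2])
  have P0: "P \<noteq> 0" unfolding P_def by (rule qpoch_inf_nonzero'[OF p p])
  have cancel: "P\<^sup>2 * (X / (P\<^sup>2 * Y * Z)) = X / (Y * Z)" for X Y Z
    using P0 by (simp add: mult.assoc)
  have "P\<^sup>2 / (qtheta u p * qtheta v p * qtheta w p) = P\<^sup>2 * (1 / (qtheta u p * qtheta v p * qtheta w p))" by simp
  thus ?thesis unfolding eq distrib_left cancel unfolding P_def p_def .
qed

section \<open>Splitting the theta series at an eighth root of unity\<close>

lemma has_sum_int_even_odd:
  fixes f :: "int \<Rightarrow> complex"
  assumes "((\<lambda>k. f (2 * k)) has_sum a) UNIV" "((\<lambda>k. f (2 * k + 1)) has_sum b) UNIV"
  shows "(f has_sum (a + b)) UNIV"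
proof -
  have 1: "(f has_sum a) (range (\<lambda>k. 2 * k))"
    using assms(1) by (subst has_sum_reindex) (auto simp: o_def inj_on_def)
  have 2: "(f has_sum b) (range (\<lambda>k. 2 * k + 1))"
    using assms(2) by (subst has_sum_reindex) (auto simp: o_def inj_on_def)
  have "(f has_sum (a + b)) (range (\<lambda>k. 2 * k) \<union> range (\<lambda>k. 2 * k + 1))"
    by (rule has_sum_Un_disjoint[OF 1 2]) (auto, presburger)
  moreover have "range (\<lambda>k::int. 2 * k) \<union> range (\<lambda>k. 2 * k + 1) = UNIV"
  proof -
    have "n \<in> range (\<lambda>k::int. 2 * k) \<union> range (\<lambda>k. 2 * k + 1)" for n :: int
      by (cases "even n") (auto elim!: evenE oddE)
    thus ?thesis by blast
  qed
  ultimately show ?thesis by simp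
qed

lemma theta_sum_even_odd:
  assumes q: "norm q < 1" "q \<noteq> 0" and y: "y \<noteq> 0"
  shows "theta_sum y q = theta_sum (y\<^sup>2) (q ^ 4) + y * q * theta_sum (y\<^sup>2 * q ^ 4) (q ^ 4)"
proof -
  have q4: "norm (q ^ 4) < 1" "q ^ 4 \<noteq> 0" using q by (auto simp: norm_power power_less_one_iff)
  have e4: "q powi (4 * k) = (q ^ 4) powi k" for k by (simp add: power_int_mult)
  have y2: "y powi (2 * k) = (y\<^sup>2) powi k" for k by (simp add: power_int_mult)
  have "q powi ((2 * k)\<^sup>2) * y powi (2 * k) = (q ^ 4) powi (k\<^sup>2) * (y\<^sup>2) powi k" for k :: int
    by (simp add: power_mult_distrib e4 y2)
  hence 1: "((\<lambda>k::int. q powi ((2 * k)\<^sup>2) * y powi (2 * k)) has_sum theta_sum (y\<^sup>2) (q ^ 4)) UNIV"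
    using has_sum_theta_sum[OF q4, of "y\<^sup>2"] y by simp
  have "q powi ((2 * k + 1)\<^sup>2) * y powi (2 * k + 1) = y * q * ((q ^ 4) powi (k\<^sup>2) * (y\<^sup>2 * q ^ 4) powi k)" for k :: int
  proof -
    have "(2 * k + 1)\<^sup>2 = 4 * k\<^sup>2 + 4 * k + 1" by (simp add: power2_eq_square algebra_simps)
    hence "q powi ((2 * k + 1)\<^sup>2) = q powi (4 * k\<^sup>2) * q powi (4 * k) * q powi 1"
      using q(2) by (simp only: power_int_add simp_thms)
    moreover have "y powi (2 * k + 1) = y powi (2 * k) * y" using y by (simp add: power_int_add)
    ultimately show ?thesis by (simp add: e4 y2 power_int_mult_distrib)
  qed
  hence 2: "((\<lambda>k::int. q powi ((2 * k + 1)\<^sup>2) * y powi (2 * k + 1)) has_sum (y * q * theta_sum (y\<^sup>2 * q ^ 4) (q ^ 4))) UNIV"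
    using has_sum_cmult_right[OF has_sum_theta_sum[OF q4, of "y\<^sup>2 * q ^ 4"], of "y * q"] y q by simp
  have "((\<lambda>n::int. q powi (n\<^sup>2) * y powi n) has_sum (theta_sum (y\<^sup>2) (q ^ 4) + y * q * theta_sum (y\<^sup>2 * q ^ 4) (q ^ 4))) UNIV"
    by (rule has_sum_int_even_odd[OF 1 2])
  thus ?thesis using has_sum_theta_sum[OF q y] has_sum_unique by blast
qed

lemma theta_sum_inverse:
  "theta_sum (inverse y) q = theta_sum y q"
proof -
  have "theta_sum y q = (\<Sum>\<^sub>\<infinity>n::int. q powi ((- n)\<^sup>2) * y powi (- n))"
    unfolding theta_sum_def by (rule infsum_reindex_bij_betw [symmetric]) (rule bij_uminus)
  also have "\<dots> = theta_sum (inverse y) q"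
    unfolding theta_sum_def by (simp add: power_int_minus power_int_inverse)
  finally show ?thesis ..
qed

lemma theta_sum_shift:
  assumes q: "q \<noteq> 0" and y: "y \<noteq> 0"
  shows "theta_sum y q = y * q * theta_sum (y * q\<^sup>2) q"
proof -
  have "theta_sum y q = (\<Sum>\<^sub>\<infinity>n::int. q powi ((n + 1)\<^sup>2) * y powi (n + 1))"
    unfolding theta_sum_def by (rule infsum_reindex_bij_betw [symmetric]) (rule bij_plus_right)
  also have "(\<lambda>n::int. q powi ((n + 1)\<^sup>2) * y powi (n + 1)) = (\<lambda>n. y * q * (q powi (n\<^sup>2) * (y * q\<^sup>2) powi n))"
  proof
    fix n :: int
    have "(n + 1)\<^sup>2 = n\<^sup>2 + 2 * n + 1" by (simp add: power2_eq_square algebra_simps)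
    hence "q powi ((n + 1)\<^sup>2) = q powi (n\<^sup>2) * q powi (2 * n) * q powi 1"
      using q by (simp only: power_int_add simp_thms)
    moreover have "q powi (2 * n) = (q\<^sup>2) powi n" by (simp add: power_int_mult)
    moreover have "y powi (n + 1) = y powi n * y" using y by (simp add: power_int_add)
    ultimately show "q powi ((n + 1)\<^sup>2) * y powi (n + 1) = y * q * (q powi (n\<^sup>2) * (y * q\<^sup>2) powi n)"
      by (simp add: power_int_mult_distrib)
  qed
  also have "(\<Sum>\<^sub>\<infinity>n::int. y * q * (q powi (n\<^sup>2) * (y * q\<^sup>2) powi n)) = y * q * theta_sum (y * q\<^sup>2) q"
    unfolding theta_sum_def by (rule infsum_cmult_right')
  finally show ?thesis .
qed

section \<open>Dissection of the theta series at the eighth root of unity\<close>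

definition zeta8 :: complex where "zeta8 = cis (pi / 4)"

lemma zeta8_square: "zeta8\<^sup>2 = \<i>"
  by (simp add: zeta8_def cis_mult power2_eq_square)

lemma norm_zeta8: "norm zeta8 = 1"
  by (simp add: zeta8_def)

lemma zeta8_nonzero: "zeta8 \<noteq> 0"
  by (simp add: zeta8_def)

lemma sqrt2_zeta8: "complex_of_real (sqrt 2) * zeta8 = 1 + \<i>"
  by (simp add: zeta8_def cis.code complex_eq_iff cos_45 sin_45)

lemma zeta8_mult_one_minus_ii: "zeta8 * (1 - \<i>) = complex_of_real (sqrt 2)"
  by (simp add: zeta8_def cis.code complex_eq_iff cos_45 sin_45)

text \<open>Two parity splittings sort the terms by \<open>n\<close> modulo 4. The class 2 cancels
  itself, and the classes 1 and 3 are proportional with ratio \<open>- i\<close>, so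
  \<open>zeta8\<close> occurs only in \<open>zeta8 * (1 - i) = sqrt 2\<close>.\<close>

lemma theta_sum_zeta8:
  assumes q: "norm q < 1" "q \<noteq> 0"
  shows "theta_sum zeta8 q = theta_sum (-1) (q ^ 16) + of_real (sqrt 2) * q * theta_sum (- (q ^ 8)) (q ^ 16)"
proof -
  have q4: "norm (q ^ 4) < 1" "q ^ 4 \<noteq> 0" using q by (auto simp: norm_power power_less_one_iff)
  have 1: "theta_sum zeta8 q = theta_sum \<i> (q ^ 4) + zeta8 * q * theta_sum (\<i> * q ^ 4) (q ^ 4)"
    using theta_sum_even_odd[OF q zeta8_nonzero] by (simp add: zeta8_square)
  have 2: "theta_sum \<i> (q ^ 4) = theta_sum (-1) (q ^ 16) + \<i> * q ^ 4 * theta_sum (- (q ^ 16)) (q ^ 16)"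
    using theta_sum_even_odd[OF q4, of \<i>] by (simp flip: power_mult)
  \<comment> \<open>Reflection and shift of the index relate this value to itself with opposite
    signs.\<close>
  have 3: "theta_sum (- (q ^ 16)) (q ^ 16) = 0"
  proof -
    have e: "- inverse (q ^ 16) * q ^ 16 = -1" "- inverse (q ^ 16) * (q ^ 16)\<^sup>2 = - (q ^ 16)"
      using q by (auto simp: field_simps simp flip: power_mult power_add)
    have "theta_sum (- inverse (q ^ 16)) (q ^ 16) =
        - inverse (q ^ 16) * q ^ 16 * theta_sum (- inverse (q ^ 16) * (q ^ 16)\<^sup>2) (q ^ 16)"
      by (rule theta_sum_shift) (use q in auto)
    hence "theta_sum (- inverse (q ^ 16)) (q ^ 16) = - theta_sum (- (q ^ 16)) (q ^ 16)"
      unfolding e by simp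
    moreover have "theta_sum (- inverse (q ^ 16)) (q ^ 16) = theta_sum (- (q ^ 16)) (q ^ 16)"
      using theta_sum_inverse[of "- (q ^ 16)"] by (simp add: inverse_minus_eq)
    ultimately show ?thesis by simp
  qed
  have 4: "theta_sum (\<i> * q ^ 4) (q ^ 4) = theta_sum (- (q ^ 8)) (q ^ 16) + \<i> * q ^ 8 * theta_sum (- (q ^ 24)) (q ^ 16)"
    using theta_sum_even_odd[OF q4, of "\<i> * q ^ 4"] q
    by (simp add: power_mult_distrib mult.assoc flip: power_mult power_add)
  have 5: "theta_sum (- (q ^ 8)) (q ^ 16) = - (q ^ 8 * theta_sum (- (q ^ 24)) (q ^ 16))"
  proof -
    have e: "- inverse (q ^ 8) * q ^ 16 = - (q ^ 8)" "- inverse (q ^ 8) * (q ^ 16)\<^sup>2 = - (q ^ 24)"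
      using q by (auto simp: field_simps simp flip: power_mult power_add)
    have "theta_sum (- (q ^ 8)) (q ^ 16) = theta_sum (- inverse (q ^ 8)) (q ^ 16)"
      using theta_sum_inverse[of "- (q ^ 8)"] by (simp add: inverse_minus_eq)
    also have "\<dots> = - inverse (q ^ 8) * q ^ 16 * theta_sum (- inverse (q ^ 8) * (q ^ 16)\<^sup>2) (q ^ 16)"
      by (rule theta_sum_shift) (use q in auto)
    finally show ?thesis unfolding e by simp
  qed
  have 6: "\<i> * q ^ 8 * theta_sum (- (q ^ 24)) (q ^ 16) = - \<i> * theta_sum (- (q ^ 8)) (q ^ 16)"
    unfolding 5 by simp
  have "theta_sum zeta8 q = theta_sum (-1) (q ^ 16) + (zeta8 * (1 - \<i>)) * q * theta_sum (- (q ^ 8)) (q ^ 16)"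
    unfolding 1 2 3 4 6 by (simp add: algebra_simps)
  thus ?thesis unfolding zeta8_mult_one_minus_ii .
qed

lemma qtheta_shift:
  assumes "norm p < 1" "p \<noteq> 0" "x \<noteq> 0"
  shows "qtheta x p = - x * qtheta (x * p) p"
proof -
  have 1: "qpoch_inf x p = (1 - x) * qpoch_inf (x * p) p" by (rule qpoch_inf_rec[OF assms(1)])
  have 2: "qpoch_inf (1 / x) p = (1 - 1 / x) * qpoch_inf (p / x) p"
    using qpoch_inf_rec[OF assms(1), of "1 / x"] by simp
  have 3: "p / (x * p) = 1 / x" using assms by simp
  have 4: "1 - x = - x * (1 - 1 / x)" using assms by (simp add: field_simps)
  show ?thesis unfolding qtheta_def 1 3 2 4 by (simp only: mult_ac)
qed

lemma qtheta_reflect: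
  assumes "p \<noteq> 0" "x \<noteq> 0"
  shows "qtheta (p / x) p = qtheta x p"
  using assms by (simp add: qtheta_def mult.commute)

section \<open>Bilateral companions of the third order mock theta functions\<close>

lemma qpoch_inf_minus_mult:
  assumes "norm t < 1"
  shows "qpoch_inf (- t) t * qpoch_inf t t = qpoch_inf (t\<^sup>2) (t\<^sup>2)"
  using qpoch_inf_mult_minus[OF assms, of t] by (simp add: mult.commute)

lemma qpoch_inf_euler_distinct_odd:
  assumes "norm t < 1"
  shows "qpoch_inf (- t) t * qpoch_inf t (t\<^sup>2) = 1"
proof -
  have t2: "norm (t\<^sup>2) < 1" using assms by (simp add: norm_power power_less_one_iff)
  have "qpoch_inf t t = qpoch_inf t (t\<^sup>2) * qpoch_inf (t\<^sup>2) (t\<^sup>2)"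
    using qpoch_inf_even_odd[OF assms, of t] by (simp add: power2_eq_square)
  hence "qpoch_inf (- t) t * qpoch_inf t (t\<^sup>2) * qpoch_inf (t\<^sup>2) (t\<^sup>2) = qpoch_inf (t\<^sup>2) (t\<^sup>2)"
    using qpoch_inf_minus_mult[OF assms] by (simp add: mult.assoc)
  moreover have "qpoch_inf (t\<^sup>2) (t\<^sup>2) \<noteq> 0" by (rule qpoch_inf_nonzero'[OF t2 t2])
  ultimately show ?thesis by simp
qed

text \<open>The product is arranged so that division by \<open>qpoch_inf t t\<close> leaves
  \<open>qpoch_inf (- t) (t\<^sup>2)\<close>, a factor of the final series with visibly nonnegative
  coefficients. The next lemma plays the same role for
  \<open>qpoch_inf (- (t\<^sup>2)) (t\<^sup>2)\<close>.\<close>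

lemma theta_sum_minus_one:
  assumes t: "norm t < 1" "t \<noteq> 0"
  shows "theta_sum (-1) (t\<^sup>2) = qpoch_inf t t * qpoch_inf (- t) (t\<^sup>2)"
proof -
  have t2: "norm (t\<^sup>2) < 1" "t\<^sup>2 \<noteq> 0" using t by (auto simp: norm_power power_less_one_iff)
  have t4: "norm ((t\<^sup>2)\<^sup>2) < 1" using t by (simp add: norm_power power_less_one_iff flip: power_mult)
  define A where "A = qpoch_inf (t\<^sup>2) ((t\<^sup>2)\<^sup>2)"
  have "theta_sum (-1) (t\<^sup>2) = qpoch_inf ((t\<^sup>2)\<^sup>2) ((t\<^sup>2)\<^sup>2) * A * A"
    using jacobi_triple_product[OF t2, of "-1"] t2 by (simp add: A_def)
  also have "qpoch_inf ((t\<^sup>2)\<^sup>2) ((t\<^sup>2)\<^sup>2) * A = qpoch_inf (t\<^sup>2) (t\<^sup>2)"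
    using qpoch_inf_even_odd[OF t2(1), of "t\<^sup>2"] by (simp add: A_def mult.commute power2_eq_square)
  also have "A = qpoch_inf t (t\<^sup>2) * qpoch_inf (- t) (t\<^sup>2)"
    using qpoch_inf_mult_minus[OF t2(1), of t] by (simp add: A_def)
  also have "qpoch_inf (t\<^sup>2) (t\<^sup>2) * (qpoch_inf t (t\<^sup>2) * qpoch_inf (- t) (t\<^sup>2)) = qpoch_inf t t * qpoch_inf (- t) (t\<^sup>2)"
    using qpoch_inf_even_odd[OF t(1), of t] by (simp add: mult_ac power2_eq_square)
  finally show ?thesis .
qed

lemma theta_sum_minus:
  assumes t: "norm t < 1" "t \<noteq> 0"
  shows "theta_sum (- t) (t\<^sup>2) = qpoch_inf t t * qpoch_inf (- (t\<^sup>2)) (t\<^sup>2)"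
proof -
  have t2: "norm (t\<^sup>2) < 1" "t\<^sup>2 \<noteq> 0" using t by (auto simp: norm_power power_less_one_iff)
  have "norm (t\<^sup>2) < norm (- t)" using t by (simp add: norm_mult power2_eq_square)
  hence "theta_sum (- t) (t\<^sup>2) = qpoch_inf ((t\<^sup>2)\<^sup>2) ((t\<^sup>2)\<^sup>2) * qpoch_inf (t * t\<^sup>2) ((t\<^sup>2)\<^sup>2) * qpoch_inf t ((t\<^sup>2)\<^sup>2)"
    using jacobi_triple_product[OF t2, of "- t"] t by (simp add: power2_eq_square)
  also have "\<dots> = qpoch_inf ((t\<^sup>2)\<^sup>2) ((t\<^sup>2)\<^sup>2) * qpoch_inf t (t\<^sup>2)"
    using qpoch_inf_even_odd[OF t2(1), of t] by (simp add: mult_ac)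
  also have "qpoch_inf ((t\<^sup>2)\<^sup>2) ((t\<^sup>2)\<^sup>2) = qpoch_inf (- (t\<^sup>2)) (t\<^sup>2) * qpoch_inf (t\<^sup>2) (t\<^sup>2)"
    by (rule qpoch_inf_minus_mult[OF t2(1), symmetric])
  also have "qpoch_inf (- (t\<^sup>2)) (t\<^sup>2) * qpoch_inf (t\<^sup>2) (t\<^sup>2) * qpoch_inf t (t\<^sup>2) = qpoch_inf t t * qpoch_inf (- (t\<^sup>2)) (t\<^sup>2)"
    using qpoch_inf_even_odd[OF t(1), of t] by (simp add: mult_ac power2_eq_square)
  finally show ?thesis .
qed

text \<open>The terms with negative index turn the mock theta function into its companion.\<close>
lemma phi_psi_relation:
  assumes t: "norm t < 1" "t \<noteq> 0"
  obtains A B where "((\<lambda>n. t ^ (n * n) / qpoch (- (t\<^sup>2)) (t\<^sup>2) n) has_sum A) UNIV"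
    "((\<lambda>m. t ^ Suc m * qpoch (- (t\<^sup>2)) (t\<^sup>2) m) has_sum B) UNIV"
    "A + 2 * B = theta_sum 1 t * theta_sum (-1) (t\<^sup>2) / qpoch_inf t t"
proof -
  define p where "p = t\<^sup>2"
  have p: "norm p < 1" "p \<noteq> 0" using t by (auto simp: norm_power power_less_one_iff p_def)
  define P where "P = qpoch_inf (- p) p"
  have P0: "P \<noteq> 0" unfolding P_def by (rule qpoch_inf_nonzero'[OF p(1)]) (use p in simp)
  \<comment> \<open>This is the bilateral summation at \<open>y = 1\<close>,
    \<open>b = - t\<^sup>2\<close>, whose terms with nonnegative \<open>n\<close> are those of phi
    up to the constant \<open>P\<close>.\<close>
  define f where "f = (\<lambda>n::int. t powi (n\<^sup>2) * qpoch_inf (- p * t powi (2 * n)) p)"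
  have "norm (- p) < norm (t * 1)" using t by (simp add: p_def norm_mult power2_eq_square)
  from bilateral_theta_summation[OF t _ this]
  have "(f has_sum (theta_sum 1 t / qpoch_inf t p)) UNIV"
    using t by (simp add: f_def p_def power2_eq_square)
  then obtain a b where a: "((\<lambda>n::nat. f (int n)) has_sum a) UNIV"
    and b: "((\<lambda>n::nat. f (- int n - 1)) has_sum b) UNIV" and ab: "theta_sum 1 t / qpoch_inf t p = a + b"
    by (rule has_sum_int_splitE)
  have f1: "f (int n) = P * (t ^ (n * n) / qpoch (- p) p n)" for n
  proof -
    have "P = qpoch (- p) p n * qpoch_inf (- p * p ^ n) p"
      unfolding P_def by (rule qpoch_inf_split[OF p(1)])
    moreover have "qpoch (- p) p n \<noteq> 0" by (rule qpoch_nonzero'[OF p(1)]) (use p in simp)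
    moreover have "f (int n) = t ^ (n * n) * qpoch_inf (- p * p ^ n) p"
      unfolding f_def powi_double_of_nat p_def by (simp add: power2_eq_square flip: of_nat_mult)
    ultimately show ?thesis by simp
  qed
  have f2: "f (- int m - 1) = 2 * P * (t ^ Suc m * qpoch (- p) p m)" for m
  proof -
    define x where "x = - p * t powi (2 * (- int m - 1))"
    have x: "x = - inverse (p ^ m)"
    proof -
      have "t powi (2 * (- int m - 1)) = inverse (t powi (2 * int (Suc m)))"
        unfolding power_int_minus[symmetric] by (rule arg_cong[where f = "\<lambda>k. t powi k"]) simp
      hence "t powi (2 * (- int m - 1)) = inverse (p ^ Suc m)" unfolding powi_double_of_nat p_def .
      thus ?thesis unfolding x_def using p by simp
    qed
    \<comment> \<open>The last factor is \<open>1 + 1\<close>, the origin of the 2 in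
      \<open>A + 2 * B\<close>; turning the other factors around uses up the power
      \<open>t ^ (m * Suc m)\<close>.\<close>
    have qp: "qpoch (- inverse (p ^ m)) p (Suc m) * t ^ (m * Suc m) = 2 * qpoch (- p) p m" for m
    proof (induction m)
      case (Suc m)
      have e: "- inverse (p ^ Suc m) * p = - inverse (p ^ m)" using p by simp
      have "qpoch (- inverse (p ^ Suc m)) p (Suc (Suc m)) = (1 + inverse (p ^ Suc m)) * qpoch (- inverse (p ^ m)) p (Suc m)"
        unfolding qpoch_Suc_shift[of _ _ "Suc m"] e by simp
      moreover have "t ^ (Suc m * Suc (Suc m)) = t ^ (m * Suc m) * p ^ Suc m"
      proof -
        have "Suc m * Suc (Suc m) = m * Suc m + 2 * Suc m" by simp
        thus ?thesis by (simp only: p_def power_mult power_add)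
      qed
      ultimately have "qpoch (- inverse (p ^ Suc m)) p (Suc (Suc m)) * t ^ (Suc m * Suc (Suc m)) =
          ((1 + inverse (p ^ Suc m)) * p ^ Suc m) * (qpoch (- inverse (p ^ m)) p (Suc m) * t ^ (m * Suc m))"
        by (simp only: mult_ac)
      also have "(1 + inverse (p ^ Suc m)) * p ^ Suc m = 1 - (- p) * p ^ m"
        using p by (simp add: field_simps)
      finally show ?case unfolding Suc by (simp add: qpoch_Suc mult_ac)
    qed (simp add: qpoch_Suc)
    have "x * p ^ Suc m = - p" unfolding x using p by simp
    hence "qpoch_inf x p = qpoch x p (Suc m) * P"
      unfolding P_def using qpoch_inf_split[OF p(1), of x "Suc m"] by simp
    moreover have "t powi ((- int m - 1)\<^sup>2) = t ^ Suc m * t ^ (m * Suc m)"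
    proof -
      have "(- int m - 1)\<^sup>2 = int (Suc m + m * Suc m)" by (simp add: power2_eq_square algebra_simps)
      thus ?thesis by (simp only: power_int_of_nat power_add)
    qed
    ultimately have "f (- int m - 1) = t ^ Suc m * P * (qpoch (- inverse (p ^ m)) p (Suc m) * t ^ (m * Suc m))"
      unfolding f_def x_def[symmetric] by (simp only: x mult_ac)
    thus ?thesis unfolding qp by (simp only: mult_ac)
  qed
  have A: "((\<lambda>n. t ^ (n * n) / qpoch (- p) p n) has_sum (a / P)) UNIV"
    using has_sum_cmult_right[OF a, of "1 / P"] P0 unfolding f1 by simp
  have B: "((\<lambda>m. t ^ Suc m * qpoch (- p) p m) has_sum (b / (2 * P))) UNIV"
    using has_sum_cmult_right[OF b, of "1 / (2 * P)"] P0 unfolding f2 by simp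
  have tp0: "qpoch_inf t p \<noteq> 0" "qpoch_inf t t \<noteq> 0"
    using qpoch_inf_nonzero'[OF p(1) t(1)] qpoch_inf_nonzero'[OF t(1) t(1)] by auto
  have "theta_sum (-1) p = qpoch_inf t t * qpoch_inf (- t) p"
    unfolding p_def by (rule theta_sum_minus_one[OF t])
  moreover have "P * qpoch_inf t p * qpoch_inf (- t) p = 1"
    using qpoch_inf_euler_distinct_odd[OF p(1)] qpoch_inf_mult_minus[OF p(1), of t]
    by (simp add: P_def mult.assoc) (simp add: p_def)
  ultimately have "theta_sum (-1) p * (P * qpoch_inf t p) = qpoch_inf t t"
    by (metis mult.assoc mult.commute mult_1_right)
  hence "theta_sum (-1) p / qpoch_inf t t = 1 / (P * qpoch_inf t p)"
    using P0 tp0 by (simp add: frac_eq_eq)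
  hence "theta_sum 1 t * theta_sum (-1) p / qpoch_inf t t = (theta_sum 1 t / qpoch_inf t p) / P"
    by (metis divide_divide_eq_left mult.commute times_divide_eq_right mult_1_right)
  hence "a / P + 2 * (b / (2 * P)) = theta_sum 1 t * theta_sum (-1) p / qpoch_inf t t"
    unfolding ab by (simp add: add_divide_distrib)
  thus ?thesis using that A B unfolding p_def by blast
qed

text \<open>The same completion with \<open>y = t\<close> and \<open>b = - t^3\<close>. At negative
  index all factors now carry odd powers of \<open>t\<close>, so none of them is
  \<open>1 + 1\<close> and the companion enters with coefficient 1.\<close>

lemma nu_relation:
  assumes t: "norm t < 1" "t \<noteq> 0"
  obtains A B where "((\<lambda>n. t ^ (n * n + n) / qpoch (- t) (t\<^sup>2) (Suc n)) has_sum A) UNIV"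
    "((\<lambda>m. t ^ m * qpoch (- t) (t\<^sup>2) m) has_sum B) UNIV"
    "A + B = theta_sum t t * theta_sum (- t) (t\<^sup>2) / qpoch_inf t t"
proof -
  define p where "p = t\<^sup>2"
  have p: "norm p < 1" "p \<noteq> 0" using t by (auto simp: norm_power power_less_one_iff p_def)
  define P where "P = qpoch_inf (- t) p"
  have P0: "P \<noteq> 0" unfolding P_def by (rule qpoch_inf_nonzero'[OF p(1)]) (use t in simp)
  define f where "f = (\<lambda>n::int. t powi (n\<^sup>2) * t powi n * qpoch_inf (- (t * p) * t powi (2 * n)) p)"
  have "norm (- (t * p)) < norm (t * t)" using t by (simp add: p_def norm_mult norm_power power2_eq_square)
  from bilateral_theta_summation[OF t t(2) this]
  have "(f has_sum (theta_sum t t / qpoch_inf t p)) UNIV"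
    using t by (simp add: f_def p_def power2_eq_square)
  then obtain a b where a: "((\<lambda>n::nat. f (int n)) has_sum a) UNIV"
    and b: "((\<lambda>n::nat. f (- int n - 1)) has_sum b) UNIV" and ab: "theta_sum t t / qpoch_inf t p = a + b"
    by (rule has_sum_int_splitE)
  have f1: "f (int n) = P * (t ^ (n * n + n) / qpoch (- t) p (Suc n))" for n
  proof -
    have "P = qpoch (- t) p (Suc n) * qpoch_inf (- t * p ^ Suc n) p"
      unfolding P_def by (rule qpoch_inf_split[OF p(1)])
    moreover have "qpoch (- t) p (Suc n) \<noteq> 0" by (rule qpoch_nonzero'[OF p(1)]) (use t in simp)
    moreover have "f (int n) = t ^ (n * n + n) * qpoch_inf (- t * p ^ Suc n) p"
      unfolding f_def powi_double_of_nat p_def by (simp add: power2_eq_square power_add mult_ac flip: of_nat_mult)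
    ultimately show ?thesis by simp
  qed
  have f2: "f (- int m - 1) = P * (t ^ m * qpoch (- t) p m)" for m
  proof -
    define x where "x = - (t * p) * t powi (2 * (- int m - 1))"
    have x: "x = - t * inverse (p ^ m)"
    proof -
      have "t powi (2 * (- int m - 1)) = inverse (t powi (2 * int (Suc m)))"
        unfolding power_int_minus[symmetric] by (rule arg_cong[where f = "\<lambda>k. t powi k"]) simp
      hence "t powi (2 * (- int m - 1)) = inverse (p ^ Suc m)" unfolding powi_double_of_nat p_def .
      thus ?thesis unfolding x_def using p by simp
    qed
    have qp: "qpoch (- t * inverse (p ^ m)) p m * t ^ (m * m) = qpoch (- t) p m" for m
    proof (induction m)
      case (Suc m)
      have e: "- t * inverse (p ^ Suc m) * p = - t * inverse (p ^ m)" using p by simp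
      have "qpoch (- t * inverse (p ^ Suc m)) p (Suc m) = (1 + t * inverse (p ^ Suc m)) * qpoch (- t * inverse (p ^ m)) p m"
        unfolding qpoch_Suc_shift[of _ _ m] e by simp
      moreover have "t ^ (Suc m * Suc m) = t ^ (m * m) * (t * p ^ m)"
      proof -
        have "Suc m * Suc m = m * m + Suc (2 * m)" by simp
        thus ?thesis by (simp only: p_def power_mult power_Suc power_add)
      qed
      ultimately have "qpoch (- t * inverse (p ^ Suc m)) p (Suc m) * t ^ (Suc m * Suc m) =
          ((1 + t * inverse (p ^ Suc m)) * (t * p ^ m)) * (qpoch (- t * inverse (p ^ m)) p m * t ^ (m * m))"
        by (simp only: mult_ac)
      also have "(1 + t * inverse (p ^ Suc m)) * (t * p ^ m) = 1 - (- t) * p ^ m"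
      proof -
        have "t * inverse (p ^ Suc m) * (t * p ^ m) = 1"
          using t by (simp add: p_def power2_eq_square field_simps)
        thus ?thesis by (simp add: algebra_simps)
      qed
      finally show ?case unfolding Suc by (simp add: qpoch_Suc mult_ac)
    qed simp
    have "x * p ^ m = - t" unfolding x using p by simp
    hence "qpoch_inf x p = qpoch x p m * P"
      unfolding P_def using qpoch_inf_split[OF p(1), of x m] by simp
    moreover have "t powi ((- int m - 1)\<^sup>2) * t powi (- int m - 1) = t ^ m * t ^ (m * m)"
    proof -
      have "(- int m - 1)\<^sup>2 + (- int m - 1) = int (m + m * m)" by (simp add: power2_eq_square algebra_simps)
      moreover have "t powi ((- int m - 1)\<^sup>2) * t powi (- int m - 1) = t powi ((- int m - 1)\<^sup>2 + (- int m - 1))"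
        using t(2) by (simp only: power_int_add simp_thms)
      ultimately show ?thesis by (simp only: power_int_of_nat power_add)
    qed
    ultimately have "f (- int m - 1) = t ^ m * P * (qpoch (- t * inverse (p ^ m)) p m * t ^ (m * m))"
      unfolding f_def x_def[symmetric] by (simp only: x mult_ac)
    thus ?thesis unfolding qp by (simp only: mult_ac)
  qed
  have A: "((\<lambda>n. t ^ (n * n + n) / qpoch (- t) p (Suc n)) has_sum (a / P)) UNIV"
    using has_sum_cmult_right[OF a, of "1 / P"] P0 unfolding f1 by simp
  have B: "((\<lambda>m. t ^ m * qpoch (- t) p m) has_sum (b / P)) UNIV"
    using has_sum_cmult_right[OF b, of "1 / P"] P0 unfolding f2 by simp
  have tp0: "qpoch_inf t p \<noteq> 0" "qpoch_inf t t \<noteq> 0"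
    using qpoch_inf_nonzero'[OF p(1) t(1)] qpoch_inf_nonzero'[OF t(1) t(1)] by auto
  have "theta_sum (- t) p = qpoch_inf t t * qpoch_inf (- p) p"
    unfolding p_def by (rule theta_sum_minus[OF t])
  moreover have "P * qpoch_inf t p * qpoch_inf (- p) p = 1"
    using qpoch_inf_euler_distinct_odd[OF p(1)] qpoch_inf_mult_minus[OF p(1), of t]
    by (simp add: P_def mult_ac) (simp add: p_def mult_ac)
  ultimately have "theta_sum (- t) p * (P * qpoch_inf t p) = qpoch_inf t t"
    by (metis mult.assoc mult.commute mult_1_right)
  hence "theta_sum (- t) p / qpoch_inf t t = 1 / (P * qpoch_inf t p)"
    using P0 tp0 by (simp add: frac_eq_eq)
  hence "theta_sum t t * theta_sum (- t) p / qpoch_inf t t = (theta_sum t t / qpoch_inf t p) / P"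
    by (metis divide_divide_eq_left mult.commute times_divide_eq_right mult_1_right)
  hence "a / P + b / P = theta_sum t t * theta_sum (- t) p / qpoch_inf t t"
    unfolding ab by (simp add: add_divide_distrib)
  thus ?thesis using that A B unfolding p_def by blast
qed

section \<open>The rank generating function at an eighth root of unity\<close>

lemma has_sum_appell3_sum:
  assumes q: "norm q < 1" "q \<noteq> 0" and x: "x \<noteq> 0" and beta: "\<beta> \<noteq> 0"
  shows "((\<lambda>n::int. (-1) powi n * q powi (3 * n\<^sup>2 + 3 * n) * \<beta> powi n / (1 - x * q powi (2 * n))) has_sum
          appell3_sum \<beta> x q) UNIV"
proof -
  obtain C where C: "C > 0" "\<And>k::int. norm (1 / (1 - x * q powi (2 * k))) \<le> C"
    using inverse_one_minus_powi_bounded[OF q x] by blast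
  define a where "a = (\<lambda>n::int. (-1) powi n * q powi (3 * n\<^sup>2 + 3 * n) * \<beta> powi n)"
  have as: "(\<lambda>n. norm (a n) * C) summable_on UNIV"
    unfolding a_def by (intro summable_on_cmult_left summable_appell3_numerators q beta)
  have "(\<lambda>n. norm (a n / (1 - x * q powi (2 * n)))) summable_on UNIV"
  proof (rule Infinite_Sum.abs_summable_on_comparison_test'[OF as])
    fix n :: int
    have "norm (a n / (1 - x * q powi (2 * n))) = norm (a n) * norm (1 / (1 - x * q powi (2 * n)))"
      by (simp add: norm_divide)
    also have "\<dots> \<le> norm (a n) * C" by (intro mult_left_mono C) auto
    finally show "norm (a n / (1 - x * q powi (2 * n))) \<le> norm (a n) * C" .
  qed
  hence "(\<lambda>n. a n / (1 - x * q powi (2 * n))) summable_on UNIV"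
    by (rule abs_summable_summable)
  thus ?thesis unfolding a_def appell3_sum_def by (rule has_sum_infsum)
qed

lemma has_sum_appell_sum:
  assumes q: "norm q < 1" "q \<noteq> 0" and x: "x \<noteq> 0"
  shows "((\<lambda>k::int. (-1) powi k * q powi (3 * k\<^sup>2 + (2 * int a + 1) * k) / (1 - x * q powi (2 * k))) has_sum
          appell_sum a x q) UNIV"
proof -
  define \<beta> where "\<beta> = q powi (2 * int a - 2)"
  have eq: "(-1) powi n * q powi (3 * n\<^sup>2 + 3 * n) * \<beta> powi n / (1 - x * q powi (2 * n)) =
        (-1) powi n * q powi (3 * n\<^sup>2 + (2 * int a + 1) * n) / (1 - x * q powi (2 * n))" for n :: int
  proof -
    have "q powi (3 * n\<^sup>2 + 3 * n) * \<beta> powi n = q powi (3 * n\<^sup>2 + 3 * n + (2 * int a - 2) * n)"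
      unfolding \<beta>_def using q(2) by (simp only: power_int_add power_int_mult simp_thms)
    also have "3 * n\<^sup>2 + 3 * n + (2 * int a - 2) * n = 3 * n\<^sup>2 + (2 * int a + 1) * n"
      by (simp add: algebra_simps)
    finally show ?thesis by (simp add: mult.assoc)
  qed
  have "\<beta> \<noteq> 0" using q by (simp add: \<beta>_def)
  from has_sum_appell3_sum[OF q x this] show ?thesis
    unfolding eq appell_sum_def by (intro has_sum_infsum has_sum_imp_summable)
qed

lemma appell3_sum_one: "appell3_sum 1 x q = appell_sum 1 x q"
  by (simp add: appell3_sum_def appell_sum_def)

lemma powi_neq_of_norm:
  fixes q :: complex
  assumes "norm q < 1" "q \<noteq> 0" "norm c = 1" "norm d = 1" "m \<noteq> n"
  shows "c * q powi m \<noteq> d * q powi n"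
proof
  assume "c * q powi m = d * q powi n"
  hence "norm (c * q powi m) = norm (d * q powi n)" by simp
  hence "norm q powi m = norm q powi n" using assms by (simp add: norm_mult norm_power_int)
  hence "of_real (norm q) powi m = (of_real (norm q) powi n :: complex)"
    by (simp only: flip: of_real_power_int)
  thus False using powi_eq_iff_complex[of "of_real (norm q)" m n] assms by simp
qed

text \<open>Shifting the index of the second sum by one gives both sums the Gaussian
  \<open>q^(3 n^2)\<close>, and the terms become \<open>i^n / (1 - y) - (- i)^n / (1 + y)\<close>
  with \<open>y = i zeta8 q^(2n)\<close>. For even \<open>n\<close> the two numerators agree and the
  fractions give \<open>2 y / (1 - y^2)\<close>; for odd \<open>n\<close> they are opposite and give
  \<open>2 / (1 - y^2)\<close>. Since \<open>y^2 = - i q^(4n)\<close>, the denominators lose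
  \<open>zeta8\<close> and each parity class is an Appell sum in base \<open>q^4\<close>.\<close>

lemma appell3_zeta8_combination:
  assumes q: "norm q < 1" "q \<noteq> 0"
  shows "appell3_sum (- \<i> / q ^ 3) (\<i> * zeta8) q + \<i> * q ^ 3 * appell3_sum (\<i> * q ^ 3) (- (\<i> * zeta8 * q\<^sup>2)) q =
         2 * \<i> * zeta8 * appell_sum 0 (- \<i>) (q ^ 4) + 2 * \<i> * q ^ 3 * appell_sum 1 (- (\<i> * q ^ 4)) (q ^ 4)"
proof -
  define f where "f = (\<lambda>n::int. q powi (3 * n\<^sup>2) * (\<i> powi n / (1 - \<i> * zeta8 * q powi (2 * n)) - (- \<i>) powi n / (1 + \<i> * zeta8 * q powi (2 * n))))"
  have q4: "norm (q ^ 4) < 1" "q ^ 4 \<noteq> 0" using q by (auto simp: norm_power power_less_one_iff)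
  have q3: "q powi (3 * n) = (q ^ 3) powi n" for n by (simp add: power_int_mult)
  have s2: "((\<lambda>n. q powi (3 * n\<^sup>2) * \<i> powi n / (1 - \<i> * zeta8 * q powi (2 * n))) has_sum appell3_sum (- \<i> / q ^ 3) (\<i> * zeta8) q) UNIV"
  proof -
    have "(-1) powi n * q powi (3 * n\<^sup>2 + 3 * n) * (- \<i> / q ^ 3) powi n = q powi (3 * n\<^sup>2) * \<i> powi n" for n
    proof -
      have "(-1) powi n * (q ^ 3) powi n * (- \<i> / q ^ 3) powi n = ((-1) * q ^ 3 * (- \<i> / q ^ 3)) powi n"
        by (simp only: power_int_mult_distrib)
      also have "(-1) * q ^ 3 * (- \<i> / q ^ 3) = \<i>" using q by simp
      finally have "(-1) powi n * (q ^ 3) powi n * (- \<i> / q ^ 3) powi n = \<i> powi n" .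
      moreover have "q powi (3 * n\<^sup>2 + 3 * n) = q powi (3 * n\<^sup>2) * (q ^ 3) powi n"
        unfolding q3[symmetric] using q(2) by (simp only: power_int_add simp_thms)
      moreover from this have "(-1) powi n * q powi (3 * n\<^sup>2 + 3 * n) * (- \<i> / q ^ 3) powi n =
          q powi (3 * n\<^sup>2) * ((-1) powi n * (q ^ 3) powi n * (- \<i> / q ^ 3) powi n)"
        by (simp only: mult_ac)
      ultimately show ?thesis by (simp only:)
    qed
    thus ?thesis using has_sum_appell3_sum[OF q, of "\<i> * zeta8" "- \<i> / q ^ 3"] q zeta8_nonzero by simp
  qed
  have s3: "((\<lambda>n. - (q powi (3 * n\<^sup>2) * (- \<i>) powi n / (1 + \<i> * zeta8 * q powi (2 * n)))) has_sum
      (\<i> * q ^ 3 * appell3_sum (\<i> * q ^ 3) (- (\<i> * zeta8 * q\<^sup>2)) q)) UNIV"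
  proof -
    define g where "g = (\<lambda>n::int. (-1) powi n * q powi (3 * n\<^sup>2 + 3 * n) * (\<i> * q ^ 3) powi n / (1 - (- (\<i> * zeta8 * q\<^sup>2)) * q powi (2 * n)))"
    have "(g has_sum appell3_sum (\<i> * q ^ 3) (- (\<i> * zeta8 * q\<^sup>2)) q) UNIV"
      unfolding g_def by (rule has_sum_appell3_sum[OF q]) (use q zeta8_nonzero in auto)
    hence "((\<lambda>n. g (n - 1)) has_sum appell3_sum (\<i> * q ^ 3) (- (\<i> * zeta8 * q\<^sup>2)) q) UNIV"
      by (subst has_sum_reindex_bij_betw[of "\<lambda>n::int. n - 1" UNIV UNIV g])
         (auto intro!: bij_betwI[where g = "\<lambda>n. n + 1"])
    hence "((\<lambda>n. \<i> * q ^ 3 * g (n - 1)) has_sum (\<i> * q ^ 3 * appell3_sum (\<i> * q ^ 3) (- (\<i> * zeta8 * q\<^sup>2)) q)) UNIV"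
      by (rule has_sum_cmult_right)
    moreover have "\<i> * q ^ 3 * g (n - 1) = - (q powi (3 * n\<^sup>2) * (- \<i>) powi n / (1 + \<i> * zeta8 * q powi (2 * n)))" for n
    proof -
      have d: "- (\<i> * zeta8 * q\<^sup>2) * q powi (2 * (n - 1)) = - (\<i> * zeta8 * q powi (2 * n))"
      proof -
        have "q\<^sup>2 * q powi (2 * (n - 1)) = q powi (2 + 2 * (n - 1))"
          using q(2) by (subst power_int_add) auto
        also have "2 + 2 * (n - 1) = 2 * n" by simp
        finally show ?thesis by (simp add: mult.assoc)
      qed
      have "(-1) powi (n - 1) * (q ^ 3) powi n * (\<i> * q ^ 3) powi (n - 1) * (\<i> * q ^ 3) =
            - ((-1) powi n) * (q ^ 3) powi n * (\<i> * q ^ 3) powi n"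
        using q by (simp add: power_int_diff)
      also have "- ((-1) powi n) * (q ^ 3) powi n * (\<i> * q ^ 3) powi n = - (((-1) * \<i>) powi n * ((q ^ 3) powi n * (q ^ 3) powi n))"
        unfolding power_int_mult_distrib by (simp only: mult_ac mult_minus_left mult_minus_right)
      also have "(q ^ 3) powi n * (q ^ 3) powi n = q powi (6 * n)"
      proof -
        have "6 * n = 3 * n + 3 * n" by simp
        thus ?thesis unfolding q3[symmetric] using q(2) by (simp only: power_int_add simp_thms)
      qed
      finally have e: "(-1) powi (n - 1) * (q ^ 3) powi n * (\<i> * q ^ 3) powi (n - 1) * (\<i> * q ^ 3) = - ((- \<i>) powi n * q powi (6 * n))"
        by simp
      have "q powi (3 * (n - 1)\<^sup>2 + 3 * (n - 1)) = q powi (3 * n\<^sup>2 - 6 * n) * (q ^ 3) powi n"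
      proof -
        have "3 * (n - 1)\<^sup>2 + 3 * (n - 1) = (3 * n\<^sup>2 - 6 * n) + 3 * n" by (simp add: power2_eq_square algebra_simps)
        thus ?thesis unfolding q3[symmetric] using q(2) by (simp only: power_int_add simp_thms)
      qed
      hence "(-1) powi (n - 1) * q powi (3 * (n - 1)\<^sup>2 + 3 * (n - 1)) * (\<i> * q ^ 3) powi (n - 1) * (\<i> * q ^ 3) =
         q powi (3 * n\<^sup>2 - 6 * n) * ((-1) powi (n - 1) * (q ^ 3) powi n * (\<i> * q ^ 3) powi (n - 1) * (\<i> * q ^ 3))"
        by (simp only: mult_ac)
      also have "\<dots> = - ((- \<i>) powi n * (q powi (3 * n\<^sup>2 - 6 * n) * q powi (6 * n)))"
        unfolding e by (simp only: mult_ac mult_minus_left mult_minus_right)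
      also have "q powi (3 * n\<^sup>2 - 6 * n) * q powi (6 * n) = q powi (3 * n\<^sup>2)"
      proof -
        have "3 * n\<^sup>2 = (3 * n\<^sup>2 - 6 * n) + 6 * n" by simp
        hence "q powi (3 * n\<^sup>2) = q powi ((3 * n\<^sup>2 - 6 * n) + 6 * n)" by (rule arg_cong)
        also have "\<dots> = q powi (3 * n\<^sup>2 - 6 * n) * q powi (6 * n)" by (rule power_int_add) (use q in simp)
        finally show ?thesis ..
      qed
      finally have N: "(-1) powi (n - 1) * q powi (3 * (n - 1)\<^sup>2 + 3 * (n - 1)) * (\<i> * q ^ 3) powi (n - 1) * (\<i> * q ^ 3) =
        - ((- \<i>) powi n * q powi (3 * n\<^sup>2))" .
      have "\<i> * q ^ 3 * g (n - 1) = (-1) powi (n - 1) * q powi (3 * (n - 1)\<^sup>2 + 3 * (n - 1)) * (\<i> * q ^ 3) powi (n - 1) * (\<i> * q ^ 3) /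
          (1 - - (\<i> * zeta8 * q powi (2 * n)))"
        unfolding g_def d by (simp only: times_divide_eq_right mult_ac)
      thus ?thesis unfolding N by (simp add: mult.commute)
    qed
    ultimately show ?thesis by simp
  qed
  have "f = (\<lambda>n. q powi (3 * n\<^sup>2) * \<i> powi n / (1 - \<i> * zeta8 * q powi (2 * n)) +
      - (q powi (3 * n\<^sup>2) * (- \<i>) powi n / (1 + \<i> * zeta8 * q powi (2 * n))))"
    by (simp add: f_def right_diff_distrib)
  hence 1: "(f has_sum (appell3_sum (- \<i> / q ^ 3) (\<i> * zeta8) q + \<i> * q ^ 3 * appell3_sum (\<i> * q ^ 3) (- (\<i> * zeta8 * q\<^sup>2)) q)) UNIV"
    using has_sum_add[OF s2 s3] by (simp only:)
  have frac: "1 / (1 - y) - 1 / (1 + y) = 2 * y / (1 - y\<^sup>2)" "1 / (1 - y) + 1 / (1 + y) = 2 / (1 - y\<^sup>2)"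
    if "y\<^sup>2 \<noteq> 1" for y :: complex
  proof -
    have e: "1 - y\<^sup>2 = (1 - y) * (1 + y)" by (simp add: power2_eq_square algebra_simps)
    have "(1 - y) * (1 + y) \<noteq> 0" using that unfolding e[symmetric] by simp
    hence n: "1 - y \<noteq> 0" "1 + y \<noteq> 0" by auto
    show "1 / (1 - y) - 1 / (1 + y) = 2 * y / (1 - y\<^sup>2)" "1 / (1 - y) + 1 / (1 + y) = 2 / (1 - y\<^sup>2)"
      unfolding e diff_frac_eq[OF n] add_frac_eq[OF n] by simp_all
  qed
  have ysq: "(\<i> * zeta8 * q powi k)\<^sup>2 = - \<i> * q powi (2 * k)" for k
  proof -
    have "(q powi k)\<^sup>2 = q powi (k * 2)" by (simp add: power_int_mult)
    thus ?thesis by (simp add: power_mult_distrib zeta8_square mult.commute)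
  qed
  have y1: "(\<i> * zeta8 * q powi k)\<^sup>2 \<noteq> 1" for k
  proof (cases "k = 0")
    case False
    thus ?thesis unfolding ysq using powi_neq_of_norm[OF q, of "- \<i>" 1 "2 * k" 0] by simp
  qed (simp add: power_mult_distrib zeta8_square complex_eq_iff)
  have ev: "((\<lambda>m. f (2 * m)) has_sum (2 * \<i> * zeta8 * appell_sum 0 (- \<i>) (q ^ 4))) UNIV"
  proof -
    have "f (2 * m) = 2 * \<i> * zeta8 * ((-1) powi m * (q ^ 4) powi (3 * m\<^sup>2 + (2 * int 0 + 1) * m) / (1 - (- \<i>) * (q ^ 4) powi (2 * m)))" for m
    proof -
      define y where "y = \<i> * zeta8 * q powi (2 * (2 * m))"
      have i2: "\<i> powi (2 * m) = (-1) powi m" "(- \<i>) powi (2 * m) = (-1) powi m" by (simp_all add: power_int_mult)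
      have "f (2 * m) = q powi (3 * (2 * m)\<^sup>2) * (-1) powi m * (1 / (1 - y) - 1 / (1 + y))"
        unfolding f_def y_def i2 by (simp add: algebra_simps)
      also have "1 / (1 - y) - 1 / (1 + y) = 2 * y / (1 - y\<^sup>2)" by (rule frac) (simp only: y_def y1 not_False_eq_True)
      also have "y\<^sup>2 = - \<i> * (q ^ 4) powi (2 * m)"
      proof -
        have "q powi (2 * (2 * (2 * m))) = (q powi 4) powi (2 * m)" unfolding power_int_mult[symmetric] by simp
        thus ?thesis unfolding y_def ysq by simp
      qed
      also have "q powi (3 * (2 * m)\<^sup>2) * (-1) powi m * (2 * y / (1 - - \<i> * (q ^ 4) powi (2 * m))) =
         2 * \<i> * zeta8 * ((-1) powi m * (q powi (3 * (2 * m)\<^sup>2) * q powi (2 * (2 * m))) / (1 - - \<i> * (q ^ 4) powi (2 * m)))"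
        by (simp add: y_def)
      also have "q powi (3 * (2 * m)\<^sup>2) * q powi (2 * (2 * m)) = (q ^ 4) powi (3 * m\<^sup>2 + (2 * int 0 + 1) * m)"
      proof -
        have "q powi (3 * (2 * m)\<^sup>2) * q powi (2 * (2 * m)) = q powi (3 * (2 * m)\<^sup>2 + 2 * (2 * m))"
          using q(2) by (simp only: power_int_add simp_thms)
        also have "3 * (2 * m)\<^sup>2 + 2 * (2 * m) = 4 * (3 * m\<^sup>2 + (2 * int 0 + 1) * m)" by (simp add: power2_eq_square)
        also have "q powi \<dots> = (q powi 4) powi (3 * m\<^sup>2 + (2 * int 0 + 1) * m)" by (rule power_int_mult)
        finally show ?thesis by simp
      qed
      finally show ?thesis .
    qed
    thus ?thesis using has_sum_cmult_right[OF has_sum_appell_sum[OF q4, of "- \<i>" 0], of "2 * \<i> * zeta8"] by simp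
  qed
  have od: "((\<lambda>m. f (2 * m + 1)) has_sum (2 * \<i> * q ^ 3 * appell_sum 1 (- (\<i> * q ^ 4)) (q ^ 4))) UNIV"
  proof -
    have "f (2 * m + 1) = 2 * \<i> * q ^ 3 * ((-1) powi m * (q ^ 4) powi (3 * m\<^sup>2 + (2 * int 1 + 1) * m) / (1 - (- (\<i> * q ^ 4)) * (q ^ 4) powi (2 * m)))" for m
    proof -
      define y where "y = \<i> * zeta8 * q powi (2 * (2 * m + 1))"
      have i2: "\<i> powi (2 * m + 1) = \<i> * (-1) powi m" "(- \<i>) powi (2 * m + 1) = - (\<i> * (-1) powi m)"
        by (simp_all add: power_int_add power_int_mult)
      have "f (2 * m + 1) = q powi (3 * (2 * m + 1)\<^sup>2) * (\<i> * (-1) powi m) * (1 / (1 - y) + 1 / (1 + y))"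
        unfolding f_def y_def i2 by (simp add: algebra_simps)
      also have "1 / (1 - y) + 1 / (1 + y) = 2 / (1 - y\<^sup>2)" by (rule frac) (simp only: y_def y1 not_False_eq_True)
      also have "y\<^sup>2 = - (\<i> * q ^ 4) * (q ^ 4) powi (2 * m)"
      proof -
        have "q powi (2 * (2 * (2 * m + 1))) = q powi 4 * (q powi 4) powi (2 * m)"
          unfolding power_int_mult[symmetric] using q(2) by (subst power_int_add[symmetric]) (auto simp: add.commute)
        thus ?thesis unfolding y_def ysq by simp
      qed
      also have "q powi (3 * (2 * m + 1)\<^sup>2) = q ^ 3 * (q ^ 4) powi (3 * m\<^sup>2 + (2 * int 1 + 1) * m)"
      proof -
        have "3 * (2 * m + 1)\<^sup>2 = 3 + 4 * (3 * m\<^sup>2 + (2 * int 1 + 1) * m)" by (simp add: power2_eq_square algebra_simps)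
        hence "q powi (3 * (2 * m + 1)\<^sup>2) = q powi 3 * q powi (4 * (3 * m\<^sup>2 + (2 * int 1 + 1) * m))"
          using q(2) by (simp only: power_int_add simp_thms)
        also have "q powi (4 * (3 * m\<^sup>2 + (2 * int 1 + 1) * m)) = (q powi 4) powi (3 * m\<^sup>2 + (2 * int 1 + 1) * m)"
          by (rule power_int_mult)
        finally show ?thesis by simp
      qed
      finally show ?thesis by (simp add: mult_ac)
    qed
    thus ?thesis using has_sum_cmult_right[OF has_sum_appell_sum[OF q4, of "- (\<i> * q ^ 4)" 1], of "2 * \<i> * q ^ 3"] q by simp
  qed
  from has_sum_unique[OF 1 has_sum_int_even_odd[OF ev od]] show ?thesis .
qed

text \<open>Neither this nor \<open>psi_series\<close> is the series being completed: they are the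
  negative-index halves in \<open>nu_relation\<close> and \<open>phi_psi_relation\<close>, chosen
  because their expansions have only nonnegative coefficients.\<close>

definition nu_series :: "complex \<Rightarrow> complex" where
  "nu_series t = (\<Sum>\<^sub>\<infinity>m. t ^ m * qpoch (- t) (t\<^sup>2) m)"

definition psi_series :: "complex \<Rightarrow> complex" where
  "psi_series t = (\<Sum>\<^sub>\<infinity>m. t ^ Suc m * qpoch (- (t\<^sup>2)) (t\<^sup>2) m)"

lemma rank_series_zeta8_aux:
  assumes q: "norm q < 1" "q \<noteq> 0"
  shows "q * appell_sum 1 (zeta8 * q) q / qpoch_inf (q\<^sup>2) (q\<^sup>2) =
      theta_sum zeta8 q * theta_sum 1 (q\<^sup>2) / (of_real (sqrt 2) * qpoch_inf (q ^ 8) (q ^ 8)) -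
      (zeta8 * appell_sum 0 (- \<i>) (q ^ 4) + q ^ 3 * appell_sum 1 (- (\<i> * q ^ 4)) (q ^ 4)) / qpoch_inf (q ^ 8) (q ^ 8)"
proof -
  define z where "z = zeta8"
  define p where "p = q\<^sup>2"
  define E where "E = qpoch_inf p p"
  define E8 where "E8 = qpoch_inf (q ^ 8) (q ^ 8)"
  define th where "th = qpoch_inf (- p) (p\<^sup>2)"
  define w0 where "w0 = qtheta (-1) p"
  define M where "M = qpoch_inf (- (q ^ 8)) (q ^ 8)"
  define T where "T = qtheta (z * q) p"
  define S where "S = appell_sum 1 (z * q) q"
  define W where "W = zeta8 * appell_sum 0 (- \<i>) (q ^ 4) + q ^ 3 * appell_sum 1 (- (\<i> * q ^ 4)) (q ^ 4)"
  have p: "norm p < 1" "p \<noteq> 0" using q by (auto simp: norm_power power_less_one_iff p_def)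
  have p2: "norm (p\<^sup>2) < 1" "p\<^sup>2 \<noteq> 0" using p by (auto simp: norm_power power_less_one_iff)
  have q4: "norm (q ^ 4) < 1" "q ^ 4 \<noteq> 0" and q8: "norm (q ^ 8) < 1" "q ^ 8 \<noteq> 0"
    using q by (auto simp: norm_power power_less_one_iff)
  have pq: "p\<^sup>2 = q ^ 4" "(p\<^sup>2)\<^sup>2 = q ^ 8" "(q ^ 4)\<^sup>2 = q ^ 8" by (simp_all add: p_def flip: power_mult)
  have z: "norm z = 1" "z \<noteq> 0" "z\<^sup>2 = \<i>" using norm_zeta8 zeta8_nonzero zeta8_square by (auto simp: z_def)
  have iz: "\<i> * z \<noteq> 1" "- (\<i> * z) \<noteq> 1"
  proof -
    have "(\<i> * z)\<^sup>2 = - \<i>" using z by (simp add: power_mult_distrib)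
    hence "(\<i> * z)\<^sup>2 \<noteq> 1" by (simp add: complex_eq_iff)
    thus "\<i> * z \<noteq> 1" "- (\<i> * z) \<noteq> 1" by (metis one_power2, metis one_power2 power2_minus)
  qed
  have nz: "E \<noteq> 0" "E8 \<noteq> 0" "th \<noteq> 0" "M \<noteq> 0" "w0 \<noteq> 0" "T \<noteq> 0"
  proof -
    show "E \<noteq> 0" unfolding E_def by (rule qpoch_inf_nonzero'[OF p(1) p(1)])
    show "E8 \<noteq> 0" unfolding E8_def by (rule qpoch_inf_nonzero'[OF q8(1) q8(1)])
    show "th \<noteq> 0" unfolding th_def by (rule qpoch_inf_nonzero'[OF p2(1)]) (use p in simp)
    show "M \<noteq> 0" unfolding M_def by (rule qpoch_inf_nonzero'[OF q8(1)]) (use q8 in simp)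
    have "qpoch_inf (-1) p = 2 * qpoch_inf (- p) p" using qpoch_inf_rec[OF p(1), of "-1"] by simp
    thus "w0 \<noteq> 0" unfolding w0_def qtheta_def using qpoch_inf_nonzero'[OF p(1), of "- p"] p by simp
    have "norm (z * q) < 1" "norm (p / (z * q)) < 1"
      using z q by (simp_all add: norm_mult norm_divide p_def power2_eq_square)
    thus "T \<noteq> 0" unfolding T_def qtheta_def using qpoch_inf_nonzero'[OF p(1)] by simp
  qed
  \<comment> \<open>The identity is used at \<open>u = z q\<close>, \<open>v = i z\<close>,
    \<open>w = - i z q^2\<close>. The factor \<open>q^2\<close> in \<open>w\<close> gives
    \<open>u^2 = v w\<close>, so the sum at \<open>u\<close> has argument \<beta> equal to 1. All
    ratios of the three points are a power of \<open>q\<close> times a fourth root of unity, so the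
    theta values at these ratios no longer involve \<open>z\<close>.\<close>
  let ?w = "- (\<i> * z * q\<^sup>2)"
  have main: "E\<^sup>2 / (qtheta (z * q) p * qtheta (\<i> * z) p * qtheta ?w p) =
     appell3_sum ((z * q)\<^sup>2 / (\<i> * z * ?w)) (z * q) q / (qtheta (\<i> * z / (z * q)) p * qtheta (?w / (z * q)) p) +
     appell3_sum ((\<i> * z)\<^sup>2 / (z * q * ?w)) (\<i> * z) q / (qtheta (z * q / (\<i> * z)) p * qtheta (?w / (\<i> * z)) p) +
     appell3_sum (?w\<^sup>2 / (z * q * (\<i> * z))) ?w q / (qtheta (z * q / ?w) p * qtheta (\<i> * z / ?w) p)"
    unfolding E_def p_def
  proof (rule three_theta_identity[OF q])
    fix k :: int
    have u: "z * q * q powi (2 * k) = z * q powi (2 * k + 1)" using q(2) by (simp add: power_int_add)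
    have w: "- (\<i> * z * q\<^sup>2) = - (\<i> * z) * q powi 2" by simp
    have w': "- (\<i> * z * q\<^sup>2) * q powi (2 * k) = - (\<i> * z) * q powi (2 * k + 2)" using q(2) by (simp add: power_int_add)
    have n: "norm (\<i> * z) = 1" "norm (- (\<i> * z)) = 1" using z by (simp_all add: norm_mult)
    have odd: "2 * k + 1 \<noteq> 0" "2 * k + 1 \<noteq> 2" by presburger+
    show "z * q * q powi (2 * k) \<noteq> 1"
      unfolding u using powi_neq_of_norm[OF q z(1), of 1 "2 * k + 1" 0] odd by simp
    show "\<i> * z * q powi (2 * k) \<noteq> 1"
      using powi_neq_of_norm[OF q n(1), of 1 "2 * k" 0] iz(1) by (cases "k = 0") auto
    show "- (\<i> * z * q\<^sup>2) * q powi (2 * k) \<noteq> 1"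
      unfolding w' using powi_neq_of_norm[OF q n(2), of 1 "2 * k + 2" 0] iz(2) by (cases "k = -1") auto
    show "z * q * q powi (2 * k) \<noteq> \<i> * z"
      unfolding u using powi_neq_of_norm[OF q z(1) n(1), of "2 * k + 1" 0] odd by simp
    show "z * q * q powi (2 * k) \<noteq> - (\<i> * z * q\<^sup>2)"
      unfolding u w using powi_neq_of_norm[OF q z(1) n(2), of "2 * k + 1" 2] odd by simp
    show "\<i> * z * q powi (2 * k) \<noteq> - (\<i> * z * q\<^sup>2)"
    proof (cases "k = 1")
      case True
      have "\<i> * z * q\<^sup>2 \<noteq> - (\<i> * z * q\<^sup>2)" using q z by (simp add: eq_neg_iff_add_eq_0)
      thus ?thesis using True by simp
    next
      case False
      thus ?thesis unfolding w using powi_neq_of_norm[OF q n, of "2 * k" 2] by simp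
    qed
  qed (use q z in auto)
  have r: "(z * q)\<^sup>2 / (\<i> * z * - (\<i> * z * q\<^sup>2)) = 1" "\<i> * z / (z * q) = \<i> / q" "- (\<i> * z * q\<^sup>2) / (z * q) = - (\<i> * q)"
    "(\<i> * z)\<^sup>2 / (z * q * - (\<i> * z * q\<^sup>2)) = - \<i> / q ^ 3" "z * q / (\<i> * z) = - (\<i> * q)" "- (\<i> * z * q\<^sup>2) / (\<i> * z) = - p"
    "(- (\<i> * z * q\<^sup>2))\<^sup>2 / (z * q * (\<i> * z)) = \<i> * q ^ 3" "z * q / - (\<i> * z * q\<^sup>2) = \<i> / q" "\<i> * z / - (\<i> * z * q\<^sup>2) = - 1 / p"
    using q z by (simp_all add: p_def field_simps power2_eq_square power3_eq_cube)
  have iq: "qtheta (\<i> * q) p = th" "qtheta (- (\<i> * q)) p = th"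
  proof -
    have a: "qpoch_inf (\<i> * q) p * qpoch_inf (- (\<i> * q)) p = th"
      using qpoch_inf_mult_minus[OF p(1), of "\<i> * q"] by (simp add: th_def power_mult_distrib p_def)
    have "p / (\<i> * q) = - (\<i> * q)" "p / (- (\<i> * q)) = \<i> * q"
      using q by (simp_all add: p_def power2_eq_square field_simps)
    thus "qtheta (\<i> * q) p = th" "qtheta (- (\<i> * q)) p = th"
      unfolding qtheta_def using a by (simp_all add: mult.commute)
  qed
  have t1: "qtheta (\<i> / q) p = - (\<i> / q) * th"
  proof -
    have "\<i> / q * p = \<i> * q" using q by (simp add: p_def power2_eq_square)
    thus ?thesis using qtheta_shift[OF p, of "\<i> / q"] q iq by simp
  qed
  have t2: "qtheta (- p) p = w0"
    using qtheta_reflect[OF p(2), of "-1"] by (simp add: w0_def)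
  have t3: "qtheta (- 1 / p) p = w0 / p"
    using qtheta_shift[OF p, of "- 1 / p"] p by (simp add: w0_def)
  have t4: "qtheta (- (\<i> * z * q\<^sup>2)) p = qtheta (- (\<i> * z)) p / (\<i> * z)"
    using qtheta_shift[OF p, of "- (\<i> * z)"] z by (simp add: p_def)
  \<comment> \<open>Multiplying values at opposite arguments squares both argument and base. The
    first squaring replaces \<open>z\<close> by fourth roots of unity, the second reaches base
    \<open>q^8\<close>; the factor \<open>1 + i\<close> is an initial factor split off in
    between.\<close>
  have t5: "qtheta (\<i> * z) p * qtheta (- (\<i> * z)) p = (1 + \<i>) * M"
  proof -
    have "qtheta (\<i> * z) p * qtheta (- (\<i> * z)) p =
       (qpoch_inf (\<i> * z) p * qpoch_inf (- (\<i> * z)) p) * (qpoch_inf (p / (\<i> * z)) p * qpoch_inf (- (p / (\<i> * z))) p)"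
      by (simp add: qtheta_def mult_ac)
    also have "\<dots> = qpoch_inf (- \<i>) (p\<^sup>2) * qpoch_inf (\<i> * p\<^sup>2) (p\<^sup>2)"
      unfolding qpoch_inf_mult_minus[OF p(1)] using z by (simp add: power_mult_distrib power_divide)
    also have "qpoch_inf (- \<i>) (p\<^sup>2) = (1 + \<i>) * qpoch_inf (- (\<i> * p\<^sup>2)) (p\<^sup>2)"
      using qpoch_inf_rec[OF p2(1), of "- \<i>"] by simp
    also have "(1 + \<i>) * qpoch_inf (- (\<i> * p\<^sup>2)) (p\<^sup>2) * qpoch_inf (\<i> * p\<^sup>2) (p\<^sup>2) =
       (1 + \<i>) * (qpoch_inf (\<i> * p\<^sup>2) (p\<^sup>2) * qpoch_inf (- (\<i> * p\<^sup>2)) (p\<^sup>2))" by (simp only: mult_ac)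
    also have "\<dots> = (1 + \<i>) * M"
      unfolding qpoch_inf_mult_minus[OF p2(1)] using pq by (simp add: M_def power_mult_distrib flip: power_mult)
    finally show ?thesis .
  qed
  have comb: "appell3_sum (- \<i> / q ^ 3) (\<i> * z) q + \<i> * q ^ 3 * appell3_sum (\<i> * q ^ 3) (- (\<i> * z * q\<^sup>2)) q = 2 * \<i> * W"
    using appell3_zeta8_combination[OF q] by (simp add: W_def z_def algebra_simps)
  have "E\<^sup>2 / (T * qtheta (\<i> * z) p * (qtheta (- (\<i> * z)) p / (\<i> * z))) =
     S / (- (\<i> / q) * th * th) + appell3_sum (- \<i> / q ^ 3) (\<i> * z) q / (th * w0) +
     appell3_sum (\<i> * q ^ 3) (- (\<i> * z * q\<^sup>2)) q / (- (\<i> / q) * th * (w0 / p))"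
    using main unfolding r t1 t2 t3 t4 iq appell3_sum_one T_def[symmetric] S_def[symmetric] .
  also have "S / (- (\<i> / q) * th * th) = \<i> * (q * S / th\<^sup>2)"
    using q nz by (simp add: field_simps power2_eq_square)
  also have "appell3_sum (\<i> * q ^ 3) (- (\<i> * z * q\<^sup>2)) q / (- (\<i> / q) * th * (w0 / p)) =
      \<i> * q ^ 3 * appell3_sum (\<i> * q ^ 3) (- (\<i> * z * q\<^sup>2)) q / (th * w0)"
    using q nz by (simp add: field_simps power2_eq_square power3_eq_cube p_def)
  also have "\<i> * (q * S / th\<^sup>2) + appell3_sum (- \<i> / q ^ 3) (\<i> * z) q / (th * w0) +
      \<i> * q ^ 3 * appell3_sum (\<i> * q ^ 3) (- (\<i> * z * q\<^sup>2)) q / (th * w0) = \<i> * (q * S / th\<^sup>2) + 2 * \<i> * W / (th * w0)"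
    unfolding comb[symmetric] by (simp add: add_divide_distrib)
  also have "E\<^sup>2 / (T * qtheta (\<i> * z) p * (qtheta (- (\<i> * z)) p / (\<i> * z))) = \<i> * (z * E\<^sup>2 / (T * ((1 + \<i>) * M)))"
    unfolding t5[symmetric] using z by (simp add: mult.assoc)
  also have "z * E\<^sup>2 / (T * ((1 + \<i>) * M)) = E\<^sup>2 / (of_real (sqrt 2) * T * M)"
    unfolding sqrt2_zeta8[folded z_def, symmetric] using z by (simp add: mult_ac)
  finally have "\<i> * (E\<^sup>2 / (of_real (sqrt 2) * T * M)) = \<i> * (q * S / th\<^sup>2 + 2 * W / (th * w0))"
    by (simp add: algebra_simps)
  moreover have "a = b" if "\<i> * a = \<i> * b" for a b using that by simp
  ultimately have eq: "E\<^sup>2 / (of_real (sqrt 2) * T * M) = q * S / th\<^sup>2 + 2 * W / (th * w0)" by blast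
  have w0E: "w0 * E = 2 * th * E8"
  proof -
    have "w0 * E = 2 * (qpoch_inf (- p) p * E) * qpoch_inf (- p) p"
      using qpoch_inf_rec[OF p(1), of "-1"] by (simp add: w0_def qtheta_def)
    also have "qpoch_inf (- p) p * E = qpoch_inf (p\<^sup>2) (p\<^sup>2)" unfolding E_def by (rule qpoch_inf_minus_mult[OF p(1)])
    also have "qpoch_inf (- p) p = th * qpoch_inf (- (p\<^sup>2)) (p\<^sup>2)"
      using qpoch_inf_even_odd[OF p(1), of "- p"] by (simp add: th_def power2_eq_square)
    also have "2 * qpoch_inf (p\<^sup>2) (p\<^sup>2) * (th * qpoch_inf (- (p\<^sup>2)) (p\<^sup>2)) = 2 * th * (qpoch_inf (- (p\<^sup>2)) (p\<^sup>2) * qpoch_inf (p\<^sup>2) (p\<^sup>2))"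
      by (simp only: mult_ac)
    also have "qpoch_inf (- (p\<^sup>2)) (p\<^sup>2) * qpoch_inf (p\<^sup>2) (p\<^sup>2) = E8"
      using qpoch_inf_minus_mult[OF p2(1)] by (simp only: pq E8_def)
    finally show ?thesis .
  qed
  \<comment> \<open>The factor \<open>1 / T\<close> cannot be dissected directly. Pairing the theta
    function at \<open>z\<close> with the one at \<open>- z\<close> trades it for
    \<open>theta_sum z q\<close> in the numerator, which \<open>theta_sum_zeta8\<close>
    dissects.\<close>
  have TT: "theta_sum z q * theta_sum 1 (q\<^sup>2) * T * M = E * th\<^sup>2 * E8"
  proof -
    define N where "N = qpoch_inf (- (p\<^sup>2)) ((p\<^sup>2)\<^sup>2)"
    have "norm q < norm z" using q z by simp
    hence a: "theta_sum z q = E * qpoch_inf (- (z * q)) p * qpoch_inf (- (q / z)) p"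
      using jacobi_triple_product[OF q] by (simp add: E_def p_def)
    have b: "T = qpoch_inf (z * q) p * qpoch_inf (q / z) p"
      using q by (simp add: T_def qtheta_def p_def power2_eq_square mult.commute)
    have c: "qpoch_inf (z * q) p * qpoch_inf (- (z * q)) p = qpoch_inf (\<i> * p) (p\<^sup>2)"
      unfolding qpoch_inf_mult_minus[OF p(1)] using z by (simp add: power_mult_distrib p_def)
    have d: "qpoch_inf (q / z) p * qpoch_inf (- (q / z)) p = qpoch_inf (- (\<i> * p)) (p\<^sup>2)"
      unfolding qpoch_inf_mult_minus[OF p(1)] using z by (simp add: power_divide p_def)
    have e: "qpoch_inf (\<i> * p) (p\<^sup>2) * qpoch_inf (- (\<i> * p)) (p\<^sup>2) = N"
      unfolding qpoch_inf_mult_minus[OF p2(1)] by (simp add: N_def power_mult_distrib)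
    have f: "theta_sum 1 (q\<^sup>2) = qpoch_inf (p\<^sup>2) (p\<^sup>2) * th * th"
      using jacobi_triple_product[of "q\<^sup>2" 1] p by (simp add: p_def[symmetric] th_def)
    have g: "N * M = qpoch_inf (- (p\<^sup>2)) (p\<^sup>2)"
      using qpoch_inf_even_odd[OF p2(1), of "- (p\<^sup>2)"] pq by (simp add: N_def M_def power2_eq_square)
    have h: "theta_sum z q * T = E * N"
      unfolding a b e[symmetric] c[symmetric] d[symmetric] by (simp only: mult_ac)
    have "theta_sum z q * theta_sum 1 (q\<^sup>2) * T * M = (theta_sum z q * T) * M * theta_sum 1 (q\<^sup>2)"
      by (simp only: mult_ac)
    also have "\<dots> = E * (N * M) * (qpoch_inf (p\<^sup>2) (p\<^sup>2) * th * th)"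
      unfolding h f by (simp only: mult_ac)
    also have "\<dots> = E * th\<^sup>2 * (qpoch_inf (- (p\<^sup>2)) (p\<^sup>2) * qpoch_inf (p\<^sup>2) (p\<^sup>2))"
      unfolding g by (simp only: mult_ac power2_eq_square[of th])
    also have "qpoch_inf (- (p\<^sup>2)) (p\<^sup>2) * qpoch_inf (p\<^sup>2) (p\<^sup>2) = E8"
      using qpoch_inf_minus_mult[OF p2(1)] by (simp only: pq E8_def)
    finally show ?thesis .
  qed
  have sq: "of_real (sqrt 2) \<noteq> (0::complex)" by simp
  have "q * S / E = th\<^sup>2 / E * (q * S / th\<^sup>2)" using nz by simp
  also have "\<dots> = th\<^sup>2 / E * (E\<^sup>2 / (of_real (sqrt 2) * T * M)) - th\<^sup>2 / E * (2 * W / (th * w0))"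
    unfolding eq by (simp add: algebra_simps)
  also have "th\<^sup>2 / E * (2 * W / (th * w0)) = W / E8"
  proof -
    have "th\<^sup>2 / E * (2 * W / (th * w0)) = 2 * th * W / (w0 * E)" using nz by (simp add: power2_eq_square mult_ac)
    thus ?thesis unfolding w0E using nz by simp
  qed
  also have "th\<^sup>2 / E * (E\<^sup>2 / (of_real (sqrt 2) * T * M)) = theta_sum z q * theta_sum 1 (q\<^sup>2) / (of_real (sqrt 2) * E8)"
  proof -
    have "th\<^sup>2 / E * (E\<^sup>2 / (of_real (sqrt 2) * T * M)) = (E * th\<^sup>2 * E8) / (of_real (sqrt 2) * E8 * T * M)"
      using nz by (simp add: power2_eq_square mult_ac)
    thus ?thesis unfolding TT[symmetric] using nz by simp
  qed
  finally show ?thesis unfolding S_def E_def E8_def W_def z_def p_def .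
qed


theorem rank_series_zeta8:
  assumes q: "norm q < 1" "q \<noteq> 0"
  shows "((\<lambda>n. q ^ (2 * n\<^sup>2 + 2 * n + 1) / (qpoch (zeta8 * q) (q\<^sup>2) (Suc n) * qpoch (q / zeta8) (q\<^sup>2) (Suc n))) has_sum
     (q * (theta_sum 1 (q ^ 8) * qpoch_inf (- ((q ^ 8)\<^sup>2)) ((q ^ 8)\<^sup>2)) + q ^ 3 * nu_series (q ^ 8) +
      of_real (sqrt 2) * (q\<^sup>2 * (theta_sum (q ^ 8) (q ^ 8) / 2 * qpoch_inf (- (q ^ 8)) ((q ^ 8)\<^sup>2)) + psi_series (q ^ 8)))) UNIV"
proof -
  define t where "t = q ^ 8"
  have q4: "norm (q ^ 4) < 1" "q ^ 4 \<noteq> 0" and t: "norm t < 1" "t \<noteq> 0"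
    using q by (auto simp: norm_power power_less_one_iff t_def)
  have tt: "(q ^ 4)\<^sup>2 = t" "q ^ 16 = t\<^sup>2" by (simp_all add: t_def flip: power_mult)
  have tn: "norm (t\<^sup>2) < 1" using t by (simp add: norm_power power_less_one_iff)
  define s2 :: complex where "s2 = of_real (sqrt 2)"
  have s2: "s2 \<noteq> 0" "s2 * s2 = 2" by (simp_all add: s2_def flip: of_real_mult)
  define E8 where "E8 = qpoch_inf t t"
  have E8: "E8 \<noteq> 0" unfolding E8_def by (rule qpoch_inf_nonzero'[OF t(1) t(1)])
  obtain A0 B0 where A0: "((\<lambda>n. t ^ (n * n) / qpoch (- (t\<^sup>2)) (t\<^sup>2) n) has_sum A0) UNIV"
    and B0: "((\<lambda>m. t ^ Suc m * qpoch (- (t\<^sup>2)) (t\<^sup>2) m) has_sum B0) UNIV"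
    and AB0: "A0 + 2 * B0 = theta_sum 1 t * theta_sum (-1) (t\<^sup>2) / E8"
    unfolding E8_def by (rule phi_psi_relation[OF t])
  obtain A1 B1 where A1: "((\<lambda>n. t ^ (n * n + n) / qpoch (- t) (t\<^sup>2) (Suc n)) has_sum A1) UNIV"
    and B1: "((\<lambda>m. t ^ m * qpoch (- t) (t\<^sup>2) m) has_sum B1) UNIV"
    and AB1: "A1 + B1 = theta_sum t t * theta_sum (- t) (t\<^sup>2) / E8"
    unfolding E8_def by (rule nu_relation[OF t])
  have B: "B0 = psi_series t" "B1 = nu_series t"
    using infsumI[OF B0] infsumI[OF B1] by (simp_all add: psi_series_def nu_series_def)
  have qp2: "qpoch (- x) t n * qpoch x t n = qpoch (x\<^sup>2) (t\<^sup>2) n" for x n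
    unfolding qpoch_def prod.distrib [symmetric]
    by (rule prod.cong) (auto simp: algebra_simps power2_eq_square power_mult_distrib)
  \<comment> \<open>The symbols with arguments \<open>i t\<close> and \<open>- i t\<close> multiply
    to one symbol in base \<open>t^2\<close>, which gives the terms of phi; \<open>1 + i\<close> is
    the initial factor of the longer symbol.\<close>
  have app0: "appell_sum 0 (- \<i>) (q ^ 4) = E8 * A0 / (1 + \<i>)"
  proof -
    have "((\<lambda>n. t ^ (n * n + 0 * n) / (qpoch (- \<i>) t (Suc n) * qpoch (t / - \<i>) t (n + 0))) has_sum
        appell_sum 0 (- \<i>) (q ^ 4) / E8) UNIV"
      unfolding E8_def tt(1)[symmetric]
    proof (rule durfee_series_eq_appell_sum[OF q4])
      fix k :: int
      show "- \<i> * (q ^ 4) powi (2 * k) \<noteq> 1"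
        using powi_neq_of_norm[OF q4, of "- \<i>" 1 "2 * k" 0] by (cases "k = 0") (auto simp: complex_eq_iff)
    qed auto
    also have "(\<lambda>n. t ^ (n * n + 0 * n) / (qpoch (- \<i>) t (Suc n) * qpoch (t / - \<i>) t (n + 0))) =
       (\<lambda>n. 1 / (1 + \<i>) * (t ^ (n * n) / qpoch (- (t\<^sup>2)) (t\<^sup>2) n))"
    proof
      fix n
      have "qpoch (- \<i>) t (Suc n) * qpoch (t / - \<i>) t (n + 0) = (1 + \<i>) * (qpoch (- (\<i> * t)) t n * qpoch (\<i> * t) t n)"
        by (simp add: qpoch_Suc_shift mult_ac)
      also have "qpoch (- (\<i> * t)) t n * qpoch (\<i> * t) t n = qpoch (- (t\<^sup>2)) (t\<^sup>2) n"
        unfolding qp2 by (simp add: power_mult_distrib)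
      finally show "t ^ (n * n + 0 * n) / (qpoch (- \<i>) t (Suc n) * qpoch (t / - \<i>) t (n + 0)) =
         1 / (1 + \<i>) * (t ^ (n * n) / qpoch (- (t\<^sup>2)) (t\<^sup>2) n)" by simp
    qed
    finally have "appell_sum 0 (- \<i>) (q ^ 4) / E8 = 1 / (1 + \<i>) * A0"
      using has_sum_cmult_right[OF A0, of "1 / (1 + \<i>)"] by (rule has_sum_unique)
    thus ?thesis using E8 by (simp add: nonzero_divide_eq_eq mult.commute)
  qed
  have app1: "appell_sum 1 (- (\<i> * q ^ 4)) (q ^ 4) = E8 * A1"
  proof -
    have "((\<lambda>n. t ^ (n * n + 1 * n) / (qpoch (- (\<i> * q ^ 4)) t (Suc n) * qpoch (t / - (\<i> * q ^ 4)) t (n + 1))) has_sum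
        appell_sum 1 (- (\<i> * q ^ 4)) (q ^ 4) / E8) UNIV"
      unfolding E8_def tt(1)[symmetric]
    proof (rule durfee_series_eq_appell_sum[OF q4])
      fix k :: int
      have "2 * k + 1 \<noteq> 0" by presburger
      hence "- \<i> * (q ^ 4) powi (2 * k + 1) \<noteq> 1"
        using powi_neq_of_norm[OF q4, of "- \<i>" 1 "2 * k + 1" 0] by simp
      moreover have "- (\<i> * q ^ 4) * (q ^ 4) powi (2 * k) = - \<i> * (q ^ 4) powi (2 * k + 1)"
        using q4(2) by (simp add: power_int_add)
      ultimately show "- (\<i> * q ^ 4) * (q ^ 4) powi (2 * k) \<noteq> 1" by (simp only: not_False_eq_True)
    qed (use q in auto)
    also have "(\<lambda>n. t ^ (n * n + 1 * n) / (qpoch (- (\<i> * q ^ 4)) t (Suc n) * qpoch (t / - (\<i> * q ^ 4)) t (n + 1))) =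
       (\<lambda>n. t ^ (n * n + n) / qpoch (- t) (t\<^sup>2) (Suc n))"
    proof
      fix n
      have "t / - (\<i> * q ^ 4) = \<i> * q ^ 4"
        using q by (simp add: tt(1)[symmetric] power2_eq_square field_simps)
      hence "qpoch (- (\<i> * q ^ 4)) t (Suc n) * qpoch (t / - (\<i> * q ^ 4)) t (n + 1) = qpoch ((\<i> * q ^ 4)\<^sup>2) (t\<^sup>2) (Suc n)"
        unfolding qp2[symmetric] by simp
      also have "(\<i> * q ^ 4)\<^sup>2 = - t" unfolding power_mult_distrib tt by simp
      finally show "t ^ (n * n + 1 * n) / (qpoch (- (\<i> * q ^ 4)) t (Suc n) * qpoch (t / - (\<i> * q ^ 4)) t (n + 1)) =
         t ^ (n * n + n) / qpoch (- t) (t\<^sup>2) (Suc n)" by simp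
    qed
    finally have "appell_sum 1 (- (\<i> * q ^ 4)) (q ^ 4) / E8 = A1"
      using A1 by (rule has_sum_unique)
    thus ?thesis using E8 by (simp add: nonzero_divide_eq_eq mult.commute)
  qed
  have zA0: "zeta8 * (E8 * A0 / (1 + \<i>)) = E8 * A0 / s2"
    unfolding sqrt2_zeta8[symmetric] s2_def using zeta8_nonzero by simp
  have Ta: "theta_sum zeta8 q = theta_sum (-1) (t\<^sup>2) + s2 * q * theta_sum (- t) (t\<^sup>2)"
    using theta_sum_zeta8[OF q] by (simp add: s2_def tt flip: t_def)
  have Fa: "theta_sum 1 (q\<^sup>2) = theta_sum 1 t + q\<^sup>2 * theta_sum t t"
  proof -
    have "norm (q\<^sup>2) < 1" "q\<^sup>2 \<noteq> 0" using q by (auto simp: norm_power power_less_one_iff)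
    from theta_sum_even_odd[OF this, of 1] show ?thesis by (simp add: t_def flip: power_mult)
  qed
  have To: "theta_sum (- t) (t\<^sup>2) / E8 = qpoch_inf (- (t\<^sup>2)) (t\<^sup>2)"
    using theta_sum_minus[OF t] E8 by (simp add: E8_def)
  have Tm: "theta_sum (-1) (t\<^sup>2) / E8 = qpoch_inf (- t) (t\<^sup>2)"
    using theta_sum_minus_one[OF t] E8 by (simp add: E8_def)
  have x: "zeta8 * q * q powi (2 * k) \<noteq> 1" for k :: int
  proof -
    have "2 * k + 1 \<noteq> 0" by presburger
    hence "zeta8 * q powi (2 * k + 1) \<noteq> 1"
      using powi_neq_of_norm[OF q norm_zeta8, of 1 "2 * k + 1" 0] by simp
    moreover have "zeta8 * q * q powi (2 * k) = zeta8 * q powi (2 * k + 1)"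
      using q(2) by (simp add: power_int_add)
    ultimately show ?thesis by (simp only: not_False_eq_True)
  qed
  \<comment> \<open>At \<open>x = zeta8 * q\<close> and \<open>a = 1\<close> the two Pochhammer
    symbols have equal length and conjugate roots of unity, so the Durfee series is the rank series
    up to one factor \<open>q\<close>.\<close>
  have "((\<lambda>n. (q\<^sup>2) ^ (n * n + 1 * n) / (qpoch (zeta8 * q) (q\<^sup>2) (Suc n) * qpoch (q\<^sup>2 / (zeta8 * q)) (q\<^sup>2) (n + 1))) has_sum
        appell_sum 1 (zeta8 * q) q / qpoch_inf (q\<^sup>2) (q\<^sup>2)) UNIV"
    by (rule durfee_series_eq_appell_sum[OF q _ x]) (use q zeta8_nonzero in auto)
  hence "((\<lambda>n. q * ((q\<^sup>2) ^ (n * n + 1 * n) / (qpoch (zeta8 * q) (q\<^sup>2) (Suc n) * qpoch (q\<^sup>2 / (zeta8 * q)) (q\<^sup>2) (n + 1)))) has_sum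
        q * (appell_sum 1 (zeta8 * q) q / qpoch_inf (q\<^sup>2) (q\<^sup>2))) UNIV"
    by (rule has_sum_cmult_right)
  also have "(\<lambda>n. q * ((q\<^sup>2) ^ (n * n + 1 * n) / (qpoch (zeta8 * q) (q\<^sup>2) (Suc n) * qpoch (q\<^sup>2 / (zeta8 * q)) (q\<^sup>2) (n + 1)))) =
      (\<lambda>n. q ^ (2 * n\<^sup>2 + 2 * n + 1) / (qpoch (zeta8 * q) (q\<^sup>2) (Suc n) * qpoch (q / zeta8) (q\<^sup>2) (Suc n)))"
  proof
    fix n
    have "2 * n\<^sup>2 + 2 * n + 1 = Suc (2 * (n * n + 1 * n))" by (simp add: power2_eq_square)
    hence e: "q ^ (2 * n\<^sup>2 + 2 * n + 1) = q * (q\<^sup>2) ^ (n * n + 1 * n)" by (simp only: power_Suc power_mult)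
    have e': "q\<^sup>2 / (zeta8 * q) = q / zeta8" using q by (simp add: power2_eq_square)
    show "q * ((q\<^sup>2) ^ (n * n + 1 * n) / (qpoch (zeta8 * q) (q\<^sup>2) (Suc n) * qpoch (q\<^sup>2 / (zeta8 * q)) (q\<^sup>2) (n + 1))) =
      q ^ (2 * n\<^sup>2 + 2 * n + 1) / (qpoch (zeta8 * q) (q\<^sup>2) (Suc n) * qpoch (q / zeta8) (q\<^sup>2) (Suc n))"
      unfolding e e' by simp
  qed
  also have "q * (appell_sum 1 (zeta8 * q) q / qpoch_inf (q\<^sup>2) (q\<^sup>2)) =
     theta_sum zeta8 q * theta_sum 1 (q\<^sup>2) / (s2 * E8) - (E8 * A0 / s2 + q ^ 3 * (E8 * A1)) / E8"
    using rank_series_zeta8_aux[OF q]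
    by (simp only: times_divide_eq_right s2_def[symmetric] t_def[symmetric] E8_def[symmetric] app0 app1)
       (simp only: zA0[simplified times_divide_eq_right])
  \<comment> \<open>Writing the quotient as \<open>(a + s2 q b) (c + q^2 d) / s2\<close>, the terms
    with \<open>a c\<close> and \<open>b d\<close> cancel against the completions of phi and nu and
    leave only the companions \<open>B0\<close> and \<open>B1\<close>; the mixed terms with
    \<open>b c\<close> and \<open>a d\<close> are the two products.\<close>
  also have "\<dots> = q * (theta_sum 1 t * qpoch_inf (- (t\<^sup>2)) (t\<^sup>2)) + q ^ 3 * B1 + s2 * (q\<^sup>2 * (theta_sum t t / 2 * qpoch_inf (- t) (t\<^sup>2)) + B0)"
  proof -
    define a where "a = theta_sum (-1) (t\<^sup>2) / E8"
    define b where "b = theta_sum (- t) (t\<^sup>2) / E8"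
    define c where "c = theta_sum 1 t"
    define d where "d = theta_sum t t"
    have th: "theta_sum zeta8 q * theta_sum 1 (q\<^sup>2) / (s2 * E8) = (a + s2 * q * b) * (c + q\<^sup>2 * d) / s2"
      unfolding Ta Fa a_def b_def c_def d_def using E8 by (simp add: field_simps)
    have i: "1 / s2 = s2 / 2" using s2 by (simp add: field_simps)
    have A0': "A0 = c * a - 2 * B0" using AB0 by (simp add: a_def c_def algebra_simps)
    have A1': "A1 = d * b - B1" using AB1 by (simp add: b_def d_def algebra_simps)
    have "(E8 * A0 / s2 + q ^ 3 * (E8 * A1)) / E8 = A0 * (1 / s2) + q ^ 3 * A1"
      using E8 by (simp add: field_simps)
    moreover have "(a + s2 * q * b) * (c + q\<^sup>2 * d) / s2 = a * (c + q\<^sup>2 * d) * (1 / s2) + q * b * (c + q\<^sup>2 * d)"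
      using s2(1) by (simp add: field_simps)
    ultimately have "theta_sum zeta8 q * theta_sum 1 (q\<^sup>2) / (s2 * E8) - (E8 * A0 / s2 + q ^ 3 * (E8 * A1)) / E8 =
      a * (c + q\<^sup>2 * d) * (s2 / 2) + q * b * (c + q\<^sup>2 * d) - ((c * a - 2 * B0) * (s2 / 2) + q ^ 3 * (d * b - B1))"
      unfolding th i A0' A1' by simp
    also have "\<dots> = q * (c * b) + q ^ 3 * B1 + s2 * (q\<^sup>2 * (d / 2 * a) + B0)"
      by (simp add: field_simps power2_eq_square power3_eq_cube)
    finally show ?thesis unfolding a_def b_def c_def d_def To Tm .
  qed
  finally show ?thesis unfolding B t_def s2_def .
qed

section \<open>Generating functions of weights\<close>

text \<open>The identities exclude \<open>q = 0\<close>, so the coefficient cannot be read off by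
  evaluation. After the earlier coefficients are removed, dividing by \<open>q ^ m\<close> and
  continuity at 0 recover it.\<close>

lemma power_series_coeff_eq_0:
  fixes d :: "nat \<Rightarrow> complex"
  assumes "\<And>q. q \<noteq> 0 \<Longrightarrow> norm q < 1 \<Longrightarrow> (\<lambda>n. d n * q ^ n) sums 0"
  shows "d m = 0"
proof (induction m rule: less_induct)
  case (less m)
  define g where "g = (\<lambda>q. \<Sum>n. d (n + m) * q ^ n)"
  have s: "(\<lambda>n. d (n + m) * q ^ n) sums 0" if "q \<noteq> 0" "norm q < 1" for q
  proof -
    have "(\<Sum>i<m. d i * q ^ i) = 0" using less by simp
    hence "(\<lambda>n. d (n + m) * q ^ (n + m)) sums 0"
      using sums_split_initial_segment[OF assms[OF that], of m] by simp
    hence "(\<lambda>n. d (n + m) * q ^ (n + m) / q ^ m) sums (0 / q ^ m)" by (rule sums_divide)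
    thus ?thesis using that by (simp add: power_add)
  qed
  have "isCont g 0" unfolding g_def
    by (rule isCont_powser[of _ "1/2"]) (use s[of "1/2"] in \<open>auto simp: sums_iff norm_divide\<close>)
  hence "(g \<longlongrightarrow> g 0) (at 0)" by (simp add: isCont_def)
  moreover have "(g \<longlongrightarrow> 0) (at 0)"
  proof (rule tendsto_eventually)
    have "\<forall>\<^sub>F q in at 0. q \<in> ball 0 1 - {0 :: complex}"
      by (rule eventually_at_in_open) auto
    thus "\<forall>\<^sub>F q in at 0. g q = 0"
      by eventually_elim (use s in \<open>auto simp: g_def sums_iff\<close>)
  qed
  ultimately have "g 0 = 0" using tendsto_unique[OF at_neq_bot] by blast
  moreover have "g 0 = d m" unfolding g_def by (subst powser_zero) simp
  ultimately show ?case by simp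
qed

section \<open>Rows of odd parts and generating functions by weight\<close>

lemma has_sum_geometric_nat:
  fixes x :: complex
  assumes "norm x < 1"
  shows "((\<lambda>k. x ^ k) has_sum (1 / (1 - x))) UNIV"
  using assms by (intro norm_summable_imp_has_sum geometric_sums)
    (auto simp: norm_power summable_geometric)

text \<open>The bound \<open>2 * n\<close> lets inductions start with the empty list alone; the rows
  of a symbol with subscript \<open>D\<close> form the case \<open>n = Suc D\<close>.\<close>

definition odd_lists :: "nat \<Rightarrow> nat list set" where
  "odd_lists n = {xs. sorted_wrt (\<ge>) xs \<and> (\<forall>x\<in>set xs. odd x \<and> x < 2 * n)}"

lemma odd_lists_0: "odd_lists 0 = {[]}"
  by (auto simp: odd_lists_def)

lemma sorted_wrt_ge_replicate_append:
  "sorted_wrt (\<ge>) (replicate k a @ xs) \<longleftrightarrow> sorted_wrt (\<ge>) xs \<and> (k > 0 \<longrightarrow> (\<forall>x\<in>set xs. x \<le> a))" for a :: nat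
  by (induction k) (auto simp: sorted_wrt_append)

text \<open>A row splits into the leading run of the largest admissible part
  \<open>2 * n + 1\<close> and the rest; the length of the run becomes a geometric factor.\<close>

lemma bij_betw_odd_lists_Suc:
  "bij_betw (\<lambda>(k, xs). replicate k (2 * n + 1) @ xs) (UNIV \<times> odd_lists n) (odd_lists (Suc n))"
proof (rule bij_betwI[where g = "\<lambda>ys. (length (takeWhile (\<lambda>x. x = 2 * n + 1) ys), dropWhile (\<lambda>x. x = 2 * n + 1) ys)"])
  let ?P = "\<lambda>x. x = 2 * n + 1"
  show "(\<lambda>(k, xs). replicate k (2 * n + 1) @ xs) \<in> UNIV \<times> odd_lists n \<rightarrow> odd_lists (Suc n)"
    by (force simp: odd_lists_def sorted_wrt_ge_replicate_append)
  have tw: "replicate (length (takeWhile ?P ys)) (2 * n + 1) = takeWhile ?P ys" for ys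
    by (induction ys) auto
  show "(\<lambda>ys. (length (takeWhile ?P ys), dropWhile ?P ys)) \<in> odd_lists (Suc n) \<rightarrow> UNIV \<times> odd_lists n"
  proof
    fix ys assume ys: "ys \<in> odd_lists (Suc n)"
    have s: "sorted_wrt (\<ge>) (dropWhile ?P ys)"
    proof -
      have "sorted_wrt (\<ge>) (takeWhile ?P ys @ dropWhile ?P ys)" using ys by (simp add: odd_lists_def)
      thus ?thesis by (simp only: sorted_wrt_append)
    qed
    have "odd x \<and> x < 2 * n" if x: "x \<in> set (dropWhile ?P ys)" for x
    proof -
      have x': "odd x" "x < 2 * Suc n" using set_dropWhileD[OF x] ys by (auto simp: odd_lists_def)
      have ne: "dropWhile ?P ys \<noteq> []" using x by (metis empty_iff list.set(1))
      then obtain h zs where dz: "dropWhile ?P ys = h # zs" by (meson neq_Nil_conv)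
      have h: "h \<noteq> 2 * n + 1" using hd_dropWhile[OF ne] by (simp only: dz list.sel not_False_eq_True)
      have "h \<in> set ys" using set_dropWhileD[of h ?P ys] dz by simp
      hence "odd h" "h < 2 * Suc n" using ys by (auto simp: odd_lists_def)
      with h have "h < 2 * n" by presburger
      moreover have "x \<le> h" using s x unfolding dz by auto
      ultimately show ?thesis using x' by simp
    qed
    thus "(length (takeWhile ?P ys), dropWhile ?P ys) \<in> UNIV \<times> odd_lists n"
      using s by (simp add: odd_lists_def)
  qed
  show "(\<lambda>(k, xs). replicate k (2 * n + 1) @ xs) (length (takeWhile ?P ys), dropWhile ?P ys) = ys" for ys
    by (simp only: prod.case tw takeWhile_dropWhile_id)
  fix z :: "nat \<times> nat list" assume z: "z \<in> UNIV \<times> odd_lists n"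
  obtain k xs where kx: "z = (k, xs)" by force
  have xs: "\<not> ?P (hd xs)" if "xs \<noteq> []"
  proof -
    have "hd xs < 2 * n" using z that by (auto simp: kx odd_lists_def)
    thus ?thesis by simp
  qed
  have "takeWhile ?P xs = []" "dropWhile ?P xs = xs" using xs by (cases xs; simp)+
  thus "(length (takeWhile ?P ((\<lambda>(k, xs). replicate k (2 * n + 1) @ xs) z)),
         dropWhile ?P ((\<lambda>(k, xs). replicate k (2 * n + 1) @ xs) z)) = z"
    unfolding kx prod.case by (subst takeWhile_append2 dropWhile_append2; simp)+
qed

lemma has_sum_odd_lists:
  fixes w q :: complex
  assumes q: "norm q < 1" and w: "norm w \<le> 1"
  shows "((\<lambda>xs. w ^ length xs * q ^ sum_list xs) has_sum (1 / qpoch (w * q) (q\<^sup>2) n)) (odd_lists n)"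
proof (induction n)
  case 0
  show ?case by (rule has_sum_finiteI) (simp_all add: odd_lists_0)
next
  case (Suc n)
  define x where "x = w * q ^ (2 * n + 1)"
  have "norm x = norm w * norm q ^ (2 * n + 1)" by (simp add: x_def norm_mult norm_power)
  also have "\<dots> \<le> 1 * norm q ^ (2 * n + 1)" using w by (intro mult_right_mono) auto
  also have "norm q ^ (2 * n + 1) < 1" using q by (subst power_less_one_iff) auto
  finally have x: "norm x < 1" by simp
  have "((\<lambda>(k, xs). x ^ k * (w ^ length xs * q ^ sum_list xs)) has_sum
     (1 / (1 - x) * (1 / qpoch (w * q) (q\<^sup>2) n))) (UNIV \<times> odd_lists n)"
    by (rule has_sum_product_complex[OF has_sum_geometric_nat[OF x] Suc])
  also have "(\<lambda>(k, xs). x ^ k * (w ^ length xs * q ^ sum_list xs)) =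
      (\<lambda>z. (\<lambda>xs. w ^ length xs * q ^ sum_list xs) ((\<lambda>(k, xs). replicate k (2 * n + 1) @ xs) z))"
    by (auto simp: x_def sum_list_replicate power_add power_mult_distrib mult_ac simp flip: power_mult)
  also have "(\<dots> has_sum (1 / (1 - x) * (1 / qpoch (w * q) (q\<^sup>2) n))) (UNIV \<times> odd_lists n) \<longleftrightarrow>
      ((\<lambda>xs. w ^ length xs * q ^ sum_list xs) has_sum (1 / (1 - x) * (1 / qpoch (w * q) (q\<^sup>2) n))) (odd_lists (Suc n))"
    by (rule has_sum_reindex_bij_betw[OF bij_betw_odd_lists_Suc])
  also have "1 / (1 - x) * (1 / qpoch (w * q) (q\<^sup>2) n) = 1 / qpoch (w * q) (q\<^sup>2) (Suc n)"
  proof -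
    have "x = w * q * (q\<^sup>2) ^ n" by (simp add: x_def power_mult)
    thus ?thesis by (simp add: qpoch_Suc)
  qed
  finally show ?case .
qed

text \<open>
  The coefficients of a generating function of weights are cardinalities, so their positivity is
  witnessed by exhibiting an index of the given weight.
\<close>
definition weight_gf :: "(complex \<Rightarrow> complex) \<Rightarrow> 'a set \<Rightarrow> ('a \<Rightarrow> nat) \<Rightarrow> bool" where
  "weight_gf f X w \<longleftrightarrow> (\<forall>t. t \<noteq> 0 \<longrightarrow> norm t < 1 \<longrightarrow> ((\<lambda>x. t ^ w x) has_sum f t) X)"

lemma weight_gf_product:
  assumes "weight_gf f X v" "weight_gf g Y w"
  shows "weight_gf (\<lambda>t. f t * g t) (X \<times> Y) (\<lambda>(x, y). v x + w y)"
  unfolding weight_gf_def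
proof (intro allI impI)
  fix t :: complex assume "t \<noteq> 0" "norm t < 1"
  hence "((\<lambda>(x, y). t ^ v x * t ^ w y) has_sum f t * g t) (X \<times> Y)"
    using assms by (intro has_sum_product_complex) (auto simp: weight_gf_def)
  thus "((\<lambda>x. t ^ (case x of (x, y) \<Rightarrow> v x + w y)) has_sum f t * g t) (X \<times> Y)"
    by (simp add: case_prod_unfold power_add)
qed

text \<open>Summability over the whole union is tested at \<open>norm t\<close>: there all terms are
  nonnegative reals, and the assumption on \<open>F\<close> supplies convergence of the inner
  totals.\<close>

lemma weight_gf_Sigma:
  fixes f :: "nat \<Rightarrow> complex \<Rightarrow> complex"
  assumes f: "\<And>m. weight_gf (f m) (X m) (\<lambda>x. w (m, x))"
    and F: "\<And>t. t \<noteq> 0 \<Longrightarrow> norm t < 1 \<Longrightarrow> ((\<lambda>m. f m t) has_sum F t) UNIV"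
  shows "weight_gf F (Sigma UNIV X) w"
  unfolding weight_gf_def
proof (intro allI impI)
  fix t :: complex assume t: "t \<noteq> 0" "norm t < 1"
  define r where "r = complex_of_real (norm t)"
  have r: "r \<noteq> 0" "norm r < 1" using t by (auto simp: r_def)
  have nr: "norm (t ^ k) = Re (r ^ k)" for k
    by (simp add: r_def norm_power flip: of_real_power)
  have "(\<lambda>z. norm (t ^ w z)) summable_on (Sigma UNIV X)"
  proof (rule summable_on_SigmaI)
    show "((\<lambda>y. norm (t ^ w (m, y))) has_sum Re (f m r)) (X m)" for m
      unfolding nr using f[of m] r by (intro has_sum_Re) (auto simp: weight_gf_def)
    show "(\<lambda>m. Re (f m r)) summable_on UNIV"
      using has_sum_Re[OF F[OF r]] by (rule has_sum_imp_summable)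
  qed auto
  hence sm: "(\<lambda>z. t ^ w z) summable_on (Sigma UNIV X)"
    by (rule abs_summable_summable)
  show "((\<lambda>z. t ^ w z) has_sum F t) (Sigma UNIV X)"
    by (rule has_sum_SigmaI[OF _ F[OF t] sm]) (use f t in \<open>auto simp: weight_gf_def\<close>)
qed

text \<open>Convergence at \<open>t = 1/2\<close> rules out infinitely many terms of the same
  size.\<close>

lemma weight_gf_finite:
  assumes "weight_gf f X w"
  shows "finite {x\<in>X. w x = k}"
proof (rule ccontr)
  assume inf: "infinite {x\<in>X. w x = k}"
  have "((\<lambda>x. (1/2 :: complex) ^ w x) has_sum f (1/2)) X"
    using assms by (simp add: weight_gf_def norm_divide)
  hence "(\<lambda>x. norm ((1/2 :: complex) ^ w x)) summable_on X"
    using has_sum_imp_summable by (subst summable_on_iff_abs_summable_on_complex [symmetric]) blast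
  hence "(\<lambda>x. norm ((1/2 :: complex) ^ w x)) summable_on {x\<in>X. w x = k}"
    by (rule summable_on_subset) auto
  also have "?this \<longleftrightarrow> (\<lambda>_. (1/2 :: real) ^ k) summable_on {x\<in>X. w x = k}"
    by (rule summable_on_cong) (auto simp: norm_power norm_divide)
  finally show False using infsum_diverge_constant[OF inf, of "(1/2 :: real) ^ k"] by simp
qed

lemma weight_gf_power_series:
  assumes "weight_gf f X w" "t \<noteq> 0" "norm t < 1"
  shows "((\<lambda>k. of_nat (card {x\<in>X. w x = k}) * t ^ k) has_sum f t) UNIV"
proof -
  define Y where "Y = (\<lambda>k. {x\<in>X. w x = k})"
  have fin: "finite (Y k)" for k
    unfolding Y_def by (rule weight_gf_finite[OF assms(1)])
  have "((\<lambda>x. t ^ w x) has_sum f t) X" using assms by (simp add: weight_gf_def)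
  also have "?this \<longleftrightarrow> ((\<lambda>(k, x). t ^ w x) has_sum f t) (Sigma UNIV Y)"
  proof -
    have "bij_betw snd (Sigma UNIV Y) X"
      by (rule bij_betwI[where g = "\<lambda>x. (w x, x)"]) (auto simp: Y_def)
    from has_sum_reindex_bij_betw[OF this, of "\<lambda>x. t ^ w x"] show ?thesis
      by (simp add: case_prod_unfold)
  qed
  finally have S: "((\<lambda>(k, x). t ^ w x) has_sum f t) (Sigma UNIV Y)" .
  have "((\<lambda>k. of_nat (card (Y k)) * t ^ k) has_sum f t) UNIV"
  proof (rule has_sum_SigmaD[OF S])
    fix k
    have "((\<lambda>x. t ^ w x) has_sum (\<Sum>x\<in>Y k. t ^ w x)) (Y k)" by (rule has_sum_finite[OF fin])
    also have "(\<Sum>x\<in>Y k. t ^ w x) = (\<Sum>x\<in>Y k. t ^ k)" by (rule sum.cong) (auto simp: Y_def)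
    finally show "((\<lambda>y. case (k, y) of (k, x) \<Rightarrow> t ^ w x) has_sum of_nat (card (Y k)) * t ^ k) (Y k)" by simp
  qed
  thus ?thesis by (simp only: Y_def)
qed

lemma weight_gf_card_pos:
  assumes "weight_gf f X w" "x \<in> X" "w x = k"
  shows "card {x\<in>X. w x = k} > 0"
proof -
  have "finite {x\<in>X. w x = k}" by (rule weight_gf_finite[OF assms(1)])
  thus ?thesis using assms(2,3) by (auto simp: card_gt_0_iff)
qed

section \<open>Odd Durfee symbols\<close>

lemma weight_gf_theta_one: "weight_gf (theta_sum 1) (UNIV :: int set) (\<lambda>n. nat (n\<^sup>2))"
  unfolding weight_gf_def
proof (intro allI impI)
  fix t :: complex assume t: "t \<noteq> 0" "norm t < 1"
  have "t powi (n\<^sup>2) = t ^ nat (n\<^sup>2)" for n :: int by (simp add: power_int_def)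
  thus "((\<lambda>n::int. t ^ nat (n\<^sup>2)) has_sum theta_sum 1 t) UNIV"
    using has_sum_theta_sum[OF t(2,1), of 1] by simp
qed

text \<open>The indices \<open>n\<close> and \<open>- n - 1\<close> have the same exponent
  \<open>n^2 + n\<close>, so half of the bilateral sum is a sum over the natural numbers.\<close>

lemma weight_gf_theta_half: "weight_gf (\<lambda>t. theta_sum t t / 2) (UNIV :: nat set) (\<lambda>n. n\<^sup>2 + n)"
  unfolding weight_gf_def
proof (intro allI impI)
  fix t :: complex assume t: "t \<noteq> 0" "norm t < 1"
  define f where "f = (\<lambda>n::int. t powi (n\<^sup>2) * t powi n)"
  have "(f has_sum theta_sum t t) UNIV"
    unfolding f_def using t by (intro has_sum_theta_sum) auto
  then obtain a b where a: "((\<lambda>n::nat. f (int n)) has_sum a) UNIV"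
    and b: "((\<lambda>n::nat. f (- int n - 1)) has_sum b) UNIV" and ab: "theta_sum t t = a + b"
    by (rule has_sum_int_splitE)
  have f: "f k = t powi (k\<^sup>2 + k)" for k
    using t(1) unfolding f_def by (simp only: power_int_add simp_thms)
  have "(- int n - 1)\<^sup>2 + (- int n - 1) = int (n\<^sup>2 + n)" "(int n)\<^sup>2 + int n = int (n\<^sup>2 + n)" for n
    by (simp_all add: power2_eq_square algebra_simps)
  hence "f (- int n - 1) = t ^ (n\<^sup>2 + n)" "f (int n) = t ^ (n\<^sup>2 + n)" for n
    unfolding f by (simp_all only: power_int_of_nat)
  with a b have "((\<lambda>n. t ^ (n\<^sup>2 + n)) has_sum a) UNIV" "((\<lambda>n. t ^ (n\<^sup>2 + n)) has_sum b) UNIV"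
    by simp_all
  moreover from this have "a = b" by (rule has_sum_unique)
  ultimately show "((\<lambda>n. t ^ (n\<^sup>2 + n)) has_sum theta_sum t t / 2) UNIV"
    unfolding ab by simp
qed

text \<open>Euler's Gaussian expansion. The factor
  \<open>1 / qpoch (t\<^sup>2) (t\<^sup>2) k\<close> counts lists of even parts up to
  \<open>2 * k\<close>; coding each as an odd part plus one reuses \<open>has_sum_odd_lists\<close>
  at \<open>w = t\<close>, whence the weight \<open>length xs + sum_list xs\<close>.\<close>

lemma weight_gf_qpoch_inf:
  "weight_gf (\<lambda>t. qpoch_inf (- (t ^ Suc a)) (t\<^sup>2)) (Sigma UNIV odd_lists)
     (\<lambda>(k, xs). k * k + k * a + (length xs + sum_list xs))"
proof (rule weight_gf_Sigma[where f = "\<lambda>k t. t ^ (k * k) * (t ^ a) ^ k / qpoch (t\<^sup>2) (t\<^sup>2) k"])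
  fix k
  show "weight_gf (\<lambda>t. t ^ (k * k) * (t ^ a) ^ k / qpoch (t\<^sup>2) (t\<^sup>2) k) (odd_lists k)
     (\<lambda>xs. case (k, xs) of (k, xs) \<Rightarrow> k * k + k * a + (length xs + sum_list xs))"
    unfolding weight_gf_def prod.case
  proof (intro allI impI)
    fix t :: complex assume t: "t \<noteq> 0" "norm t < 1"
    have "((\<lambda>xs. t ^ (k * k) * (t ^ a) ^ k * (t ^ length xs * t ^ sum_list xs)) has_sum
        (t ^ (k * k) * (t ^ a) ^ k * (1 / qpoch (t * t) (t\<^sup>2) k))) (odd_lists k)"
      by (intro has_sum_cmult_right has_sum_odd_lists) (use t in auto)
    also have "(\<lambda>xs. t ^ (k * k) * (t ^ a) ^ k * (t ^ length xs * t ^ sum_list xs)) =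
        (\<lambda>xs. t ^ (k * k + k * a + (length xs + sum_list xs)))"
      by (simp add: power_add mult.commute flip: power_mult)
    finally show "((\<lambda>xs. t ^ (k * k + k * a + (length xs + sum_list xs))) has_sum
        t ^ (k * k) * (t ^ a) ^ k / qpoch (t\<^sup>2) (t\<^sup>2) k) (odd_lists k)"
      by (simp add: power2_eq_square)
  qed
next
  fix t :: complex assume t: "t \<noteq> 0" "norm t < 1"
  have "((\<lambda>k. t ^ (k * k) * (t ^ a) ^ k / qpoch (t\<^sup>2) (t\<^sup>2) k) has_sum qpoch_inf (- (t ^ a) * t) (t\<^sup>2)) UNIV"
    by (intro norm_summable_imp_has_sum qpoch_euler_abs_summable qpoch_euler_gauss t)
  thus "((\<lambda>k. t ^ (k * k) * (t ^ a) ^ k / qpoch (t\<^sup>2) (t\<^sup>2) k) has_sum qpoch_inf (- (t ^ Suc a)) (t\<^sup>2)) UNIV"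
    by (simp add: mult.commute)
qed

lemma qpoch_minus_subset_sum:
  "qpoch (- (t ^ a)) (t\<^sup>2) m = (\<Sum>S\<in>Pow {..<m}. t ^ (\<Sum>j\<in>S. 2 * j + a))"
proof (induction m)
  case (Suc m)
  have disj: "Pow {..<m} \<inter> insert m ` Pow {..<m} = {}" by auto
  have inj: "inj_on (insert m) (Pow {..<m})"
  proof (rule inj_onI)
    fix S T assume "S \<in> Pow {..<m}" "T \<in> Pow {..<m}" "insert m S = insert m T"
    thus "S = T" using insert_ident[of m S T] by auto
  qed
  have "(\<Sum>S\<in>Pow {..<Suc m}. t ^ (\<Sum>j\<in>S. 2 * j + a)) =
        (\<Sum>S\<in>Pow {..<m}. t ^ (\<Sum>j\<in>S. 2 * j + a)) + (\<Sum>S\<in>insert m ` Pow {..<m}. t ^ (\<Sum>j\<in>S. 2 * j + a))"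
    unfolding lessThan_Suc Pow_insert by (rule sum.union_disjoint) (use disj in auto)
  also have "(\<Sum>S\<in>insert m ` Pow {..<m}. t ^ (\<Sum>j\<in>S. 2 * j + a)) =
             (\<Sum>S\<in>Pow {..<m}. t ^ (2 * m + a) * t ^ (\<Sum>j\<in>S. 2 * j + a))"
  proof (subst sum.reindex[OF inj], rule sum.cong)
    fix S assume "S \<in> Pow {..<m}"
    hence "finite S" "m \<notin> S" by (auto intro: finite_subset)
    thus "((\<lambda>S. t ^ (\<Sum>j\<in>S. 2 * j + a)) \<circ> insert m) S = t ^ (2 * m + a) * t ^ (\<Sum>j\<in>S. 2 * j + a)"
      by (simp add: power_add)
  qed simp
  also have "\<dots> = t ^ (2 * m + a) * (\<Sum>S\<in>Pow {..<m}. t ^ (\<Sum>j\<in>S. 2 * j + a))"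
    by (rule sum_distrib_left [symmetric])
  finally have "(\<Sum>S\<in>Pow {..<Suc m}. t ^ (\<Sum>j\<in>S. 2 * j + a)) = qpoch (- (t ^ a)) (t\<^sup>2) m * (1 + t ^ (2 * m + a))"
    unfolding Suc by (simp add: algebra_simps)
  also have "1 + t ^ (2 * m + a) = 1 - - (t ^ a) * (t\<^sup>2) ^ m"
    by (simp add: power_add power_mult)
  finally show ?case by (simp only: qpoch_Suc)
qed simp

lemma weight_gf_nu_series:
  "weight_gf nu_series (Sigma (UNIV :: nat set) (\<lambda>m. Pow {..<m})) (\<lambda>(m, S). m + (\<Sum>j\<in>S. 2 * j + 1))"
proof (rule weight_gf_Sigma[where f = "\<lambda>m t. t ^ m * qpoch (- t) (t\<^sup>2) m"])
  fix m
  show "weight_gf (\<lambda>t. t ^ m * qpoch (- t) (t\<^sup>2) m) (Pow {..<m}) (\<lambda>S. case (m, S) of (m, S) \<Rightarrow> m + (\<Sum>j\<in>S. 2 * j + 1))"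
    unfolding weight_gf_def prod.case
    using qpoch_minus_subset_sum[of _ 1 m]
    by (auto intro!: has_sum_finiteI simp: sum_distrib_left power_add)
next
  fix t :: complex assume t: "t \<noteq> 0" "norm t < 1"
  obtain A B where "((\<lambda>m. t ^ m * qpoch (- t) (t\<^sup>2) m) has_sum B) UNIV"
    using nu_relation[OF t(2,1)] by metis
  thus "((\<lambda>m. t ^ m * qpoch (- t) (t\<^sup>2) m) has_sum nu_series t) UNIV"
    unfolding nu_series_def by (intro has_sum_infsum has_sum_imp_summable)
qed

lemma weight_gf_psi_series:
  "weight_gf psi_series (Sigma (UNIV :: nat set) (\<lambda>m. Pow {..<m})) (\<lambda>(m, S). Suc m + (\<Sum>j\<in>S. 2 * j + 2))"
proof (rule weight_gf_Sigma[where f = "\<lambda>m t. t ^ Suc m * qpoch (- (t\<^sup>2)) (t\<^sup>2) m"])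
  fix m
  show "weight_gf (\<lambda>t. t ^ Suc m * qpoch (- (t\<^sup>2)) (t\<^sup>2) m) (Pow {..<m}) (\<lambda>S. case (m, S) of (m, S) \<Rightarrow> Suc m + (\<Sum>j\<in>S. 2 * j + 2))"
    unfolding weight_gf_def prod.case qpoch_minus_subset_sum
    by (auto intro!: has_sum_finiteI simp: sum_distrib_left power_add mult.assoc)
next
  fix t :: complex assume t: "t \<noteq> 0" "norm t < 1"
  obtain A B where "((\<lambda>m. t ^ Suc m * qpoch (- (t\<^sup>2)) (t\<^sup>2) m) has_sum B) UNIV"
    using phi_psi_relation[OF t(2,1)] by metis
  thus "((\<lambda>m. t ^ Suc m * qpoch (- (t\<^sup>2)) (t\<^sup>2) m) has_sum psi_series t) UNIV"
    unfolding psi_series_def by (intro has_sum_infsum has_sum_imp_summable)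
qed

section \<open>Positivity in the four residue classes\<close>

lemma replicate_one_in_odd_lists: "k \<ge> 1 \<Longrightarrow> replicate m 1 \<in> odd_lists k"
  using sorted_wrt_ge_replicate_append[of m 1 "[]"] by (auto simp: odd_lists_def)

lemma Nil_in_odd_lists: "[] \<in> odd_lists k"
  by (simp add: odd_lists_def)

text \<open>The product part attains every even weight, already with \<open>k\<close> at most 1, and
  the theta part adds the parity of \<open>k\<close> as the square 0 or 1.\<close>

lemma positive_coefficients_1_mod_8:
  obtains c :: "nat \<Rightarrow> nat" where "\<forall>k. c k > 0"
    "\<forall>t. t \<noteq> 0 \<longrightarrow> norm t < 1 \<longrightarrow>
      ((\<lambda>k. of_nat (c k) * t ^ k) has_sum theta_sum 1 t * qpoch_inf (- (t\<^sup>2)) (t\<^sup>2)) UNIV"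
proof -
  define X where "X = (UNIV :: int set) \<times> Sigma UNIV odd_lists"
  define w :: "int \<times> nat \<times> nat list \<Rightarrow> nat" where
    "w = (\<lambda>(n, z). nat (n\<^sup>2) + (\<lambda>(k, xs). k * k + k * 1 + (length xs + sum_list xs)) z)"
  have "weight_gf (\<lambda>t. theta_sum 1 t * qpoch_inf (- (t ^ Suc 1)) (t\<^sup>2)) X w"
    unfolding X_def w_def by (intro weight_gf_product weight_gf_theta_one weight_gf_qpoch_inf)
  hence gf: "weight_gf (\<lambda>t. theta_sum 1 t * qpoch_inf (- (t\<^sup>2)) (t\<^sup>2)) X w"
    by (simp add: numeral_2_eq_2)
  have even: "\<exists>z\<in>Sigma UNIV odd_lists. (\<lambda>(k, xs). k * k + k * 1 + (length xs + sum_list xs)) z = 2 * j" for j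
  proof (cases j)
    case 0
    thus ?thesis using Nil_in_odd_lists[of 0] by (intro bexI[of _ "(0, [])"]) auto
  next
    case (Suc i)
    thus ?thesis using replicate_one_in_odd_lists[of 1 i]
      by (intro bexI[of _ "(1, replicate i 1)"]) (auto simp: sum_list_replicate)
  qed
  have "card {x\<in>X. w x = k} > 0" for k
  proof -
    obtain z where z: "z \<in> Sigma UNIV odd_lists"
      "(\<lambda>(k, xs). k * k + k * 1 + (length xs + sum_list xs)) z = 2 * (k div 2)" using even by blast
    have "w (int (k mod 2), z) = nat ((int (k mod 2))\<^sup>2) + 2 * (k div 2)" unfolding w_def prod.case z(2) ..
    also have "nat ((int (k mod 2))\<^sup>2) = k mod 2" by (cases "even k") (auto simp: odd_iff_mod_2_eq_one)
    finally have "w (int (k mod 2), z) = k" by simp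
    thus ?thesis using z(1) by (intro weight_gf_card_pos[OF gf]) (auto simp: X_def)
  qed
  thus ?thesis using that[of "\<lambda>k. card {x\<in>X. w x = k}"] weight_gf_power_series[OF gf] by blast
qed

lemma positive_coefficients_2_mod_8:
  obtains c :: "nat \<Rightarrow> nat" where "\<forall>k. c k > 0"
    "\<forall>t. t \<noteq> 0 \<longrightarrow> norm t < 1 \<longrightarrow>
      ((\<lambda>k. of_nat (c k) * t ^ k) has_sum theta_sum t t / 2 * qpoch_inf (- t) (t\<^sup>2)) UNIV"
proof -
  define X where "X = (UNIV :: nat set) \<times> Sigma UNIV odd_lists"
  define w :: "nat \<times> nat \<times> nat list \<Rightarrow> nat" where
    "w = (\<lambda>(n, z). (n\<^sup>2 + n) + (\<lambda>(k, xs). k * k + k * 0 + (length xs + sum_list xs)) z)"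
  have "weight_gf (\<lambda>t. theta_sum t t / 2 * qpoch_inf (- (t ^ Suc 0)) (t\<^sup>2)) X w"
    unfolding X_def w_def by (intro weight_gf_product weight_gf_theta_half weight_gf_qpoch_inf)
  hence gf: "weight_gf (\<lambda>t. theta_sum t t / 2 * qpoch_inf (- t) (t\<^sup>2)) X w"
    by simp
  have ex: "\<exists>x\<in>X. w x = k" for k
  proof -
    \<comment> \<open>The product counts sums of distinct odd parts, and these represent every
      number except 2; that weight comes from \<open>n = 1\<close> in the theta part. The last two
      cases use one and two parts.\<close>
    consider "k = 0" | "k = 2" | j where "k = 2 * j + 1" | j where "k = 2 * j + 4"
    proof (cases "even k")
      case True
      then obtain i where i: "k = 2 * i" by (elim evenE)
      consider "i = 0" | "i = 1" | "i \<ge> 2" by linarith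
      thus ?thesis
      proof cases
        case 3
        hence "k = 2 * (i - 2) + 4" using i by simp
        thus ?thesis by (rule that(4))
      qed (use i that(1,2) in auto)
    next
      case False
      then obtain j where "k = 2 * j + 1" by (elim oddE)
      thus ?thesis by (rule that(3))
    qed
    thus ?thesis
    proof cases
      case 1
      thus ?thesis by (intro bexI[of _ "(0, 0, [])"]) (auto simp: w_def X_def Nil_in_odd_lists)
    next
      case 2
      thus ?thesis by (intro bexI[of _ "(1, 0, [])"]) (auto simp: w_def X_def Nil_in_odd_lists)
    next
      case (3 j)
      thus ?thesis using replicate_one_in_odd_lists[of 1 j]
        by (intro bexI[of _ "(0, 1, replicate j 1)"]) (auto simp: w_def X_def sum_list_replicate)
    next
      case (4 j)
      thus ?thesis using replicate_one_in_odd_lists[of 2 j]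
        by (intro bexI[of _ "(0, 2, replicate j 1)"]) (auto simp: w_def X_def sum_list_replicate)
    qed
  qed
  have "card {x\<in>X. w x = k} > 0" for k
  proof -
    obtain x where "x \<in> X" "w x = k" using ex[of k] by blast
    thus ?thesis by (rule weight_gf_card_pos[OF gf])
  qed
  thus ?thesis using that[of "\<lambda>k. card {x\<in>X. w x = k}"] weight_gf_power_series[OF gf] by blast
qed

lemma positive_coefficients_3_mod_8:
  obtains c :: "nat \<Rightarrow> nat" where "\<forall>k. c k > 0"
    "\<forall>t. t \<noteq> 0 \<longrightarrow> norm t < 1 \<longrightarrow> ((\<lambda>k. of_nat (c k) * t ^ k) has_sum nu_series t) UNIV"
proof -
  have "card {x \<in> Sigma (UNIV :: nat set) (\<lambda>m. Pow {..<m}). (\<lambda>(m, S). m + (\<Sum>j\<in>S. 2 * j + 1)) x = k} > 0" for k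
    by (rule weight_gf_card_pos[OF weight_gf_nu_series, of "(k, {})"]) auto
  thus ?thesis
    using that[of "\<lambda>k. card {x \<in> Sigma (UNIV :: nat set) (\<lambda>m. Pow {..<m}). (\<lambda>(m, S). m + (\<Sum>j\<in>S. 2 * j + 1)) x = k}"]
      weight_gf_power_series[OF weight_gf_nu_series] by blast
qed

text \<open>The series begins with \<open>t\<close>, so its constant coefficient is 0; this is the
  reason for the restriction to positive \<open>n\<close> in the class 0.\<close>

lemma positive_coefficients_0_mod_8:
  obtains c :: "nat \<Rightarrow> nat" where "\<forall>k\<ge>1. c k > 0"
    "\<forall>t. t \<noteq> 0 \<longrightarrow> norm t < 1 \<longrightarrow> ((\<lambda>k. of_nat (c k) * t ^ k) has_sum psi_series t) UNIV"
proof -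
  have "card {x \<in> Sigma (UNIV :: nat set) (\<lambda>m. Pow {..<m}). (\<lambda>(m, S). Suc m + (\<Sum>j\<in>S. 2 * j + 2)) x = k} > 0" if "k \<ge> 1" for k
    by (rule weight_gf_card_pos[OF weight_gf_psi_series, of "(k - 1, {})"]) (use that in auto)
  thus ?thesis
    using that[of "\<lambda>k. card {x \<in> Sigma (UNIV :: nat set) (\<lambda>m. Pow {..<m}). (\<lambda>(m, S). Suc m + (\<Sum>j\<in>S. 2 * j + 2)) x = k}"]
      weight_gf_power_series[OF weight_gf_psi_series] by blast
qed

lemma has_sum_residue_class:
  fixes c :: "nat \<Rightarrow> complex"
  assumes "((\<lambda>k. c k * (q ^ M) ^ k) has_sum F) UNIV" "r < M"
  shows "((\<lambda>n. (if n mod M = r then c (n div M) else 0) * q ^ n) has_sum (q ^ r * F)) UNIV"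
proof -
  have inj: "inj_on (\<lambda>k. M * k + r) UNIV" using assms(2) by (auto simp: inj_on_def)
  have "((\<lambda>k. q ^ r * (c k * (q ^ M) ^ k)) has_sum (q ^ r * F)) UNIV"
    by (rule has_sum_cmult_right[OF assms(1)])
  also have "(\<lambda>k. q ^ r * (c k * (q ^ M) ^ k)) = (\<lambda>n. (if n mod M = r then c (n div M) else 0) * q ^ n) \<circ> (\<lambda>k. M * k + r)"
    using assms(2) by (auto simp: fun_eq_iff power_add power_mult)
  finally have "((\<lambda>n. (if n mod M = r then c (n div M) else 0) * q ^ n) has_sum (q ^ r * F)) (range (\<lambda>k. M * k + r))"
    by (subst has_sum_reindex[OF inj])
  also have "?this \<longleftrightarrow> ?thesis"
  proof (rule has_sum_cong_neutral)
    fix n assume "n \<in> UNIV - range (\<lambda>k. M * k + r)"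
    moreover have "n = M * (n div M) + n mod M" by simp
    ultimately have "n mod M \<noteq> r" by (metis DiffD2 rangeI)
    thus "(if n mod M = r then c (n div M) else 0) * q ^ n = 0" by simp
  qed auto
  finally show ?thesis .
qed

section \<open>The character sum of the odd rank and its generating function\<close>

definition rank_character_sum :: "nat \<Rightarrow> complex" where
  "rank_character_sum n = (\<Sum>S\<in>odd_durfee_symbols n. zeta8 powi odd_rank S)"

text \<open>All symbols are summed at once, grouped first by \<open>D\<close> and then by
  \<open>n\<close>. The regrouping is justified by the sum of absolute values, which is the same
  series with trivial character and \<open>norm q\<close> in place of \<open>q\<close>.\<close>

lemma rank_character_sum_gf:
  assumes q: "norm q < 1" "q \<noteq> 0"
    and R: "((\<lambda>n. q ^ (2 * n\<^sup>2 + 2 * n + 1) / (qpoch (zeta8 * q) (q\<^sup>2) (Suc n) * qpoch (q / zeta8) (q\<^sup>2) (Suc n))) has_sum R) UNIV"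
  shows "((\<lambda>n. rank_character_sum n * q ^ n) has_sum R) UNIV"
proof -
  define e where "e = (\<lambda>D::nat. 2 * D\<^sup>2 + 2 * D + 1)"
  define L where "L = (\<lambda>D. odd_lists (Suc D) \<times> odd_lists (Suc D))"
  define wt where "wt = (\<lambda>u v q (as, bs). (u ^ length as * q ^ sum_list as) * (v ^ length bs * q ^ sum_list bs :: complex))"
  define f where "f = (\<lambda>(D, S). q ^ e D * wt zeta8 (1 / zeta8) q S)"
  have wt: "((wt u v q) has_sum (1 / (qpoch (u * q) (q\<^sup>2) (Suc D) * qpoch (v * q) (q\<^sup>2) (Suc D)))) (L D)"
    if "norm u = 1" "norm v = 1" "norm q < 1" for u v q D
    using has_sum_product_complex[OF has_sum_odd_lists[of q u "Suc D"] has_sum_odd_lists[of q v "Suc D"]] that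
    unfolding L_def wt_def by simp
  define r where "r = complex_of_real (norm q)"
  have r: "norm r < 1" "r \<noteq> 0" using q by (auto simp: r_def)
  have r2: "norm (r\<^sup>2) < 1" using r by (simp add: norm_power power_less_one_iff)
  define V where "V = (\<lambda>D. r ^ e D * (1 / (qpoch (1 * r) (r\<^sup>2) (Suc D) * qpoch (1 * r) (r\<^sup>2) (Suc D))))"
  have "(\<lambda>z. norm (f z)) summable_on (Sigma UNIV L)"
  proof (rule summable_on_SigmaI)
    fix D
    have "((\<lambda>S. r ^ e D * wt 1 1 r S) has_sum V D) (L D)"
      unfolding V_def by (intro has_sum_cmult_right wt) (use r in auto)
    hence "((\<lambda>S. Re (r ^ e D * wt 1 1 r S)) has_sum Re (V D)) (L D)" by (rule has_sum_Re)
    moreover have "Re (r ^ e D * wt 1 1 r S) = norm (f (D, S))" for S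
    proof (cases S)
      case (Pair as bs)
      have "r ^ e D * wt 1 1 r S = of_real (norm q ^ e D * (norm q ^ sum_list as * norm q ^ sum_list bs))"
        by (simp add: Pair wt_def r_def)
      moreover have "norm (f (D, S)) = norm q ^ e D * (norm q ^ sum_list as * norm q ^ sum_list bs)"
        by (simp add: Pair f_def wt_def norm_mult norm_power norm_divide norm_zeta8)
      ultimately show ?thesis by (simp only: Re_complex_of_real)
    qed
    ultimately show "((\<lambda>S. norm (f (D, S))) has_sum Re (V D)) (L D)" by simp
  next
    have ne: "r * (r\<^sup>2) ^ k \<noteq> 1" for k
    proof -
      have "r * (r\<^sup>2) ^ k = r * r ^ (2 * k)" by (simp add: power_mult)
      thus ?thesis using power_Suc_neq_1[OF r(1), of "2 * k"] by (simp only: not_False_eq_True)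
    qed
    obtain B where B: "B > 0" "\<And>n. norm (1 / qpoch r (r\<^sup>2) n) \<le> B"
      using inverse_qpoch_bounded[OF r2 ne] by metis
    have "(\<lambda>D. norm (V D)) summable_on UNIV"
    proof (rule Infinite_Sum.abs_summable_on_comparison_test')
      show "(\<lambda>D. norm r ^ (D\<^sup>2) * 1 ^ D * (B * B)) summable_on UNIV"
        by (intro summable_on_cmult_left summable_nonneg_imp_summable_on summable_gauss) (use r in auto)
      fix D
      have "norm (V D) = norm r ^ e D * (norm (1 / qpoch r (r\<^sup>2) (Suc D)) * norm (1 / qpoch r (r\<^sup>2) (Suc D)))"
        by (simp add: V_def norm_mult norm_divide norm_power)
      also have "\<dots> \<le> norm r ^ (D\<^sup>2) * (B * B)"
        using r B by (intro mult_mono power_decreasing) (auto simp: e_def)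
      finally show "norm (V D) \<le> norm r ^ (D\<^sup>2) * 1 ^ D * (B * B)" by simp
    qed
    hence "V summable_on UNIV" by (rule abs_summable_summable)
    thus "(\<lambda>D. Re (V D)) summable_on UNIV" by (rule summable_on_Re)
  qed auto
  hence sm: "f summable_on (Sigma UNIV L)" by (rule abs_summable_summable)
  have tot: "(f has_sum R) (Sigma UNIV L)"
  proof (rule has_sum_SigmaI[OF _ _ sm])
    fix D
    have "((\<lambda>S. q ^ e D * wt zeta8 (1 / zeta8) q S) has_sum
        (q ^ e D * (1 / (qpoch (zeta8 * q) (q\<^sup>2) (Suc D) * qpoch (1 / zeta8 * q) (q\<^sup>2) (Suc D))))) (L D)"
      by (intro has_sum_cmult_right wt) (use q norm_zeta8 in \<open>auto simp: norm_divide\<close>)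
    thus "((\<lambda>S. f (D, S)) has_sum q ^ e D / (qpoch (zeta8 * q) (q\<^sup>2) (Suc D) * qpoch (q / zeta8) (q\<^sup>2) (Suc D))) (L D)"
      by (simp add: f_def)
  qed (use R in \<open>simp add: e_def\<close>)
  \<comment> \<open>A symbol determines the number it belongs to, so pairing it with that number
    adds no information.\<close>
  have bij: "bij_betw snd (Sigma UNIV odd_durfee_symbols) (Sigma UNIV L)"
  proof (rule bij_betwI[where g = "\<lambda>S. (case S of (D, as, bs) \<Rightarrow> sum_list as + sum_list bs + e D, S)"])
    have le: "x < 2 * Suc D \<longleftrightarrow> x \<le> 2 * D + 1" for x D :: nat by auto
    show "snd \<in> Sigma UNIV odd_durfee_symbols \<rightarrow> Sigma UNIV L"
      by (auto simp: odd_durfee_symbols_def L_def odd_lists_def le simp del: mult_Suc_right)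
    show "(\<lambda>S. (case S of (D, as, bs) \<Rightarrow> sum_list as + sum_list bs + e D, S)) \<in> Sigma UNIV L \<rightarrow> Sigma UNIV odd_durfee_symbols"
      by (auto simp: odd_durfee_symbols_def L_def odd_lists_def e_def le simp del: mult_Suc_right)
    show "(case snd z of (D, as, bs) \<Rightarrow> sum_list as + sum_list bs + e D, snd z) = z" if "z \<in> Sigma UNIV odd_durfee_symbols" for z
      using that by (auto simp: odd_durfee_symbols_def e_def)
  qed auto
  have "((\<lambda>(n, S). f S) has_sum R) (Sigma UNIV odd_durfee_symbols)"
    using iffD2[OF has_sum_reindex_bij_betw[OF bij, of f] tot] by (simp add: case_prod_unfold)
  thus ?thesis
  proof (rule has_sum_SigmaD)
    fix n
    have "((\<lambda>S. f S) has_sum (\<Sum>S\<in>odd_durfee_symbols n. f S)) (odd_durfee_symbols n)"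
      by (rule has_sum_finite[OF finite_odd_durfee_symbols])
    also have "(\<Sum>S\<in>odd_durfee_symbols n. f S) = (\<Sum>S\<in>odd_durfee_symbols n. zeta8 powi odd_rank S * q ^ n)"
    proof (rule sum.cong)
      fix S assume "S \<in> odd_durfee_symbols n"
      then obtain D as bs where S: "S = (D, as, bs)" and n: "n = sum_list as + sum_list bs + e D"
        by (auto simp: odd_durfee_symbols_def e_def)
      have "zeta8 powi odd_rank S = zeta8 ^ length as * (1 / zeta8) ^ length bs"
        using zeta8_nonzero by (simp add: S odd_rank_def power_int_diff power_one_over divide_inverse power_inverse)
      thus "f S = zeta8 powi odd_rank S * q ^ n"
        by (simp add: S f_def wt_def n power_add mult_ac)
    qed simp
    also have "\<dots> = rank_character_sum n * q ^ n"
      by (simp add: rank_character_sum_def sum_distrib_right)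
    finally show "((\<lambda>S. case (n, S) of (n, S) \<Rightarrow> f S) has_sum rank_character_sum n * q ^ n) (odd_durfee_symbols n)"
      by simp
  qed
qed

text \<open>The residues 2 and 6 are absent because their powers are \<open>i\<close> and
  \<open>- i\<close>; the odd residues contribute plus or minus \<open>sqrt 2 / 2\<close>.\<close>

lemma Re_zeta8_powi:
  fixes r :: int
  defines "\<delta> \<equiv> \<lambda>a::int. if [r = a] (mod 8) then 1 else 0 :: real"
  shows "Re (zeta8 powi r) = \<delta> 0 - \<delta> 4 + sqrt 2 / 2 * (\<delta> 1 + \<delta> 7 - \<delta> 3 - \<delta> 5)"
proof -
  define k where "k = r mod 8"
  have z8: "zeta8 powi 8 = 1"
  proof -
    have "zeta8 powi 8 = (zeta8\<^sup>2) ^ 4" by (simp flip: power_mult)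
    thus ?thesis by (simp add: zeta8_square)
  qed
  have "r = 8 * (r div 8) + k" by (simp add: k_def)
  hence "zeta8 powi r = zeta8 powi (8 * (r div 8)) * zeta8 powi k"
    using zeta8_nonzero by (metis power_int_add)
  also have "zeta8 powi (8 * (r div 8)) = 1" unfolding power_int_mult z8 by simp
  finally have zr: "zeta8 powi r = zeta8 powi k" by simp
  have p: "zeta8 ^ 3 = \<i> * zeta8" "zeta8 ^ 4 = -1" "zeta8 ^ 5 = - zeta8" "zeta8 ^ 6 = - \<i>" "zeta8 ^ 7 = - (\<i> * zeta8)"
  proof -
    show 3: "zeta8 ^ 3 = \<i> * zeta8" using power_add[of zeta8 2 1] by (simp add: zeta8_square)
    show 4: "zeta8 ^ 4 = -1" using power_mult[of zeta8 2 2] by (simp add: zeta8_square)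
    show "zeta8 ^ 5 = - zeta8" using power_add[of zeta8 4 1] by (simp add: 4)
    show "zeta8 ^ 6 = - \<i>" using power_add[of zeta8 4 2] by (simp add: 4 zeta8_square)
    show "zeta8 ^ 7 = - (\<i> * zeta8)" using power_add[of zeta8 4 3] by (simp add: 3 4)
  qed
  have z: "Re zeta8 = sqrt 2 / 2" "Im zeta8 = sqrt 2 / 2"
    by (simp_all add: zeta8_def cos_45 sin_45)
  have d: "\<delta> a = (if k = a mod 8 then 1 else 0)" for a
    by (simp add: \<delta>_def cong_def k_def)
  have "k \<ge> 0" "k < 8" by (auto simp: k_def)
  hence "k = 0 \<or> k = 1 \<or> k = 2 \<or> k = 3 \<or> k = 4 \<or> k = 5 \<or> k = 6 \<or> k = 7" by presburger
  thus ?thesis unfolding zr d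
    by (elim disjE) (simp_all add: p z zeta8_square)
qed

lemma Re_rank_character_sum:
  "Re (rank_character_sum n) = real (N0 0 8 n) - real (N0 4 8 n) +
     sqrt 2 / 2 * (real (N0 1 8 n) + real (N0 7 8 n) - real (N0 3 8 n) - real (N0 5 8 n))"
proof -
  have c: "(\<Sum>S\<in>odd_durfee_symbols n. if [odd_rank S = a] (mod 8) then 1 else 0 :: real) = real (N0 a 8 n)" for a
    using finite_odd_durfee_symbols[of n] by (simp add: N0_def flip: sum.inter_filter)
  show ?thesis
    unfolding rank_character_sum_def Re_sum Re_zeta8_powi sum.distrib sum_subtractf sum_distrib_left[symmetric] c ..
qed

section \<open>Symmetry and parity of the odd rank\<close>

lemma N0_uminus: "N0 (- a) M n = N0 a M n"
  unfolding N0_def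
proof (rule bij_betw_same_card)
  show "bij_betw (\<lambda>(D, as, bs). (D, bs, as)) {S \<in> odd_durfee_symbols n. [odd_rank S = - a] (mod M)}
          {S \<in> odd_durfee_symbols n. [odd_rank S = a] (mod M)}"
  proof (rule bij_betwI[where g = "\<lambda>(D, as, bs). (D, bs, as)"])
    have *: "[int l - int m = - b] (mod M) \<longleftrightarrow> [int m - int l = b] (mod M)" for l m b
      using cong_minus_minus_iff[of "int l - int m" "- b" M] by simp
    show "(\<lambda>(D, as, bs). (D, bs, as)) \<in> {S \<in> odd_durfee_symbols n. [odd_rank S = - a] (mod M)} \<rightarrow>
            {S \<in> odd_durfee_symbols n. [odd_rank S = a] (mod M)}"
      by (auto simp: odd_durfee_symbols_def odd_rank_def *)
    show "(\<lambda>(D, as, bs). (D, bs, as)) \<in> {S \<in> odd_durfee_symbols n. [odd_rank S = a] (mod M)} \<rightarrow>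
            {S \<in> odd_durfee_symbols n. [odd_rank S = - a] (mod M)}"
      by (auto simp: odd_durfee_symbols_def odd_rank_def *)
  qed auto
qed

lemma N0_cong: "[a = b] (mod M) \<Longrightarrow> N0 a M n = N0 b M n"
  unfolding N0_def by (metis cong_sym cong_trans)

text \<open>A sum of odd parts has the parity of their number, and \<open>2 D^2 + 2 D + 1\<close> is
  odd, so \<open>n\<close> has the parity of \<open>s + t + 1\<close>.\<close>

lemma even_odd_rank_iff:
  assumes "S \<in> odd_durfee_symbols n"
  shows "even (odd_rank S) \<longleftrightarrow> odd n"
proof -
  obtain D as bs where S: "S = (D, as, bs)" by (metis prod_cases3)
  have par: "even (sum_list xs) \<longleftrightarrow> even (length xs)" if "\<forall>x\<in>set xs. odd x" for xs :: "nat list"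
    using that by (induction xs) auto
  have "n = sum_list as + sum_list bs + 2 * D\<^sup>2 + 2 * D + 1" "\<forall>x\<in>set as. odd x" "\<forall>x\<in>set bs. odd x"
    using assms by (auto simp: S odd_durfee_symbols_def)
  thus ?thesis using par[of as] par[of bs] by (simp add: S odd_rank_def)
qed

lemma N0_eq_0:
  assumes "even a \<longleftrightarrow> even n"
  shows "N0 a 8 n = 0"
proof -
  have "\<not> [odd_rank S = a] (mod 8)" if "S \<in> odd_durfee_symbols n" for S
  proof
    assume "[odd_rank S = a] (mod 8)"
    hence "[odd_rank S = a] (mod 2)" by (rule cong_dvd_modulus) simp
    hence "even (odd_rank S) \<longleftrightarrow> even a" using cong_dvd_iff by blast
    thus False using even_odd_rank_iff[OF that] assms by simp
  qed
  hence "{S \<in> odd_durfee_symbols n. [odd_rank S = a] (mod 8)} = {}" by blast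
  thus ?thesis by (simp only: N0_def card.empty)
qed

lemma rank_difference_odd:
  assumes "odd n"
  shows "real (N0 0 8 n) - real (N0 4 8 n) = Re (rank_character_sum n)"
  using assms by (simp add: Re_rank_character_sum N0_eq_0)

text \<open>For even \<open>n\<close> only odd ranks occur, and swapping the rows identifies the
  residues 7 and 5 with 1 and 3; this doubling turns \<open>sqrt 2 / 2\<close> into
  \<open>sqrt 2\<close>.\<close>

lemma rank_difference_even:
  assumes "even n"
  shows "sqrt 2 * (real (N0 1 8 n) - real (N0 3 8 n)) = Re (rank_character_sum n)"
proof -
  have "N0 7 8 n = N0 (- 1) 8 n" "N0 5 8 n = N0 (- 3) 8 n"
    by (rule N0_cong, simp add: cong_def)+
  hence "N0 7 8 n = N0 1 8 n" "N0 5 8 n = N0 3 8 n" by (simp_all add: N0_uminus)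
  thus ?thesis using assms by (simp add: Re_rank_character_sum N0_eq_0 algebra_simps)
qed

theorem theorem1p11:
  shows "(\<forall>n::nat. (\<forall>r\<in>{1, 3}. N0 0 8 (8 * n + r) > N0 4 8 (8 * n + r)) \<and>
            N0 1 8 (8 * n + 2) > N0 3 8 (8 * n + 2)) \<and>
         (\<forall>n::nat. n \<ge> 1 \<longrightarrow> N0 1 8 (8 * n) > N0 3 8 (8 * n))"
proof -
  obtain c1 :: "nat \<Rightarrow> nat" where c1: "\<And>k. c1 k > 0" and
    g1: "\<And>t. t \<noteq> 0 \<Longrightarrow> norm t < 1 \<Longrightarrow>
      ((\<lambda>k. of_nat (c1 k) * t ^ k) has_sum theta_sum 1 t * qpoch_inf (- (t\<^sup>2)) (t\<^sup>2)) UNIV"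
    using positive_coefficients_1_mod_8 by blast
  obtain c2 :: "nat \<Rightarrow> nat" where c2: "\<And>k. c2 k > 0" and
    g2: "\<And>t. t \<noteq> 0 \<Longrightarrow> norm t < 1 \<Longrightarrow>
      ((\<lambda>k. of_nat (c2 k) * t ^ k) has_sum theta_sum t t / 2 * qpoch_inf (- t) (t\<^sup>2)) UNIV"
    using positive_coefficients_2_mod_8 by blast
  obtain c3 :: "nat \<Rightarrow> nat" where c3: "\<And>k. c3 k > 0" and
    g3: "\<And>t. t \<noteq> 0 \<Longrightarrow> norm t < 1 \<Longrightarrow> ((\<lambda>k. of_nat (c3 k) * t ^ k) has_sum nu_series t) UNIV"
    using positive_coefficients_3_mod_8 by blast
  obtain c0 :: "nat \<Rightarrow> nat" where c0: "\<And>k. k \<ge> 1 \<Longrightarrow> c0 k > 0" and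
    g0: "\<And>t. t \<noteq> 0 \<Longrightarrow> norm t < 1 \<Longrightarrow> ((\<lambda>k. of_nat (c0 k) * t ^ k) has_sum psi_series t) UNIV"
    using positive_coefficients_0_mod_8 by blast
  define \<delta> :: "nat \<Rightarrow> (nat \<Rightarrow> nat) \<Rightarrow> nat \<Rightarrow> complex" where
    "\<delta> = (\<lambda>r c n. if n mod 8 = r then of_nat (c (n div 8)) else 0)"
  \<comment> \<open>The coefficients of the closed form: each of the four series occupies its own
    residue class modulo 8, so at most one summand is nonzero.\<close>
  define e where "e = (\<lambda>n. \<delta> 1 c1 n + \<delta> 3 c3 n + of_real (sqrt 2) * (\<delta> 2 c2 n + \<delta> 0 c0 n))"
  have "(\<lambda>n. (rank_character_sum n - e n) * q ^ n) sums 0" if q: "q \<noteq> 0" "norm q < 1" for q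
  proof -
    have q8: "q ^ 8 \<noteq> 0" "norm (q ^ 8) < 1" using q by (auto simp: norm_power power_less_one_iff)
    note h1 = has_sum_residue_class[OF g1[OF q8], of 1]
    note h2 = has_sum_residue_class[OF g2[OF q8], of 2]
    note h3 = has_sum_residue_class[OF g3[OF q8], of 3]
    note h0 = has_sum_residue_class[OF g0[OF q8], of 0]
    define R where "R = q * (theta_sum 1 (q ^ 8) * qpoch_inf (- ((q ^ 8)\<^sup>2)) ((q ^ 8)\<^sup>2)) + q ^ 3 * nu_series (q ^ 8) +
      of_real (sqrt 2) * (q\<^sup>2 * (theta_sum (q ^ 8) (q ^ 8) / 2 * qpoch_inf (- (q ^ 8)) ((q ^ 8)\<^sup>2)) + psi_series (q ^ 8))"
    have "((\<lambda>n. \<delta> 1 c1 n * q ^ n + \<delta> 3 c3 n * q ^ n + of_real (sqrt 2) * (\<delta> 2 c2 n * q ^ n + \<delta> 0 c0 n * q ^ n)) has_sum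
       (q ^ 1 * (theta_sum 1 (q ^ 8) * qpoch_inf (- ((q ^ 8)\<^sup>2)) ((q ^ 8)\<^sup>2)) + q ^ 3 * nu_series (q ^ 8) +
      of_real (sqrt 2) * (q ^ 2 * (theta_sum (q ^ 8) (q ^ 8) / 2 * qpoch_inf (- (q ^ 8)) ((q ^ 8)\<^sup>2)) + q ^ 0 * psi_series (q ^ 8)))) UNIV"
      unfolding \<delta>_def by (intro has_sum_add has_sum_cmult_right h1 h2 h3 h0) auto
    also have "(\<lambda>n. \<delta> 1 c1 n * q ^ n + \<delta> 3 c3 n * q ^ n + of_real (sqrt 2) * (\<delta> 2 c2 n * q ^ n + \<delta> 0 c0 n * q ^ n)) = (\<lambda>n. e n * q ^ n)"
      by (simp add: e_def algebra_simps)
    finally have E: "((\<lambda>n. e n * q ^ n) has_sum R) UNIV"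
      by (simp only: R_def power_one_right power_0 mult_1_left)
    have T: "((\<lambda>n. rank_character_sum n * q ^ n) has_sum R) UNIV"
      unfolding R_def by (rule rank_character_sum_gf[OF q(2,1) rank_series_zeta8[OF q(2,1)]])
    have "(\<lambda>n. rank_character_sum n * q ^ n - e n * q ^ n) sums (R - R)"
      by (intro sums_diff has_sum_imp_sums E T)
    thus ?thesis by (simp add: left_diff_distrib)
  qed
  hence "rank_character_sum n - e n = 0" for n by (rule power_series_coeff_eq_0)
  hence T: "rank_character_sum n = e n" for n by simp
  have md: "(8 * n + r) mod 8 = r" "(8 * n + r) div 8 = n" if "r < 8" for n r :: nat
    using that by auto
  have e: "e (8 * n + r) = (if r = 1 then of_nat (c1 n) else 0) + (if r = 3 then of_nat (c3 n) else 0) +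
      of_real (sqrt 2) * ((if r = 2 then of_nat (c2 n) else 0) + (if r = 0 then of_nat (c0 n) else 0))" if "r < 8" for n r
    unfolding e_def \<delta>_def md[OF that] ..
  have less: "x < y" if "real y - real x = Re (of_nat c)" "c > 0" for x y c :: nat
    using that by simp
  have less': "x < y" if "sqrt 2 * (real y - real x) = Re (of_real (sqrt 2) * of_nat c)" "c > 0" for x y c :: nat
    using that by simp
  have 1: "N0 0 8 (8 * n + 1) > N0 4 8 (8 * n + 1)" for n
  proof (rule less[OF _ c1[of n]])
    have "real (N0 0 8 (8 * n + 1)) - real (N0 4 8 (8 * n + 1)) = Re (e (8 * n + 1))"
      unfolding T[symmetric] by (rule rank_difference_odd) simp
    also have "e (8 * n + 1) = of_nat (c1 n)" by (subst e) simp_all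
    finally show "real (N0 0 8 (8 * n + 1)) - real (N0 4 8 (8 * n + 1)) = Re (of_nat (c1 n))" .
  qed
  have 3: "N0 0 8 (8 * n + 3) > N0 4 8 (8 * n + 3)" for n
  proof (rule less[OF _ c3[of n]])
    have "real (N0 0 8 (8 * n + 3)) - real (N0 4 8 (8 * n + 3)) = Re (e (8 * n + 3))"
      unfolding T[symmetric] by (rule rank_difference_odd) simp
    also have "e (8 * n + 3) = of_nat (c3 n)" by (subst e) simp_all
    finally show "real (N0 0 8 (8 * n + 3)) - real (N0 4 8 (8 * n + 3)) = Re (of_nat (c3 n))" .
  qed
  have 2: "N0 1 8 (8 * n + 2) > N0 3 8 (8 * n + 2)" for n
  proof (rule less'[OF _ c2[of n]])
    have "sqrt 2 * (real (N0 1 8 (8 * n + 2)) - real (N0 3 8 (8 * n + 2))) = Re (e (8 * n + 2))"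
      unfolding T[symmetric] by (rule rank_difference_even) simp
    also have "e (8 * n + 2) = of_real (sqrt 2) * of_nat (c2 n)" by (subst e) simp_all
    finally show "sqrt 2 * (real (N0 1 8 (8 * n + 2)) - real (N0 3 8 (8 * n + 2))) = Re (of_real (sqrt 2) * of_nat (c2 n))" .
  qed
  have 0: "N0 1 8 (8 * n) > N0 3 8 (8 * n)" if "n \<ge> 1" for n
  proof (rule less'[OF _ c0[OF that]])
    have "sqrt 2 * (real (N0 1 8 (8 * n)) - real (N0 3 8 (8 * n))) = Re (e (8 * n))"
      unfolding T[symmetric] by (rule rank_difference_even) simp
    also have "e (8 * n) = of_real (sqrt 2) * of_nat (c0 n)" using e[of 0 n] by simp
    finally show "sqrt 2 * (real (N0 1 8 (8 * n)) - real (N0 3 8 (8 * n))) = Re (of_real (sqrt 2) * of_nat (c0 n))" .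
  qed
  show ?thesis using 0 1 2 3 by auto
qed

end
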